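(* Let $n\ge 1$. Let $A$ be a symmetric real $n\times n$ matrix of symmetric tropical rank $2$. Then the associated bicolored tree $T_A$ is an $n+n$ symbic tree. Conversely, every $n+n$ symbic tree is (isomorphic, as a leaf-labelled metric tree, to) $T_A$ for some symmetric real $n\times n$ matrix $A$ of symmetric tropical rank $2$, and the matrix $A$ is unique up to simultaneous tropical scaling of rows and columns.
   Context: Tropical arithmetic is $a\oplus b=\min(a,b)$, $a\odot b=a+b$ on $\mathbb{R}$. **Symmetric tropical rank.** Let $x_{ij}=x_{ji}$, $1\le i\le j\le n$, be the $\binom{n+1}{2}$ variables of a generic symmetric matrix. A symmetric real $n\times n$ matrix $A$ *has symmetric tropical rank $r$* if for every $(r+1)\times(r+1)$ minor of the generic symmetric matrix, regarded as a polynomial in the $\binom{n+1}{2}$ variables $x_{ij}$ ($i\le j$) (in characteristic $0$, trivial valuation), the minimum over its distinct monomials $\prod x_{ij}^{m_{ij}}$ of $\sum m_{ij}A_{ij}$ is attained by at least two distinct monomials. (With this convention the condition for $r$ means rank at most $r$.) **The tree $T_A$.** Let $A$ be a real $r\times n$ matrix of tropical rank at most $2$ (for a symmetric $A$ this is implied by symmetric tropical rank $2$). Let $P$ be the tropical convex hull of the columns of $A$, i.e. the set of all tropical linear combinations of the columns, viewed in $\mathbb{R}^r/\mathbb{R}(1,\dots,1)$. It is a contractible polyhedral complex of dimension at most one, i.e. a union of line segments forming a tree, with lengths measured by the tropical Hilbert metric $d(x,y)=\max_i(x_i-y_i)-\min_i(x_i-y_i)$. There is a unique way to attach to $P$ one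 infinite ray in each coordinate direction $\mathbf e_1,\dots,\mathbf e_r$ so that the result is balanced, i.e. at every vertex the primitive lattice directions of the emanating edges sum to an element of $\mathbb{R}(1,\dots,1)$. The tree $T_A$ is obtained from the metric tree $P$ by attaching, for each $i=1,\dots,n$, a leaf labelled $i$ at the location of the $i$-th column, and, for each $j=1,\dots,r$, a leaf labelled $j'$ at the point where the ray $\mathbf e_j$ is attached. The edges coming from $P$ are the internal edges; the leaf edges are considered to have infinite length (their lengths are disregarded). Labels $i$ and $j'$ are said to have different colors. **Symbic trees.** A split of a tree is a partition of the leaf labels obtained by removing an internal (non-leaf) edge. An *$n+n$ symbic tree* is a metric tree on leaves labelled $1,\dots,n,1',\dots,n'$ (no unlabelled vertices of degree 2, lengths of leaf edges disregarded) such that (1) each split contains both colors on both sides; (2) the internal edges have positive lengths; (3) the metric tree is symmetric with respect to the involution swapping $i$ and $i'$ for all $i$; (4) the set of fixed points of this involution on the tree forms a path (possibly a single point, possibly the midpoint of an edge). **Simultaneous tropical scaling** of a symmetric matrix means, for some index $i$ and real $c$, adding $c$ to all entries of the $i$-th row and to all entries of the $i$-th column (hence adding $2c$ to the $(i,i)$ entry), and compositions of such operations. *)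

theory Defs
  imports
    "HOL-Library.Poly_Mapping"
    "HOL-Library.FuncSet"
    "Jordan_Normal_Form.Determinant"
    "Jordan_Normal_Form.DL_Submatrix"
begin

section \<open>Symmetric tropical rank\<close>

text \<open>
  Polynomials over \<open>\<rat>\<close> in variables \<open>x i j\<close>: a monomial is a finitely supported
  exponent function on index pairs, a polynomial a finitely supported coefficient function on
  monomials. In particular \<open>Poly_Mapping.keys p\<close> is the set of distinct monomials that
  survive in \<open>p\<close> with a nonzero coefficient.
\<close>

type_synonym monomial = "(nat \<times> nat) \<Rightarrow>\<^sub>0 nat"
type_synonym polynomial = "monomial \<Rightarrow>\<^sub>0 rat"

definition variable :: "nat \<times> nat \<Rightarrow> polynomial" where
  "variable ij = Poly_Mapping.single (Poly_Mapping.single ij 1) 1"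

definition generic_symmetric :: "nat \<Rightarrow> polynomial mat" where
  "generic_symmetric n = mat n n (\<lambda>(i, j). variable (min i j, max i j))"

definition tropical_weight :: "real mat \<Rightarrow> monomial \<Rightarrow> real" where
  "tropical_weight A m =
     (\<Sum>ij\<in>Poly_Mapping.keys m. of_nat (Poly_Mapping.lookup m ij) * A $$ ij)"

definition tropically_vanishes :: "polynomial \<Rightarrow> real mat \<Rightarrow> bool" where
  "tropically_vanishes p A \<longleftrightarrow>
     (\<exists>m\<in>Poly_Mapping.keys p. \<exists>m'\<in>Poly_Mapping.keys p. m \<noteq> m' \<and>
        tropical_weight A m = tropical_weight A m' \<and>
        (\<forall>q\<in>Poly_Mapping.keys p. tropical_weight A m \<le> tropical_weight A q))"

definition has_symmetric_tropical_rank :: "real mat \<Rightarrow> nat \<Rightarrow> bool" where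
  "has_symmetric_tropical_rank A r \<longleftrightarrow>
     (\<forall>I J. I \<subseteq> {..<dim_row A} \<and> J \<subseteq> {..<dim_row A} \<and> card I = r + 1 \<and> card J = r + 1 \<longrightarrow>
        tropically_vanishes (det (submatrix (generic_symmetric (dim_row A)) I J)) A)"

definition symmetric_rank2_matrix :: "nat \<Rightarrow> real mat \<Rightarrow> bool" where
  "symmetric_rank2_matrix n A \<longleftrightarrow>
     A \<in> carrier_mat n n \<and> transpose_mat A = A \<and> has_symmetric_tropical_rank A 2"


section \<open>Simultaneous tropical scaling\<close>

definition scale_index :: "nat \<Rightarrow> real \<Rightarrow> real mat \<Rightarrow> real mat" where
  "scale_index i c A = mat (dim_row A) (dim_col A)
     (\<lambda>(k, l). A $$ (k, l) + (if k = i then c else 0) + (if l = i then c else 0))"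

definition simultaneous_scaling :: "real mat \<Rightarrow> real mat \<Rightarrow> bool" where
  "simultaneous_scaling = (\<lambda>A B. \<exists>i<dim_row A. \<exists>c. B = scale_index i c A)\<^sup>*\<^sup>*"


section \<open>Leaf-labelled metric trees\<close>

text \<open>\<open>Primed i\<close> is the label \<open>i'\<close>. Indices start at 0.\<close>

datatype label = Unprimed nat | Primed nat

fun swap_label :: "label \<Rightarrow> label" where
  "swap_label (Unprimed i) = Primed i"
| "swap_label (Primed i) = Unprimed i"

definition labels :: "nat \<Rightarrow> nat \<Rightarrow> label set" where
  "labels n r = Unprimed ` {..<n} \<union> Primed ` {..<r}"

text \<open>
  The field \<open>len\<close> is only meaningful on internal edges; its values on leaf edges are
  ignored by everything below.
\<close>

record 'v ltree =
  nodes :: "'v set"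
  edges :: "'v set set"
  len :: "'v set \<Rightarrow> real"
  leaf :: "label \<Rightarrow> 'v"

definition degree :: "('v, 'm) ltree_scheme \<Rightarrow> 'v \<Rightarrow> nat" where
  "degree T v = card {e \<in> edges T. v \<in> e}"

definition internal_edges :: "('v, 'm) ltree_scheme \<Rightarrow> 'v set set" where
  "internal_edges T = {e \<in> edges T. \<forall>v\<in>e. degree T v \<noteq> 1}"

definition is_path :: "('v, 'm) ltree_scheme \<Rightarrow> 'v list \<Rightarrow> bool" where
  "is_path T vs \<longleftrightarrow> vs \<noteq> [] \<and> distinct vs \<and> set vs \<subseteq> nodes T \<and>
     (\<forall>k. Suc k < length vs \<longrightarrow> {vs ! k, vs ! Suc k} \<in> edges T)"

definition is_tree :: "('v, 'm) ltree_scheme \<Rightarrow> bool" where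
  "is_tree T \<longleftrightarrow> finite (nodes T) \<and> nodes T \<noteq> {} \<and>
     edges T \<subseteq> {{u, v} | u v. u \<in> nodes T \<and> v \<in> nodes T \<and> u \<noteq> v} \<and>
     (\<forall>u\<in>nodes T. \<forall>v\<in>nodes T. \<exists>!vs. is_path T vs \<and> hd vs = u \<and> last vs = v)"

definition leaf_labelled_tree :: "label set \<Rightarrow> ('v, 'm) ltree_scheme \<Rightarrow> bool" where
  "leaf_labelled_tree L T \<longleftrightarrow> is_tree T \<and>
     bij_betw (leaf T) L {v \<in> nodes T. degree T v = 1} \<and>
     (\<forall>v\<in>nodes T. degree T v \<noteq> 2)"

definition ltree_iso_map ::
  "label set \<Rightarrow> ('v, 'm) ltree_scheme \<Rightarrow> ('w, 'k) ltree_scheme \<Rightarrow> (label \<Rightarrow> label) \<Rightarrow> ('v \<Rightarrow> 'w) \<Rightarrow> bool" where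
  "ltree_iso_map L S T \<pi> f \<longleftrightarrow> bij_betw f (nodes S) (nodes T) \<and>
     (\<forall>u\<in>nodes S. \<forall>v\<in>nodes S. {u, v} \<in> edges S \<longleftrightarrow> {f u, f v} \<in> edges T) \<and>
     (\<forall>e\<in>internal_edges S. len T (f ` e) = len S e) \<and>
     (\<forall>l\<in>L. f (leaf S l) = leaf T (\<pi> l))"

definition ltree_isomorphic ::
  "label set \<Rightarrow> ('v, 'm) ltree_scheme \<Rightarrow> ('w, 'k) ltree_scheme \<Rightarrow> bool" where
  "ltree_isomorphic L S T \<longleftrightarrow> (\<exists>f. ltree_iso_map L S T id f)"


section \<open>Symbic trees\<close>

text \<open>The labels on the component of \<open>T\<close> minus the edge \<open>e\<close> that contains \<open>u\<close>.\<close>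

definition side :: "label set \<Rightarrow> ('v, 'm) ltree_scheme \<Rightarrow> 'v set \<Rightarrow> 'v \<Rightarrow> label set" where
  "side L T e u = {l \<in> L. (u, leaf T l) \<in> {(a, b). {a, b} \<in> edges T - {e}}\<^sup>*}"

definition splits :: "label set \<Rightarrow> ('v, 'm) ltree_scheme \<Rightarrow> label set set set" where
  "splits L T = {side L T e ` e | e. e \<in> internal_edges T}"

text \<open>
  Points of the tree as a topological space are given by barycentric coordinates: \<open>cell e\<close> is the
  closed edge \<open>e\<close>, and \<open>cell {v}\<close> the single point \<open>v\<close>. On an internal edge these coordinates are
  proportional to length, so the midpoint has both coordinates equal to \<open>1/2\<close>.
\<close>

definition cell :: "'v set \<Rightarrow> ('v \<Rightarrow> real) set" where
  "cell e = {p. (\<forall>v. 0 \<le> p v) \<and> (\<forall>v. v \<notin> e \<longrightarrow> p v = 0) \<and> (\<Sum>v\<in>e. p v) = 1}"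

definition tree_points :: "('v, 'm) ltree_scheme \<Rightarrow> ('v \<Rightarrow> real) set" where
  "tree_points T = (\<Union>v\<in>nodes T. cell {v}) \<union> (\<Union>e\<in>edges T. cell e)"

definition path_points :: "'v list \<Rightarrow> ('v \<Rightarrow> real) set" where
  "path_points vs = (\<Union>v\<in>set vs. cell {v}) \<union>
     (\<Union>k\<in>{k. Suc k < length vs}. cell {vs ! k, vs ! Suc k})"

definition fixed_points :: "('v, 'm) ltree_scheme \<Rightarrow> ('v \<Rightarrow> 'v) \<Rightarrow> ('v \<Rightarrow> real) set" where
  "fixed_points T \<sigma> = {p \<in> tree_points T. \<forall>v\<in>nodes T. p (\<sigma> v) = p v}"

text \<open>
  The singleton disjunct is needed for the midpoint of an edge flipped by the involution: it is
  the only fixed point and not a node.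
\<close>

definition forms_path :: "('v, 'm) ltree_scheme \<Rightarrow> ('v \<Rightarrow> real) set \<Rightarrow> bool" where
  "forms_path T F \<longleftrightarrow>
     (\<exists>p\<in>tree_points T. F = {p}) \<or> (\<exists>vs. is_path T vs \<and> F = path_points vs)"

definition symbic_tree :: "nat \<Rightarrow> ('v, 'm) ltree_scheme \<Rightarrow> bool" where
  "symbic_tree n T \<longleftrightarrow> leaf_labelled_tree (labels n n) T \<and>
     (\<forall>S\<in>splits (labels n n) T. \<forall>B\<in>S. (\<exists>i. Unprimed i \<in> B) \<and> (\<exists>j. Primed j \<in> B)) \<and>
     (\<forall>e\<in>internal_edges T. 0 < len T e) \<and>
     (\<exists>\<sigma>. ltree_iso_map (labels n n) T T swap_label \<sigma> \<and> (\<forall>v\<in>nodes T. \<sigma> (\<sigma> v) = v) \<and>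
          forms_path T (fixed_points T \<sigma>))"


section \<open>The tree of a matrix\<close>

text \<open>
  A point of \<open>\<real>\<^sup>r/\<real>(1,\<dots>,1)\<close> is represented by its unique representative whose coordinate with
  index 0 vanishes, and likewise for the lattice \<open>\<int>\<^sup>r/\<int>(1,\<dots>,1)\<close>.
\<close>

definition torus_rep :: "real vec \<Rightarrow> real vec" where
  "torus_rep x = vec (dim_vec x) (\<lambda>i. x $ i - x $ 0)"

definition tropical_combination :: "real mat \<Rightarrow> (nat \<Rightarrow> real) \<Rightarrow> real vec" where
  "tropical_combination A c = vec (dim_row A) (\<lambda>i. MIN j\<in>{..<dim_col A}. c j + A $$ (i, j))"

definition tropical_hull :: "real mat \<Rightarrow> real vec set" where
  "tropical_hull A = torus_rep ` range (tropical_combination A)"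

definition hilbert_dist :: "real vec \<Rightarrow> real vec \<Rightarrow> real" where
  "hilbert_dist x y =
     (MAX i\<in>{..<dim_vec x}. x $ i - y $ i) - (MIN i\<in>{..<dim_vec x}. x $ i - y $ i)"

text \<open>
  The primitive lattice directions of the edges of \<open>P\<close> emanating from \<open>p\<close>. For a representative
  with vanishing coordinate 0, being primitive in \<open>\<int>\<^sup>r/\<int>(1,\<dots>,1)\<close> means that the gcd of the
  entries is 1. At a point in the interior of an edge this gives two opposite directions.
\<close>

definition edge_directions :: "nat \<Rightarrow> real vec set \<Rightarrow> real vec \<Rightarrow> int vec set" where
  "edge_directions r P p = {v \<in> carrier_vec r. v $ 0 = 0 \<and> (GCD i\<in>{..<r}. v $ i) = 1 \<and>
     (\<exists>\<epsilon>>0. \<forall>t. 0 \<le> t \<and> t \<le> \<epsilon> \<longrightarrow> p + t \<cdot>\<^sub>v map_vec of_int v \<in> P)}"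

text \<open>
  \<open>a j\<close> is the point of the hull at which the ray in direction \<open>e\<^sub>j\<close> is attached. Points of the
  hull that are not vertices satisfy the balancing condition automatically.
\<close>

definition balanced_rays :: "real mat \<Rightarrow> (nat \<Rightarrow> real vec) \<Rightarrow> bool" where
  "balanced_rays A a \<longleftrightarrow> a \<in> {..<dim_row A} \<rightarrow>\<^sub>E tropical_hull A \<and>
     (\<forall>p\<in>tropical_hull A. \<exists>c. \<forall>i<dim_row A.
        (\<Sum>v\<in>edge_directions (dim_row A) (tropical_hull A) p. v $ i) +
        (\<Sum>j\<in>{j. j < dim_row A \<and> a j = p}. unit_vec (dim_row A) j $ i) = c)"

definition ray_base :: "real mat \<Rightarrow> nat \<Rightarrow> real vec" where
  "ray_base A = (THE a. balanced_rays A a)"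

fun label_base :: "real mat \<Rightarrow> label \<Rightarrow> real vec" where
  "label_base A (Unprimed i) = torus_rep (col A i)"
| "label_base A (Primed j) = ray_base A j"

definition valence :: "real mat \<Rightarrow> real vec \<Rightarrow> nat" where
  "valence A p = card (edge_directions (dim_row A) (tropical_hull A) p) +
     card {l \<in> labels (dim_col A) (dim_row A). label_base A l = p}"

text \<open>
  The nodes are the leaves (\<open>Inl\<close>) and the points of the hull of valence other than 2 (\<open>Inr\<close>).
  Two nodes are adjacent if no further non-leaf node lies between them on the tree; on the hull,
  which is a tree whose path metric is \<open>hilbert_dist\<close>, betweenness is equality in the triangle
  inequality. This also covers the hull of a \<open>1 \<times> 1\<close> matrix, a single point of valence 2, where
  the two leaves become adjacent. The length of an edge is the distance of its ends, written here
  as the diameter of the edge.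
\<close>

fun node_base :: "real mat \<Rightarrow> label + real vec \<Rightarrow> real vec" where
  "node_base A (Inl l) = label_base A l"
| "node_base A (Inr p) = p"

definition node_dist :: "real mat \<Rightarrow> label + real vec \<Rightarrow> label + real vec \<Rightarrow> real" where
  "node_dist A u v = hilbert_dist (node_base A u) (node_base A v)"

definition inner_nodes :: "real mat \<Rightarrow> (label + real vec) set" where
  "inner_nodes A = Inr ` {p \<in> tropical_hull A. valence A p \<noteq> 2}"

definition tree_nodes :: "real mat \<Rightarrow> (label + real vec) set" where
  "tree_nodes A = Inl ` labels (dim_col A) (dim_row A) \<union> inner_nodes A"

definition tree_of :: "real mat \<Rightarrow> (label + real vec) ltree" where
  "tree_of A = \<lparr>
     nodes = tree_nodes A,
     edges = {{u, v} | u v. u \<in> tree_nodes A \<and> v \<in> tree_nodes A \<and> u \<noteq> v \<and>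
       (\<forall>w\<in>inner_nodes A. node_dist A u w + node_dist A w v = node_dist A u v \<longrightarrow> w \<in> {u, v})},
     len = (\<lambda>e. MAX (u, v)\<in>e \<times> e. node_dist A u v),
     leaf = Inl\<rparr>"

end

theory Submission
  imports Defs
begin

text \<open>
  In a bicolored tree let \<open>D i j'\<close> be the distance of the leaves \<open>i\<close> and \<open>j'\<close>. A matrix \<open>A\<close> of tropical
  rank 2 satisfies \<open>A $$ (j, i) = - D i j' / 2 + u i + v j\<close> on its tree, and conversely every distance
  in the tree is a maximum of expressions in four entries of \<open>A\<close>; so tree and matrix determine each
  other up to scaling, and transposing a symmetric matrix swaps the colours of its tree.

  The hull is a tree because three vectors whose \<open>3 \<times> 3\<close> minors are tropically singular are tropically
  dependent, which provides a median of any three points; a metric with medians whose segments are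
  linearly ordered satisfies the four-point condition. At a point of the hull the edges emanate
  along pairwise disjoint coordinate sets, and the ray \<open>e\<^sub>j\<close> has to be attached where none of
  these sets contains \<open>j\<close>.

  In a principal minor of the generic symmetric matrix the two 3-cycles give the same monomial. It is
  the only minimal one exactly if the three leaves hang off three branches of the fixed tree of the
  involution, so the principal minors say that the fixed points form a path.
\<close>

section \<open>Tree metrics\<close>

text \<open>Lengths of leaf edges are disregarded, but leaves have to be nodes of their own; so
  every leaf is placed at distance 1 from its base, both for abstract trees and for trees of
  matrices. Each inner node is then the median of three leaves, and equality of leaf distances
  produces an isomorphism. The same reconstruction, applied to a single tree with
  \<open>swap_label\<close> as relabelling, produces the involution. The factor 1/2 arises because
  the coordinates in a set S move at unit speed along an edge of the hull: on the way from
  \<open>base j\<close> to \<open>base l\<close> the difference of coordinates l and j changes by t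
  after length t, while the difference of the distances to the two bases changes by 2t. The matrix
  only sees distances between different colours. A distance between equal colours becomes visible
  through leaves of the other colour beyond both ends. For a matrix such leaves exist by the
  geometry of the hull, for an abstract tree by the split condition. Equal trees give matrices that
  agree up to separate summands for rows and columns; symmetry allows both to be replaced by their
  mean.\<close>

definition between :: "('p \<Rightarrow> 'p \<Rightarrow> real) \<Rightarrow> 'p \<Rightarrow> 'p \<Rightarrow> 'p \<Rightarrow> bool" where
  "between d a x b \<longleftrightarrow> d a x + d x b = d a b"

text \<open>The four-point condition alone only says that \<open>M\<close> embeds isometrically in a
  tree; \<open>median\<close> adds that the branch points spanned by \<open>M\<close> belong to
  \<open>M\<close>, so that a finite \<open>M\<close> is a full vertex set. The triangle inequality
  is the four-point condition with a repeated point, see \<open>triangle\<close>.\<close>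

locale tree_metric =
  fixes M :: "'p set" and d :: "'p \<Rightarrow> 'p \<Rightarrow> real"
  assumes dist_self: "x \<in> M \<Longrightarrow> d x x = 0"
    and dist_pos: "x \<in> M \<Longrightarrow> y \<in> M \<Longrightarrow> x \<noteq> y \<Longrightarrow> 0 < d x y"
    and dist_sym: "x \<in> M \<Longrightarrow> y \<in> M \<Longrightarrow> d x y = d y x"
    and four_point: "a \<in> M \<Longrightarrow> b \<in> M \<Longrightarrow> c \<in> M \<Longrightarrow> e \<in> M \<Longrightarrow>
      d a c + d b e \<le> max (d a b + d c e) (d a e + d b c)"
    and median: "a \<in> M \<Longrightarrow> b \<in> M \<Longrightarrow> c \<in> M \<Longrightarrow>
      \<exists>m\<in>M. between d a m b \<and> between d b m c \<and> between d a m c"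
begin

lemma dist_nonneg: "x \<in> M \<Longrightarrow> y \<in> M \<Longrightarrow> 0 \<le> d x y"
  using dist_self dist_pos by (metis less_eq_real_def)

lemma dist_zero: "x \<in> M \<Longrightarrow> y \<in> M \<Longrightarrow> d x y \<le> 0 \<Longrightarrow> x = y"
  using dist_pos by force

lemma triangle: "x \<in> M \<Longrightarrow> y \<in> M \<Longrightarrow> z \<in> M \<Longrightarrow> d x z \<le> d x y + d y z"
  using four_point[of x y z y] dist_self[of y] dist_sym[of z y] by auto

lemma between_sym: "a \<in> M \<Longrightarrow> b \<in> M \<Longrightarrow> x \<in> M \<Longrightarrow> between d a x b \<longleftrightarrow> between d b x a"
  unfolding between_def using dist_sym by (metis add.commute)

lemma between_left: "a \<in> M \<Longrightarrow> between d a a b"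
  unfolding between_def using dist_self by simp

lemma between_right: "b \<in> M \<Longrightarrow> between d a b b"
  unfolding between_def using dist_self by simp

lemma between_same: "a \<in> M \<Longrightarrow> x \<in> M \<Longrightarrow> between d a x a \<Longrightarrow> x = a"
  unfolding between_def using dist_self dist_sym dist_zero by (metis add_nonneg_eq_0_iff dist_nonneg order_refl)

lemma between_antisym:
  "a \<in> M \<Longrightarrow> x \<in> M \<Longrightarrow> y \<in> M \<Longrightarrow> between d a x y \<Longrightarrow> between d a y x \<Longrightarrow> x = y"
  unfolding between_def using dist_zero[of x y] dist_sym[of x y] by linarith

lemma between_trans:
  assumes "a \<in> M" "b \<in> M" "x \<in> M" "y \<in> M" and "between d a x b" "between d a y x"
  shows "between d a y b" "between d y x b"
  using assms triangle[of y x b] triangle[of a y b] unfolding between_def by linarith+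

lemma between_trans':
  assumes "a \<in> M" "b \<in> M" "x \<in> M" "y \<in> M" and "between d a x b" "between d x y b"
  shows "between d a y b" "between d a x y"
  using assms triangle[of a x y] triangle[of a y b] unfolding between_def by linarith+

text \<open>Gluing of overlapping segments, which fails in general metric spaces. In the four-point
  inequality for \<open>a\<close>, \<open>x\<close>, \<open>y\<close>, \<open>b\<close> the
  alternative \<open>d a x + d y b\<close> is too small by twice \<open>d x y\<close>, so the other
  one holds. The overlap must be nondegenerate: with \<open>x = y\<close> the path could turn
  back.\<close>

lemma between_concat:
  assumes "a \<in> M" "b \<in> M" "x \<in> M" "y \<in> M"
    and "between d a x y" "between d x y b" "x \<noteq> y"
  shows "between d a x b" "between d a y b"
proof -
  have "d a x + d x y = d a y" "d x y + d y b = d x b" using assms unfolding between_def by auto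
  moreover have "0 < d x y" "d a b \<le> d a x + d x b" "d a b \<le> d a y + d y b"
    using dist_pos[of x y] triangle[of a x b] triangle[of a y b] assms by auto
  moreover have "d a y + d x b \<le> max (d a x + d y b) (d a b + d x y)"
    using four_point[of a x y b] assms by auto
  ultimately show "between d a x b" "between d a y b" unfolding between_def by linarith+
qed

text \<open>Removing \<open>p\<close> separates \<open>a\<close> from \<open>c\<close>, and
  \<open>b\<close> cannot be on both sides.\<close>

lemma between_cut:
  assumes "a \<in> M" "b \<in> M" "c \<in> M" "p \<in> M" and "between d a p c"
  shows "between d a p b \<or> between d b p c"
proof -
  have "d a c + d b p \<le> max (d a b + d c p) (d a p + d b c)"
    using four_point[of a b c p] assms by auto
  moreover have "d a c = d a p + d p c" using assms unfolding between_def by simp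
  moreover have "d a b \<le> d a p + d p b" "d b c \<le> d b p + d p c"
    using triangle[of a p b] triangle[of b p c] assms by auto
  moreover have "d c p = d p c" "d b p = d p b" using dist_sym[of c p] dist_sym[of b p] assms by auto
  ultimately show ?thesis unfolding between_def by linarith
qed

lemma between_linear:
  assumes "a \<in> M" "b \<in> M" "x \<in> M" "y \<in> M" and "between d a x b" "between d a y b"
  shows "between d a x y \<or> between d a y x"
proof -
  have "d a b + d x y \<le> max (d a x + d b y) (d a y + d x b)"
    using four_point[of a x b y] assms by auto
  moreover have "d b y = d y b" "d x y = d y x" using dist_sym[of b y] dist_sym[of x y] assms by auto
  moreover have "d a x + d x b = d a b" "d a y + d y b = d a b" using assms unfolding between_def by auto
  moreover have "d a y \<le> d a x + d x y" "d a x \<le> d a y + d y x"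
    using triangle[of a x y] triangle[of a y x] assms by auto
  ultimately show ?thesis unfolding between_def by linarith
qed

lemma median_unique:
  assumes "a \<in> M" "b \<in> M" "c \<in> M" "m \<in> M" "m' \<in> M"
    and "between d a m b" "between d b m c" "between d a m c"
    and "between d a m' b" "between d b m' c" "between d a m' c"
  shows "m = m'"
proof -
  have "d a m = d a m'" using assms(6-) dist_sym[of m b] dist_sym[of m' b] assms(1-5)
    unfolding between_def by auto
  moreover have "between d a m m' \<or> between d a m' m" using between_linear assms by blast
  ultimately show ?thesis using assms(1-5) dist_zero[of m m'] dist_zero[of m' m]
    unfolding between_def by auto
qed

text \<open>The triangle inequality gives all three lower bounds. By \<open>between_cut\<close> the
  path from \<open>x\<close> to one of the three points passes through \<open>m\<close>, and its
  bound is attained. Thus the distance to a branch point can be computed from distances to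
  \<open>a\<close>, \<open>b\<close>, \<open>c\<close>.\<close>

lemma median_dist:
  assumes "a \<in> M" "b \<in> M" "c \<in> M" "m \<in> M" "x \<in> M"
    and "between d a m b" "between d b m c" "between d a m c"
  shows "d x m = max (d x a - d a m) (max (d x b - d b m) (d x c - d c m))"
proof -
  note syms = dist_sym[OF assms(1,5)] dist_sym[OF assms(4,5)] dist_sym[OF assms(4,2)]
    dist_sym[OF assms(4,1)] dist_sym[OF assms(4,3)]
  have "between d a m x \<or> between d x m b"
    using between_cut[of a x b m] assms by blast
  hence "d x m = d x a - d a m \<or> d x m = d x b - d b m"
    unfolding between_def using syms by linarith
  moreover have "d x a \<le> d x m + d a m"
    using triangle[OF assms(5,4,1)] syms by linarith
  moreover have "d x b \<le> d x m + d b m"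
    using triangle[OF assms(5,4,2)] syms by linarith
  moreover have "d x c \<le> d x m + d c m"
    using triangle[OF assms(5,4,3)] syms by linarith
  ultimately show ?thesis by linarith
qed

lemma tree_metric_subset:
  assumes "N \<subseteq> M" and "\<And>a b c m. a \<in> N \<Longrightarrow> b \<in> N \<Longrightarrow> c \<in> N \<Longrightarrow> m \<in> M \<Longrightarrow>
    between d a m b \<Longrightarrow> between d b m c \<Longrightarrow> between d a m c \<Longrightarrow> m \<in> N"
  shows "tree_metric N d"
proof
  fix a b c assume "a \<in> N" "b \<in> N" "c \<in> N"
  thus "\<exists>m\<in>N. between d a m b \<and> between d b m c \<and> between d a m c"
    using assms median[of a b c] by blast
qed (use assms(1) dist_self dist_pos dist_sym four_point in \<open>auto simp: subset_iff\<close>)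

end

lemma tree_metricI:
  fixes d :: "'p \<Rightarrow> 'p \<Rightarrow> real"
  assumes self: "\<And>x. x \<in> M \<Longrightarrow> d x x = 0"
    and pos: "\<And>x y. x \<in> M \<Longrightarrow> y \<in> M \<Longrightarrow> x \<noteq> y \<Longrightarrow> 0 < d x y"
    and sym: "\<And>x y. x \<in> M \<Longrightarrow> y \<in> M \<Longrightarrow> d x y = d y x"
    and tri: "\<And>x y z. x \<in> M \<Longrightarrow> y \<in> M \<Longrightarrow> z \<in> M \<Longrightarrow> d x z \<le> d x y + d y z"
    and med: "\<And>a b c. a \<in> M \<Longrightarrow> b \<in> M \<Longrightarrow> c \<in> M \<Longrightarrow>
      \<exists>m\<in>M. between d a m b \<and> between d b m c \<and> between d a m c"
    and lin: "\<And>a b x y. a \<in> M \<Longrightarrow> b \<in> M \<Longrightarrow> x \<in> M \<Longrightarrow> y \<in> M \<Longrightarrow>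
      between d a x b \<Longrightarrow> between d a y b \<Longrightarrow> between d a x y \<or> between d a y x"
  shows "tree_metric M d"
proof
  fix a b c e assume M: "a \<in> M" "b \<in> M" "c \<in> M" "e \<in> M"
  obtain m where m: "m \<in> M" "between d a m c" "between d c m b" "between d a m b"
    using med[of a c b] M by blast
  obtain n where n: "n \<in> M" "between d a n c" "between d c n e" "between d a n e"
    using med[of a c e] M by blast
  have syms: "d b m = d m b" "d m n = d n m" "d c n = d n c" "d c m = d m c" "d c b = d b c"
    using M m n by (blast intro: sym)+
  \<comment> \<open>Both medians lie on the segment from \<open>a\<close> to \<open>c\<close>. The
    detour over \<open>m\<close> and \<open>n\<close> bounds \<open>d b e\<close>, and the order of
    \<open>m\<close> and \<open>n\<close> on that segment decides which of the two sums
    dominates.\<close>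
  have "d b e \<le> d b m + d m e" "d m e \<le> d m n + d n e" using M m n by (blast intro: tri)+
  hence be: "d b e \<le> d m b + d m n + d n e" using syms by simp
  have "between d a m n \<or> between d a n m" using lin M m n by blast
  thus "d a c + d b e \<le> max (d a b + d c e) (d a e + d b c)"
    using be m n syms unfolding between_def by linarith
qed (use assms in auto)

section \<open>The tree of a finite tree metric\<close>

lemma is_path_single: "is_path T [x] \<longleftrightarrow> x \<in> nodes T"
  unfolding is_path_def by auto

lemma all_nat_Suc: "(\<forall>k. Q k) \<longleftrightarrow> Q 0 \<and> (\<forall>k. Q (Suc k))"
  by (metis not0_implies_Suc)

lemma is_path_Cons_Cons:
  "is_path T (x # y # zs) \<longleftrightarrow>
     x \<in> nodes T \<and> {x, y} \<in> edges T \<and> x \<notin> set (y # zs) \<and> is_path T (y # zs)"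
proof -
  have "(\<forall>k. Suc k < length (x # y # zs) \<longrightarrow> {(x # y # zs) ! k, (x # y # zs) ! Suc k} \<in> edges T) \<longleftrightarrow>
    {x, y} \<in> edges T \<and> (\<forall>k. Suc k < length (y # zs) \<longrightarrow> {(y # zs) ! k, (y # zs) ! Suc k} \<in> edges T)"
    by (subst all_nat_Suc) simp
  thus ?thesis unfolding is_path_def by auto
qed

lemma is_path_hd: "is_path T vs \<Longrightarrow> hd vs \<in> nodes T"
  and is_path_last: "is_path T vs \<Longrightarrow> last vs \<in> nodes T"
  and is_path_set: "is_path T vs \<Longrightarrow> set vs \<subseteq> nodes T"
  and is_path_not_Nil: "is_path T vs \<Longrightarrow> vs \<noteq> []"
  unfolding is_path_def by (auto simp: subset_iff)

lemma is_path_induct [consumes 1, case_names single Cons]: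
  assumes "is_path T vs"
    and "\<And>x. x \<in> nodes T \<Longrightarrow> P [x]"
    and "\<And>x y zs. x \<in> nodes T \<Longrightarrow> {x, y} \<in> edges T \<Longrightarrow> x \<notin> set (y # zs) \<Longrightarrow>
      is_path T (y # zs) \<Longrightarrow> P (y # zs) \<Longrightarrow> P (x # y # zs)"
  shows "P vs"
  using assms(1)
proof (induction vs)
  case Nil
  thus ?case by (simp add: is_path_def)
next
  case (Cons x vs)
  show ?case
  proof (cases vs)
    case Nil
    thus ?thesis using Cons.prems assms(2) by (simp add: is_path_single)
  next
    case (Cons y zs)
    thus ?thesis using Cons.prems Cons.IH assms(3) by (simp add: is_path_Cons_Cons)
  qed
qed

fun path_length :: "('v \<Rightarrow> 'v \<Rightarrow> real) \<Rightarrow> 'v list \<Rightarrow> real" where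
  "path_length d (x # y # zs) = d x y + path_length d (y # zs)"
| "path_length d _ = 0"

text \<open>Edges are recovered from the metric: they join the pairs of nodes with nothing strictly
  between. The edges of \<open>tree_of\<close> are given in a similar form, and
  \<open>metric_tree_D\<close> brings an abstract tree into this one.\<close>

locale metric_tree =
  fixes T :: "('v, 'm) ltree_scheme" and d :: "'v \<Rightarrow> 'v \<Rightarrow> real"
  assumes finite_nodes: "finite (nodes T)"
    and nodes_nonempty: "nodes T \<noteq> {}"
    and tree_metric: "tree_metric (nodes T) d"
    and edges_eq: "edges T = {{u, v} | u v. u \<in> nodes T \<and> v \<in> nodes T \<and> u \<noteq> v \<and>
      (\<forall>w\<in>nodes T. between d u w v \<longrightarrow> w \<in> {u, v})}"
begin

sublocale tree_metric "nodes T" d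
  by (rule tree_metric)

lemma edge_iff: "{u, v} \<in> edges T \<longleftrightarrow> u \<in> nodes T \<and> v \<in> nodes T \<and> u \<noteq> v \<and>
    (\<forall>w\<in>nodes T. between d u w v \<longrightarrow> w = u \<or> w = v)"
proof
  assume "{u, v} \<in> edges T"
  then obtain a b where ab: "{u, v} = {a, b}" "a \<in> nodes T" "b \<in> nodes T" "a \<noteq> b"
    "\<forall>w\<in>nodes T. between d a w b \<longrightarrow> w \<in> {a, b}"
    unfolding edges_eq by auto
  hence "u = a \<and> v = b \<or> u = b \<and> v = a" by (auto simp: doubleton_eq_iff)
  thus "u \<in> nodes T \<and> v \<in> nodes T \<and> u \<noteq> v \<and> (\<forall>w\<in>nodes T. between d u w v \<longrightarrow> w = u \<or> w = v)"
    using ab between_sym by auto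
qed (auto simp: edges_eq)

lemma edgeE:
  assumes "e \<in> edges T"
  obtains u v where "e = {u, v}" "u \<in> nodes T" "v \<in> nodes T" "u \<noteq> v"
  using assms unfolding edges_eq by auto

lemma edge_between: "{u, v} \<in> edges T \<Longrightarrow> w \<in> nodes T \<Longrightarrow> between d u w v \<Longrightarrow> w = u \<or> w = v"
  by (simp add: edge_iff)

lemma edge_nodes: "{u, v} \<in> edges T \<Longrightarrow> u \<in> nodes T" "{u, v} \<in> edges T \<Longrightarrow> v \<in> nodes T"
  "{u, v} \<in> edges T \<Longrightarrow> u \<noteq> v"
  by (simp_all add: edge_iff)

text \<open>The neighbour is the node nearest to \<open>u\<close>, other than \<open>u\<close>, on
  the segment towards \<open>v\<close>.\<close>

lemma neighbour_towards:
  assumes "u \<in> nodes T" "v \<in> nodes T" "u \<noteq> v"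
  obtains w where "w \<in> nodes T" "{u, w} \<in> edges T" "between d u w v"
proof -
  define S where "S = {w \<in> nodes T. w \<noteq> u \<and> between d u w v}"
  have "finite S" "S \<noteq> {}" using assms between_right finite_nodes unfolding S_def by auto
  then obtain w where w: "w \<in> S" "\<And>x. x \<in> S \<Longrightarrow> d u w \<le> d u x"
    by (metis arg_min_if_finite(1) arg_min_least)
  have "{u, w} \<in> edges T"
    unfolding edge_iff
  proof (intro conjI ballI impI)
    fix x assume x: "x \<in> nodes T" "between d u x w"
    show "x = u \<or> x = w"
    proof (rule ccontr)
      assume neq: "\<not> (x = u \<or> x = w)"
      moreover have "between d u x v"
        using between_trans[of u v w x] x w(1) assms unfolding S_def by auto
      ultimately have "d u w \<le> d u x" using w(2) x unfolding S_def by auto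
      thus False using x neq dist_pos[of x w] w(1) unfolding between_def S_def by auto
    qed
  qed (use w assms in \<open>auto simp: S_def\<close>)
  thus ?thesis using that w(1) unfolding S_def by auto
qed

text \<open>The median of \<open>x\<close>, \<open>y\<close>, \<open>z\<close> lies on both edges,
  hence is an end of each, and \<open>y\<close> is their only common end.\<close>

lemma between_edges:
  assumes "{x, y} \<in> edges T" "{y, z} \<in> edges T" "x \<noteq> z"
  shows "between d x y z"
proof -
  have n: "x \<in> nodes T" "y \<in> nodes T" "z \<in> nodes T" using assms edge_nodes by auto
  then obtain m where "m \<in> nodes T" "between d x m y" "between d y m z" "between d x m z"
    using median[of x y z] by blast
  thus ?thesis using edge_between assms by metis
qed

lemma between_edges':
  assumes "{y, x} \<in> edges T" "{y, z} \<in> edges T" "x \<noteq> z"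
  shows "between d x y z"
  using between_edges[of x y z] assms by (simp add: insert_commute[of x y])

text \<open>A path without repetition never turns back: at each inner vertex
  \<open>between_edges\<close> joins the two edges, and \<open>between_concat\<close> carries this
  to the end of the path.\<close>

lemma path_first_between:
  assumes "is_path T vs" "vs = x # y # zs"
  shows "between d x y (last vs)"
  using assms
proof (induction arbitrary: x y zs rule: is_path_induct)
  case (Cons a b cs)
  show ?case
  proof (cases cs)
    case Nil
    thus ?thesis using Cons between_right edge_nodes by auto
  next
    case (Cons c es)
    have 1: "between d b c (last (b # cs))" using Cons.IH Cons by blast
    have bc: "{b, c} \<in> edges T" using Cons.hyps(4) Cons by (simp add: is_path_Cons_Cons)
    have "a \<noteq> c" using Cons.hyps(3) Cons by auto
    hence 2: "between d a b c" using between_edges[OF Cons.hyps(2) bc] by auto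
    have "last (b # cs) \<in> nodes T" using is_path_last[OF Cons.hyps(4)] .
    hence "between d a b (last (b # cs))"
      using between_concat(1)[of a "last (b # cs)" b c] 1 2 bc Cons.hyps(2) edge_nodes by blast
    thus ?thesis using Cons.prems by auto
  qed
qed auto

lemma path_between:
  assumes "is_path T vs" "w \<in> set vs"
  shows "between d (hd vs) w (last vs)"
  using assms
proof (induction rule: is_path_induct)
  case (Cons x y zs)
  have p: "is_path T (x # y # zs)" using Cons.hyps by (simp add: is_path_Cons_Cons)
  have n: "last (y # zs) \<in> nodes T" "w \<in> nodes T" "y \<in> nodes T"
    using is_path_last[OF p] is_path_set[OF p] Cons.prems by auto
  show ?case
  proof (cases "w = x")
    case False
    hence "between d y w (last (y # zs))" using Cons by auto
    thus ?thesis using path_first_between[OF p refl] between_trans'(1)[of x "last (y # zs)" y w] n Cons.hyps(1)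
      by auto
  qed (use between_left Cons.hyps in auto)
qed (use between_left in auto)

lemma path_exists:
  assumes "u \<in> nodes T" "v \<in> nodes T"
  shows "\<exists>vs. is_path T vs \<and> hd vs = u \<and> last vs = v"
  using assms
proof (induction "card {x \<in> nodes T. between d u x v}" arbitrary: u rule: less_induct)
  case less
  show ?case
  proof (cases "u = v")
    case True
    thus ?thesis using less.prems by (intro exI[of _ "[u]"]) (auto simp: is_path_single)
  next
    case False
    then obtain w where w: "w \<in> nodes T" "{u, w} \<in> edges T" "between d u w v"
      using neighbour_towards less.prems by metis
    have "u \<notin> {x \<in> nodes T. between d w x v}"
      using w less.prems between_antisym[of v u w] between_sym edge_nodes(3) by blast
    moreover have "between d u x v" if "x \<in> nodes T" "between d w x v" for x
      using between_trans'(1)[of u v w x] w less.prems that by auto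
    ultimately have "{x \<in> nodes T. between d w x v} \<subset> {x \<in> nodes T. between d u x v}"
      using less.prems between_left by blast
    hence "card {x \<in> nodes T. between d w x v} < card {x \<in> nodes T. between d u x v}"
      using finite_nodes by (intro psubset_card_mono) auto
    then obtain vs where vs: "is_path T vs" "hd vs = w" "last vs = v"
      using less.hyps w less.prems by blast
    have "u \<notin> set vs" using path_between[OF vs(1)] vs \<open>u \<notin> _\<close> less.prems by auto
    moreover obtain zs where "vs = w # zs" using vs by (cases vs) (auto simp: is_path_def)
    ultimately have "is_path T (u # vs)" using vs w less.prems by (auto simp: is_path_Cons_Cons)
    thus ?thesis using vs \<open>vs = _\<close> by (intro exI[of _ "u # vs"]) auto
  qed
qed

text \<open>Both second vertices lie on the segment to the common end, so they are comparable; since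
  an edge has no node inside, they agree.\<close>

lemma path_unique:
  assumes "is_path T vs" "is_path T ws" "hd vs = hd ws" "last vs = last ws"
  shows "vs = ws"
  using assms
proof (induction arbitrary: ws rule: is_path_induct)
  case (single x)
  show ?case
  proof (rule ccontr)
    assume "[x] \<noteq> ws"
    then obtain y zs where ws: "ws = x # y # zs" using single by (cases ws; cases "tl ws") (auto simp: is_path_def)
    thus False using single by (auto simp: is_path_Cons_Cons split: if_splits)
  qed
next
  case (Cons x y zs)
  have p: "is_path T (x # y # zs)" using Cons.hyps by (simp add: is_path_Cons_Cons)
  have "ws \<noteq> [x]" using Cons.prems Cons.hyps by (metis is_path_Cons_Cons last.simps last_in_set list.simps(3))
  then obtain y' zs' where ws: "ws = x # y' # zs'"
    using Cons.prems by (cases ws; cases "tl ws") (auto simp: is_path_def)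
  have l: "last ws \<in> nodes T" using is_path_last Cons.prems by auto
  have 1: "between d x y (last ws)" using path_first_between[OF p refl] Cons.prems by auto
  have 2: "between d x y' (last ws)" using path_first_between[OF _ ws] Cons.prems by auto
  have e: "{x, y} \<in> edges T" "{x, y'} \<in> edges T" "is_path T (y' # zs')"
    using Cons.hyps Cons.prems ws by (auto simp: is_path_Cons_Cons)
  hence "between d x y y' \<or> between d x y' y"
    using between_linear[of x "last ws" y y'] 1 2 l edge_nodes by blast
  hence "y = y'" using edge_between e edge_nodes by metis
  moreover have "last (y # zs) = last (y' # zs')" using Cons.prems ws by simp
  ultimately have "y # zs = y' # zs'" using Cons.IH[OF e(3)] by simp
  thus ?case using ws by auto
qed

lemma is_tree: "is_tree T"
proof -
  have "edges T \<subseteq> {{u, v} | u v. u \<in> nodes T \<and> v \<in> nodes T \<and> u \<noteq> v}"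
    unfolding edges_eq by blast
  moreover have "\<exists>!vs. is_path T vs \<and> hd vs = u \<and> last vs = v"
    if "u \<in> nodes T" "v \<in> nodes T" for u v
    using path_exists[OF that] path_unique by metis
  ultimately show ?thesis unfolding is_tree_def using finite_nodes nodes_nonempty by blast
qed

lemma dist_path_length:
  assumes "is_path T vs"
  shows "d (hd vs) (last vs) = path_length d vs"
  using assms
proof (induction rule: is_path_induct)
  case (Cons x y zs)
  have p: "is_path T (x # y # zs)" using Cons.hyps by (simp add: is_path_Cons_Cons)
  show ?case using path_first_between[OF p refl] Cons.IH unfolding between_def by auto
qed (use dist_self in auto)

lemma between_in_path:
  assumes "is_path T vs" "w \<in> nodes T" "between d (hd vs) w (last vs)"
  shows "w \<in> set vs"
  using assms
proof (induction rule: is_path_induct)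
  case (single x)
  thus ?case using between_same by auto
next
  case (Cons x y zs)
  have p: "is_path T (x # y # zs)" using Cons.hyps by (simp add: is_path_Cons_Cons)
  have n: "last (y # zs) \<in> nodes T" "y \<in> nodes T"
    using is_path_last[OF p] is_path_set[OF p] by auto
  have 1: "between d x y (last (y # zs))" using path_first_between[OF p refl] by auto
  have 2: "between d x w (last (y # zs))" using Cons.prems by auto
  consider "between d x w y" | "between d x y w"
    using between_linear 1 2 n Cons by blast
  thus ?case
  proof cases
    case 1
    thus ?thesis using edge_between Cons by auto
  next
    case 2
    hence "between d y w (last (y # zs))"
      using \<open>between d x w _\<close> \<open>between d x y (last _)\<close> unfolding between_def by linarith
    thus ?thesis using Cons by auto
  qed
qed

section \<open>Degrees, leaves and the two sides of an edge\<close>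

lemma degree_eq: 
  assumes "v \<in> nodes T"
  shows "degree T v = card {w \<in> nodes T. {v, w} \<in> edges T}"
proof -
  have "bij_betw (\<lambda>w. {v, w}) {w \<in> nodes T. {v, w} \<in> edges T} {e \<in> edges T. v \<in> e}"
  proof (rule bij_betw_imageI)
    show "inj_on (\<lambda>w. {v, w}) {w \<in> nodes T. {v, w} \<in> edges T}"
      by (intro inj_onI) (metis doubleton_eq_iff)
    show "(\<lambda>w. {v, w}) ` {w \<in> nodes T. {v, w} \<in> edges T} = {e \<in> edges T. v \<in> e}"
    proof (rule equalityI)
      show "{e \<in> edges T. v \<in> e} \<subseteq> (\<lambda>w. {v, w}) ` {w \<in> nodes T. {v, w} \<in> edges T}"
      proof (rule subsetI)
        fix e assume e: "e \<in> {e \<in> edges T. v \<in> e}"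
        then obtain a b where ab: "e = {a, b}" "a \<in> nodes T" "b \<in> nodes T"
          using edgeE[of e] by blast
        hence "e = {v, a} \<or> e = {v, b}" using e by blast
        thus "e \<in> (\<lambda>w. {v, w}) ` {w \<in> nodes T. {v, w} \<in> edges T}" using e ab by blast
      qed
      show "(\<lambda>w. {v, w}) ` {w \<in> nodes T. {v, w} \<in> edges T} \<subseteq> {e \<in> edges T. v \<in> e}"
        by (rule image_subsetI) simp
    qed
  qed
  from bij_betw_same_card[OF this] show ?thesis unfolding degree_def by simp
qed

lemma finite_neighbours: "finite {w \<in> nodes T. {v, w} \<in> edges T}"
  using finite_nodes by auto

lemma degree_pos:
  assumes "u \<in> nodes T" "v \<in> nodes T" "u \<noteq> v"
  shows "degree T u \<noteq> 0"
proof -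
  obtain w where "w \<in> nodes T" "{u, w} \<in> edges T"
    using neighbour_towards[OF assms] by blast
  hence "{w \<in> nodes T. {u, w} \<in> edges T} \<noteq> {}" by blast
  thus ?thesis using degree_eq[OF assms(1)] finite_neighbours[of u] by simp
qed

text \<open>Two different neighbours of \<open>v\<close> would have \<open>v\<close> between them.
  With \<open>degree_one_between\<close> this characterises leaves as the nodes that are never
  strictly between two others.\<close>

lemma degree_one:
  assumes "v \<in> nodes T" "u \<in> nodes T" "u \<noteq> v"
    and "\<And>a b. a \<in> nodes T \<Longrightarrow> b \<in> nodes T \<Longrightarrow> between d a v b \<Longrightarrow> a = v \<or> b = v"
  shows "degree T v = 1"
proof -
  obtain w where w: "w \<in> nodes T" "{v, w} \<in> edges T"
    using neighbour_towards[OF assms(1,2) assms(3)[symmetric]] by blast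
  have "x = w" if "x \<in> nodes T" "{v, x} \<in> edges T" for x
  proof (rule ccontr)
    assume "x \<noteq> w"
    hence "between d x v w" using between_edges'[of v x w] that w by blast
    thus False using assms(4) that w edge_nodes(3) by metis
  qed
  hence "{w \<in> nodes T. {v, w} \<in> edges T} = {w}" using w by blast
  thus ?thesis using degree_eq[OF assms(1)] by simp
qed

text \<open>Points separated by \<open>v\<close> are reached from \<open>v\<close> through different
  neighbours; this allows counting the branches at \<open>v\<close> by nodes at any
  distance.\<close>

lemma neighbours_distinct:
  assumes "v \<in> nodes T" "a \<in> nodes T" "b \<in> nodes T" "x \<in> nodes T"
    and "between d a v b" "between d v x a" "between d v x b"
  shows "x = v"
proof -
  have "d v x \<le> 0"
    using assms(5-7) dist_sym[OF assms(1,2)] dist_sym[OF assms(4,2)] triangle[OF assms(2,4,3)]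
    unfolding between_def by linarith
  thus ?thesis using dist_zero[OF assms(1,4)] by simp
qed

lemma degree_one_between:
  assumes "v \<in> nodes T" "degree T v = 1" "a \<in> nodes T" "b \<in> nodes T" "between d a v b"
  shows "a = v \<or> b = v"
proof (rule ccontr)
  assume "\<not> (a = v \<or> b = v)"
  then obtain x y where x: "x \<in> nodes T" "{v, x} \<in> edges T" "between d v x a"
    and y: "y \<in> nodes T" "{v, y} \<in> edges T" "between d v y b"
    using neighbour_towards assms by metis
  obtain z where "{w \<in> nodes T. {v, w} \<in> edges T} = {z}"
    using degree_eq[OF assms(1)] assms(2) card_1_singletonE by metis
  hence "x \<in> {z}" "y \<in> {z}" using x y by auto
  hence "x = v" using neighbours_distinct[OF assms(1,3,4) x(1) assms(5) x(3)] y(3) by simp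
  thus False using edge_nodes(3)[OF x(2)] by simp
qed

lemma degree_ge_3:
  assumes "v \<in> nodes T" "a \<in> nodes T" "b \<in> nodes T" "c \<in> nodes T"
    and "between d a v b" "between d b v c" "between d a v c" "a \<noteq> v" "b \<noteq> v" "c \<noteq> v"
  shows "degree T v \<ge> 3"
proof -
  obtain x where x: "x \<in> nodes T" "{v, x} \<in> edges T" "between d v x a"
    using neighbour_towards[OF assms(1,2) assms(8)[symmetric]] by blast
  obtain y where y: "y \<in> nodes T" "{v, y} \<in> edges T" "between d v y b"
    using neighbour_towards[OF assms(1,3) assms(9)[symmetric]] by blast
  obtain z where z: "z \<in> nodes T" "{v, z} \<in> edges T" "between d v z c"
    using neighbour_towards[OF assms(1,4) assms(10)[symmetric]] by blast
  have "x \<noteq> v" "y \<noteq> v" using x y edge_nodes(3) by blast+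
  hence "x \<noteq> y" "y \<noteq> z" "x \<noteq> z"
    using neighbours_distinct[of v a b x] neighbours_distinct[of v b c y]
      neighbours_distinct[of v a c x] assms x y z by auto
  hence "card {x, y, z} = 3" by auto
  moreover have "card {x, y, z} \<le> card {w \<in> nodes T. {v, w} \<in> edges T}"
    using x y z finite_neighbours by (intro card_mono) auto
  ultimately show ?thesis using degree_eq[OF assms(1)] by auto
qed

lemma degree_ge_3E:
  assumes "v \<in> nodes T" "degree T v \<ge> 3"
  obtains a b c where "{v, a} \<in> edges T" "{v, b} \<in> edges T" "{v, c} \<in> edges T"
    "a \<noteq> b" "b \<noteq> c" "a \<noteq> c" "between d a v b" "between d b v c" "between d a v c"
proof -
  have "3 \<le> card {w \<in> nodes T. {v, w} \<in> edges T}" using assms degree_eq by auto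
  then obtain S where S: "S \<subseteq> {w \<in> nodes T. {v, w} \<in> edges T}" "card S = 3"
    by (meson obtain_subset_with_card_n)
  then obtain a b c where "S = {a, b, c}" "a \<noteq> b" "b \<noteq> c" "a \<noteq> c"
    by (auto simp: card_3_iff)
  moreover from this have "{v, a} \<in> edges T" "{v, b} \<in> edges T" "{v, c} \<in> edges T" using S by auto
  ultimately show ?thesis using that[of a b c] between_edges'[of v a b] between_edges'[of v b c]
      between_edges'[of v a c] by blast
qed

text \<open>Take the node farthest from \<open>u\<close> among those beyond \<open>v\<close>. Any
  neighbour of it other than the one towards \<open>u\<close> would also be beyond \<open>v\<close>,
  and farther away.\<close>

lemma leaf_beyond:
  assumes "u \<in> nodes T" "v \<in> nodes T" "u \<noteq> v"
  obtains x where "x \<in> nodes T" "degree T x = 1" "between d u v x"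
proof -
  define S where "S = {x \<in> nodes T. between d u v x}"
  have S: "finite S" "S \<noteq> {}" using assms between_right finite_nodes unfolding S_def by auto
  hence "Max (d u ` S) \<in> d u ` S" by (intro Max_in) auto
  then obtain x where "x \<in> S" "Max (d u ` S) = d u x" by auto
  hence x: "x \<in> S" "\<And>z. z \<in> S \<Longrightarrow> d u z \<le> d u x"
    using S Max_ge[of "d u ` S"] by auto
  have xn: "x \<in> nodes T" "between d u v x" using x unfolding S_def by auto
  have "x \<noteq> u" using between_same assms xn by blast
  have "degree T x = 1"
  proof (rule ccontr)
    assume "degree T x \<noteq> 1"
    obtain y where y: "y \<in> nodes T" "{x, y} \<in> edges T" "between d x y u"
      using neighbour_towards \<open>x \<noteq> u\<close> xn assms by metis
    have "\<not> {w \<in> nodes T. {x, w} \<in> edges T} \<subseteq> {y}"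
    proof
      assume "{w \<in> nodes T. {x, w} \<in> edges T} \<subseteq> {y}"
      hence "{w \<in> nodes T. {x, w} \<in> edges T} = {y}" using y by auto
      thus False using \<open>degree T x \<noteq> 1\<close> degree_eq xn by auto
    qed
    then obtain z where z: "z \<in> nodes T" "{x, z} \<in> edges T" "z \<noteq> y" by auto
    have "between d y x z" using between_edges'[of x y z] y z by blast
    moreover have "between d u y x" using y between_sym xn assms by blast
    moreover have "y \<noteq> x" using y edge_nodes(3) by blast
    ultimately have b: "between d u x z"
      using between_concat(2)[of u z y x] assms y z xn by auto
    hence "z \<in> S" using between_trans(1)[of u z x v] xn z assms unfolding S_def by auto
    hence "d u z \<le> d u x" using x by auto
    moreover have "0 < d x z" using dist_pos z xn edge_nodes(3) by blast
    ultimately show False using b unfolding between_def by auto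
  qed
  thus ?thesis using that xn by auto
qed

lemma edge_dichotomy:
  assumes "{u, v} \<in> edges T" "x \<in> nodes T"
  shows "between d x u v \<or> between d x v u"
proof -
  have n: "u \<in> nodes T" "v \<in> nodes T" using assms edge_nodes by auto
  then obtain m where "m \<in> nodes T" "between d u m v" "between d v m x" "between d u m x"
    using median[of u v x] assms by blast
  moreover from this have "m = u \<or> m = v" using edge_between assms by auto
  ultimately show ?thesis using between_sym n assms by metis
qed

lemma edge_exclusive:
  assumes "{u, v} \<in> edges T" "x \<in> nodes T" "between d x u v" "between d x v u"
  shows False
  using between_antisym[of x u v] assms edge_nodes[OF assms(1)] by blast

text \<open>This replaces reachability in the graph without the edge by a metric condition. If a
  step from \<open>a\<close> to \<open>b\<close> crossed from the side of \<open>u\<close> to that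
  of \<open>v\<close>, both \<open>u\<close> and \<open>v\<close> would be between \<open>a\<close>
  and \<open>b\<close>, so the step would be the removed edge itself.\<close>

lemma side_eq:
  assumes "{u, v} \<in> edges T" "leaf T ` L \<subseteq> nodes T"
  shows "side L T {u, v} u = {l \<in> L. between d (leaf T l) u v}"
proof -
  define R where "R = {(a, b). {a, b} \<in> edges T - {{u, v}}}"
  have uv: "u \<in> nodes T" "v \<in> nodes T" "u \<noteq> v" using assms edge_nodes by auto
  have side_step: "between d b u v" if ab: "between d a u v" "(a, b) \<in> R" for a b
  proof (rule ccontr)
    assume nb: "\<not> between d b u v"
    have e: "{a, b} \<in> edges T" "{a, b} \<noteq> {u, v}" using ab unfolding R_def by auto
    have n: "a \<in> nodes T" "b \<in> nodes T" using e edge_nodes by auto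
    have "between d b v u" using edge_dichotomy assms n nb by blast
    hence "between d u v b" using between_sym n uv by blast
    hence "between d a u b" "between d a v b" using between_concat[of a b u v] n uv ab by auto
    hence "u \<in> {a, b}" "v \<in> {a, b}" using edge_between e uv by blast+
    thus False using e uv by auto
  qed
  have reach: "between d x u v" if "(u, x) \<in> R\<^sup>*" for x
    using that
  proof (induction rule: rtrancl_induct)
    case base
    show ?case using between_left uv by auto
  next
    case (step y z)
    show ?case by (rule side_step[OF step.IH step.hyps(2)])
  qed
  have path_reach: "(hd vs, last vs) \<in> R\<^sup>*" if "is_path T vs" "v \<notin> set vs" for vs
    using that
  proof (induction rule: is_path_induct)
    case (Cons x y zs)
    have "{x, y} \<noteq> {u, v}" using Cons.prems by auto
    hence "(x, y) \<in> R" using Cons.hyps(2) unfolding R_def by simp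
    moreover have "(y, last (y # zs)) \<in> R\<^sup>*" using Cons by simp
    ultimately have "(x, last (y # zs)) \<in> R\<^sup>*" by (rule converse_rtrancl_into_rtrancl)
    thus ?case by simp
  qed simp
  have "(u, x) \<in> R\<^sup>*" if x: "between d x u v" "x \<in> nodes T" for x
  proof -
    obtain vs where vs: "is_path T vs" "hd vs = u" "last vs = x"
      using path_exists[OF uv(1) x(2)] by blast
    have "v \<notin> set vs"
    proof
      assume "v \<in> set vs"
      hence "between d u v x" using path_between[OF vs(1)] vs by simp
      hence "between d x v u" using between_sym[OF uv(1) x(2) uv(2)] by simp
      thus False using edge_exclusive[OF assms(1) x(2,1)] by simp
    qed
    thus ?thesis using path_reach vs by blast
  qed
  hence "(u, leaf T l) \<in> R\<^sup>* \<longleftrightarrow> between d (leaf T l) u v" if "l \<in> L" for l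
    using reach assms(2) that by blast
  thus ?thesis unfolding side_def R_def[symmetric] by (intro Collect_cong conj_cong refl) simp
qed

end

section \<open>The path metric of a tree\<close>

lemma is_path_iff: "is_path T vs \<longleftrightarrow> vs \<noteq> [] \<and> distinct vs \<and> set vs \<subseteq> nodes T \<and>
    successively (\<lambda>x y. {x, y} \<in> edges T) vs"
  unfolding is_path_def by (auto simp: successively_conv_nth)

lemma is_path_appendD:
  assumes "is_path T (xs @ m # ys)"
  shows "is_path T (xs @ [m])" "is_path T (m # ys)"
  using assms by (auto simp: is_path_iff successively_append_iff)

lemma is_path_join:
  assumes "is_path T (xs @ [m])" "is_path T (m # ys)" "set xs \<inter> set ys = {}"
  shows "is_path T (xs @ m # ys)"
  using assms by (auto simp: is_path_iff successively_append_iff)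

lemma is_path_rev: "is_path T vs \<Longrightarrow> is_path T (rev vs)"
  by (simp add: is_path_iff insert_commute)

lemma path_length_append:
  "path_length d (xs @ m # ys) = path_length d (xs @ [m]) + path_length d (m # ys)"
  by (induction xs rule: induct_list012) (cases ys; simp)+

lemma path_length_rev:
  assumes "\<And>x y. d x y = d y x"
  shows "path_length d (rev vs) = path_length d vs"
proof (induction vs rule: induct_list012)
  case (3 x y zs)
  have "path_length d (rev (x # y # zs)) = path_length d (rev (y # zs)) + d y x"
    using path_length_append[of d "rev zs" y "[x]"] by simp
  thus ?case using 3 assms[of y x] by simp
qed auto

locale weighted_tree =
  fixes T :: "('v, 'm) ltree_scheme" and wt :: "'v set \<Rightarrow> real"
  assumes tree: "is_tree T" and wt_pos: "e \<in> edges T \<Longrightarrow> 0 < wt e"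
begin

definition tpath :: "'v \<Rightarrow> 'v \<Rightarrow> 'v list" where
  "tpath u v = (THE vs. is_path T vs \<and> hd vs = u \<and> last vs = v)"

definition D :: "'v \<Rightarrow> 'v \<Rightarrow> real" where
  "D u v = path_length (\<lambda>x y. wt {x, y}) (tpath u v)"

lemma ex1_path: "u \<in> nodes T \<Longrightarrow> v \<in> nodes T \<Longrightarrow> \<exists>!vs. is_path T vs \<and> hd vs = u \<and> last vs = v"
  using tree unfolding is_tree_def by simp

lemma tpath:
  assumes "u \<in> nodes T" "v \<in> nodes T"
  shows "is_path T (tpath u v)" "hd (tpath u v) = u" "last (tpath u v) = v"
  using theI'[OF ex1_path[OF assms]] unfolding tpath_def by simp_all

lemma tpath_eq:
  assumes "is_path T vs" "hd vs = u" "last vs = v"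
  shows "tpath u v = vs"
  unfolding tpath_def
proof (rule the1_equality)
  show "\<exists>!vs. is_path T vs \<and> hd vs = u \<and> last vs = v"
    using ex1_path[of u v] is_path_hd[OF assms(1)] is_path_last[OF assms(1)] assms(2,3) by simp
qed (use assms in simp)

lemma D_path: "is_path T vs \<Longrightarrow> D (hd vs) (last vs) = path_length (\<lambda>x y. wt {x, y}) vs"
  unfolding D_def by (simp add: tpath_eq)

lemma D_split:
  assumes "u \<in> nodes T" "v \<in> nodes T" "w \<in> set (tpath u v)"
  shows "between D u w v"
proof -
  obtain xs ys where s: "tpath u v = xs @ w # ys" using split_list[OF assms(3)] by blast
  have p: "is_path T (xs @ w # ys)" "hd (xs @ w # ys) = u" "last (xs @ w # ys) = v"
    using tpath[OF assms(1,2)] s by simp_all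
  have "D u w = path_length (\<lambda>x y. wt {x, y}) (xs @ [w])"
    using D_path[OF is_path_appendD(1)[OF p(1)]] p(2) by (cases xs) auto
  moreover have "D w v = path_length (\<lambda>x y. wt {x, y}) (w # ys)"
    using D_path[OF is_path_appendD(2)[OF p(1)]] p(3) by simp
  ultimately show ?thesis
    unfolding between_def D_def[of u v] s by (subst path_length_append) simp
qed

lemma D_self: "u \<in> nodes T \<Longrightarrow> D u u = 0"
  using D_path[of "[u]"] by (simp add: is_path_single)

lemma path_length_nonneg: "is_path T vs \<Longrightarrow> 0 \<le> path_length (\<lambda>x y. wt {x, y}) vs"
proof (induction rule: is_path_induct)
  case (Cons x y zs)
  show ?case using Cons.IH wt_pos[OF Cons.hyps(2)] by simp
qed simp

lemma tpath_ConsE: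
  assumes "u \<in> nodes T" "v \<in> nodes T" "u \<noteq> v"
  obtains x zs where "tpath u v = u # x # zs"
proof -
  obtain z vs where z: "tpath u v = z # vs"
    using is_path_not_Nil[OF tpath(1)[OF assms(1,2)]] by (cases "tpath u v") auto
  have "z = u" using tpath(2)[OF assms(1,2)] z by simp
  moreover have "vs \<noteq> []" using tpath(3)[OF assms(1,2)] z \<open>z = u\<close> assms(3) by auto
  ultimately show ?thesis using that z by (cases vs) auto
qed

lemma D_pos:
  assumes "u \<in> nodes T" "v \<in> nodes T" "u \<noteq> v"
  shows "0 < D u v"
proof -
  obtain x zs where xs: "tpath u v = u # x # zs" using tpath_ConsE[OF assms] by blast
  have p: "{u, x} \<in> edges T" "is_path T (x # zs)"
    using tpath(1)[OF assms(1,2)] by (simp_all add: xs is_path_Cons_Cons)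
  show ?thesis using wt_pos[OF p(1)] path_length_nonneg[OF p(2)] unfolding D_def xs by simp
qed

lemma D_sym:
  assumes "u \<in> nodes T" "v \<in> nodes T"
  shows "D u v = D v u"
proof -
  have "tpath v u = rev (tpath u v)"
    using tpath[OF assms] is_path_rev[OF tpath(1)[OF assms]] is_path_not_Nil[OF tpath(1)[OF assms]]
    by (intro tpath_eq) (simp_all add: hd_rev last_rev)
  thus ?thesis unfolding D_def by (simp add: path_length_rev insert_commute)
qed

lemma D_median:
  assumes "a \<in> nodes T" "b \<in> nodes T" "c \<in> nodes T"
  obtains m where "m \<in> nodes T" "m \<in> set (tpath a b)" "m \<in> set (tpath c b)" "m \<in> set (tpath c a)"
proof -
  have a: "a \<in> set (tpath c a)" "a \<in> set (tpath a b)"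
    using tpath[OF assms(3,1)] tpath[OF assms(1,2)] hd_in_set last_in_set is_path_not_Nil by metis+
  \<comment> \<open>\<open>m\<close> is the first vertex of the path from \<open>c\<close> to
    \<open>a\<close> that meets the path from \<open>a\<close> to \<open>b\<close>. The part up to
    \<open>m\<close> followed by the rest of the second path therefore repeats no vertex and is the
    path from \<open>c\<close> to \<open>b\<close>.\<close>
  then obtain xs m ys where s: "tpath c a = xs @ m # ys" "m \<in> set (tpath a b)"
    "\<forall>x\<in>set xs. x \<notin> set (tpath a b)"
    using split_list_first_prop[of "tpath c a" "\<lambda>x. x \<in> set (tpath a b)"] by blast
  obtain us vs where t: "tpath a b = us @ m # vs" using split_list[OF s(2)] by blast
  have p: "is_path T (xs @ [m])" "is_path T (m # vs)"
    using is_path_appendD tpath(1)[OF assms(3,1)] tpath(1)[OF assms(1,2)] s(1) t by metis+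
  have "is_path T (xs @ m # vs)" using is_path_join[OF p] s(3) t by auto
  moreover have "hd (xs @ m # vs) = c" using tpath(2)[OF assms(3,1)] s(1) by (cases xs) auto
  moreover have "last (xs @ m # vs) = b" using tpath(3)[OF assms(1,2)] t by simp
  ultimately have "tpath c b = xs @ m # vs" by (rule tpath_eq)
  moreover have "m \<in> nodes T" using is_path_set[OF p(1)] by simp
  ultimately show ?thesis using that[of m] s by simp
qed

lemma D_triangle:
  assumes "a \<in> nodes T" "b \<in> nodes T" "c \<in> nodes T"
  shows "D a c \<le> D a b + D b c"
proof -
  obtain m where m: "m \<in> nodes T" "m \<in> set (tpath a c)" "m \<in> set (tpath b c)" "m \<in> set (tpath b a)"
    using D_median[OF assms(1,3,2)] by blast
  have "D a m + D m c = D a c" "D b m + D m c = D b c" "D b m + D m a = D b a"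
    using D_split[OF assms(1,3) m(2)] D_split[OF assms(2,3) m(3)] D_split[OF assms(2,1) m(4)]
    unfolding between_def by simp_all
  moreover have "D b a = D a b" "D m a = D a m" "0 \<le> D b m"
    using D_sym[OF assms(2,1)] D_sym[OF m(1) assms(1)] D_pos[OF assms(2) m(1)] D_self[OF m(1)]
    by (simp_all, force)
  ultimately show ?thesis by linarith
qed

lemma D_between_iff:
  assumes "u \<in> nodes T" "v \<in> nodes T" "w \<in> nodes T"
  shows "between D u w v \<longleftrightarrow> w \<in> set (tpath u v)"
proof
  assume uwv: "between D u w v"
  obtain m where m: "m \<in> nodes T" "m \<in> set (tpath u v)" "m \<in> set (tpath w v)" "m \<in> set (tpath w u)"
    using D_median[OF assms(1,2,3)] by blast
  have "D u m + D m v = D u v" "D w m + D m v = D w v" "D w m + D m u = D w u"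
    using D_split[OF assms(1,2) m(2)] D_split[OF assms(3,2) m(3)] D_split[OF assms(3,1) m(4)]
    unfolding between_def by simp_all
  moreover have "D m u = D u m" "D w u = D u w"
    using D_sym[OF m(1) assms(1)] D_sym[OF assms(3,1)] by simp_all
  moreover have "D u w + D w v = D u v" using uwv unfolding between_def by simp
  ultimately have "D w m \<le> 0" by linarith
  hence "w = m" using D_pos[OF assms(3) m(1)] by linarith
  thus "w \<in> set (tpath u v)" using m by simp
qed (use D_split[OF assms(1,2)] in simp)

lemma D_linear:
  assumes "u \<in> nodes T" "v \<in> nodes T" "x \<in> nodes T" "y \<in> nodes T"
    and "between D u x v" "between D u y v"
  shows "between D u x y \<or> between D u y x"
proof -
  have xy: "x \<in> set (tpath u v)" "y \<in> set (tpath u v)"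
    using assms(5,6) D_between_iff[OF assms(1,2,3)] D_between_iff[OF assms(1,2,4)] by simp_all
  obtain xs ys where s: "tpath u v = xs @ x # ys" using split_list[OF xy(1)] by blast
  have p: "is_path T (xs @ x # ys)" "hd (xs @ x # ys) = u" "last (xs @ x # ys) = v"
    using tpath[OF assms(1,2)] s by simp_all
  have ux: "tpath u x = xs @ [x]"
    using is_path_appendD(1)[OF p(1)] p(2) by (intro tpath_eq) (cases xs; simp)+
  have xv: "tpath x v = x # ys"
    using is_path_appendD(2)[OF p(1)] p(3) by (intro tpath_eq) simp_all
  have "y \<in> set (tpath u x) \<or> y \<in> set (tpath x v)" using xy(2) s ux xv by auto
  thus ?thesis
  proof
    assume "y \<in> set (tpath x v)"
    hence "between D x y v" by (rule D_split[OF assms(3,2)])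
    thus ?thesis using assms(5,6) unfolding between_def by linarith
  qed (use D_split[OF assms(1,3)] in simp)
qed

lemma D_edge:
  assumes "{u, v} \<in> edges T" "u \<in> nodes T" "v \<in> nodes T" "u \<noteq> v"
  shows "tpath u v = [u, v]" "D u v = wt {u, v}"
proof -
  have "is_path T [u, v]" using assms by (auto simp: is_path_def)
  thus "tpath u v = [u, v]" by (rule tpath_eq) simp_all
  thus "D u v = wt {u, v}" unfolding D_def by simp
qed

text \<open>Medians are the vertices where paths meet. By \<open>D_between_iff\<close> the vertices
  on a path are those at which distances add up, so a pair with no node strictly between is joined
  by a path of one edge.\<close>

lemma metric_tree_D: "metric_tree T D"
proof (rule metric_tree.intro)
  show "finite (nodes T)" "nodes T \<noteq> {}" using tree unfolding is_tree_def by simp_all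
  show "tree_metric (nodes T) D"
  proof (rule tree_metricI)
    fix a b c assume abc: "a \<in> nodes T" "b \<in> nodes T" "c \<in> nodes T"
    obtain m where m: "m \<in> nodes T" "m \<in> set (tpath a b)" "m \<in> set (tpath c b)" "m \<in> set (tpath c a)"
      using D_median[OF abc] by blast
    have "between D a m b" "between D c m b" "between D c m a"
      using D_split[OF abc(1,2) m(2)] D_split[OF abc(3,2) m(3)] D_split[OF abc(3,1) m(4)] by simp_all
    moreover have "D c m = D m c" "D m b = D b m" "D c b = D b c" "D m a = D a m" "D c a = D a c"
      using D_sym abc m(1) by simp_all
    ultimately show "\<exists>m\<in>nodes T. between D a m b \<and> between D b m c \<and> between D a m c"
      using m(1) unfolding between_def by (intro bexI[of _ m]) simp_all
  qed (fact D_self D_pos D_sym D_triangle D_linear)+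
  have sub: "edges T \<subseteq> {{u, v} | u v. u \<in> nodes T \<and> v \<in> nodes T \<and> u \<noteq> v}"
    using tree unfolding is_tree_def by simp
  have "w \<in> {u, v}" if "{u, v} \<in> edges T" "u \<in> nodes T" "v \<in> nodes T" "u \<noteq> v" "w \<in> nodes T" "between D u w v"
    for u v w
    using that(6) D_between_iff[OF that(2,3,5)] D_edge(1)[OF that(1-4)] by simp
  moreover have "{u, v} \<in> edges T" if uv: "u \<in> nodes T" "v \<in> nodes T" "u \<noteq> v"
    "\<forall>w\<in>nodes T. between D u w v \<longrightarrow> w \<in> {u, v}" for u v
  proof -
    obtain x zs where xs: "tpath u v = u # x # zs" using tpath_ConsE[OF uv(1-3)] by blast
    have p: "{u, x} \<in> edges T" "x \<noteq> u" "x \<in> nodes T"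
      using tpath(1)[OF uv(1,2)] is_path_set[OF tpath(1)[OF uv(1,2)]]
      by (auto simp: xs is_path_Cons_Cons)
    have "between D u x v" using D_split[OF uv(1,2)] xs by simp
    hence "x = v" using uv(4) p by blast
    thus ?thesis using p by simp
  qed
  ultimately show "edges T = {{u, v} | u v. u \<in> nodes T \<and> v \<in> nodes T \<and> u \<noteq> v \<and>
      (\<forall>w\<in>nodes T. between D u w v \<longrightarrow> w \<in> {u, v})}"
    using sub by (intro equalityI subsetI) (smt (verit) mem_Collect_eq subsetD, smt (verit) mem_Collect_eq)
qed

end

section \<open>Trees are determined by the distances of their leaves\<close>

text \<open>Leaf edges get one unit of length for each of their leaves, so that a tree with no internal
  node is a single edge of length 2.\<close>

definition edge_weight :: "('v, 'm) ltree_scheme \<Rightarrow> 'v set \<Rightarrow> real" where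
  "edge_weight T e =
     (if e \<in> internal_edges T then len T e else real (card {v \<in> e. degree T v = 1}))"

text \<open>\<open>metric_tree\<close> determines the shape but leaves the lengths free; here they
  are tied to \<open>len\<close> on internal edges and to the conventional lengths on leaf
  edges.\<close>

locale realized_tree = metric_tree T d
  for T :: "('v, 'm) ltree_scheme" and d :: "'v \<Rightarrow> 'v \<Rightarrow> real" +
  assumes edge_dist: "{u, v} \<in> edges T \<Longrightarrow> d u v = edge_weight T {u, v}"

lemma realized_tree_exists:
  assumes "is_tree T" "\<forall>e\<in>internal_edges T. 0 < len T e"
  shows "\<exists>d. realized_tree T d"
proof -
  interpret weighted_tree T "edge_weight T"
  proof
    fix e assume e: "e \<in> edges T"
    have "finite e" using assms(1) e unfolding is_tree_def by auto
    show "0 < edge_weight T e"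
    proof (cases "e \<in> internal_edges T")
      case False
      then obtain v where "v \<in> e" "degree T v = 1" using e unfolding internal_edges_def by blast
      hence "{v \<in> e. degree T v = 1} \<noteq> {}" "finite {v \<in> e. degree T v = 1}" using \<open>finite e\<close> by auto
      hence "0 < card {v \<in> e. degree T v = 1}" by (simp add: card_gt_0_iff)
      thus ?thesis using False unfolding edge_weight_def by simp
    qed (use assms(2) in \<open>simp add: edge_weight_def\<close>)
  qed (rule assms(1))
  interpret M: metric_tree T D by (rule metric_tree_D)
  have "realized_tree T D"
  proof (intro realized_tree.intro realized_tree_axioms.intro metric_tree_D)
    fix u v assume "{u, v} \<in> edges T"
    thus "D u v = edge_weight T {u, v}" using D_edge(2)[of u v] M.edge_nodes[of u v] by simp
  qed
  thus ?thesis by blast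
qed

lemma degree_iso:
  assumes "metric_tree S dS" "metric_tree T dT" "bij_betw f (nodes S) (nodes T)"
    and "\<forall>u\<in>nodes S. \<forall>v\<in>nodes S. {u, v} \<in> edges S \<longleftrightarrow> {f u, f v} \<in> edges T"
    and "v \<in> nodes S"
  shows "degree T (f v) = degree S v"
proof -
  have fv: "f v \<in> nodes T" using assms(3,5) by (rule bij_betw_apply)
  have "bij_betw f {w \<in> nodes S. {v, w} \<in> edges S} {w \<in> nodes T. {f v, w} \<in> edges T}"
  proof (rule bij_betw_imageI)
    show "inj_on f {w \<in> nodes S. {v, w} \<in> edges S}"
      using assms(3) by (auto simp: bij_betw_def inj_on_def)
    show "f ` {w \<in> nodes S. {v, w} \<in> edges S} = {w \<in> nodes T. {f v, w} \<in> edges T}"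
    proof (intro equalityI subsetI)
      fix w assume w: "w \<in> {w \<in> nodes T. {f v, w} \<in> edges T}"
      then obtain u where u: "u \<in> nodes S" "w = f u" using assms(3) by (auto simp: bij_betw_def)
      hence "{v, u} \<in> edges S" using w assms(4) assms(5) u(1) by simp
      thus "w \<in> f ` {w \<in> nodes S. {v, w} \<in> edges S}" using u by blast
    next
      fix w assume "w \<in> f ` {w \<in> nodes S. {v, w} \<in> edges S}"
      then obtain u where u: "u \<in> nodes S" "{v, u} \<in> edges S" "w = f u" by blast
      thus "w \<in> {w \<in> nodes T. {f v, w} \<in> edges T}"
        using assms(4,5) u bij_betw_apply[OF assms(3) u(1)] by simp
    qed
  qed
  from bij_betw_same_card[OF this] show ?thesis
    using metric_tree.degree_eq[OF assms(1,5)] metric_tree.degree_eq[OF assms(2) fv] by simp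
qed

lemma internal_edges_iso:
  assumes "metric_tree S dS" "metric_tree T dT" "bij_betw f (nodes S) (nodes T)"
    and "\<forall>u\<in>nodes S. \<forall>v\<in>nodes S. {u, v} \<in> edges S \<longleftrightarrow> {f u, f v} \<in> edges T"
    and "u \<in> nodes S" "v \<in> nodes S"
  shows "{f u, f v} \<in> internal_edges T \<longleftrightarrow> {u, v} \<in> internal_edges S"
  unfolding internal_edges_def
  using assms(4-6) degree_iso[OF assms(1-4) assms(5)] degree_iso[OF assms(1-4) assms(6)]
  by auto

lemma ltree_iso_dist:
  assumes "realized_tree S dS" "realized_tree T dT" "ltree_iso_map L S T \<pi> f"
    and "u \<in> nodes S" "v \<in> nodes S"
  shows "dT (f u) (f v) = dS u v"
proof -
  interpret S: realized_tree S dS by (rule assms(1))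
  interpret T: realized_tree T dT by (rule assms(2))
  have f: "bij_betw f (nodes S) (nodes T)"
    and e: "\<forall>u\<in>nodes S. \<forall>v\<in>nodes S. {u, v} \<in> edges S \<longleftrightarrow> {f u, f v} \<in> edges T"
    and l: "\<And>e. e \<in> internal_edges S \<Longrightarrow> len T (f ` e) = len S e"
    using assms(3) unfolding ltree_iso_map_def by simp_all
  have inj: "f x = f y \<longleftrightarrow> x = y" if "x \<in> nodes S" "y \<in> nodes S" for x y
    using f that unfolding bij_betw_def inj_on_def by auto
  note iso = S.metric_tree_axioms T.metric_tree_axioms f e
  have edge: "dT (f x) (f y) = dS x y" if xy: "{x, y} \<in> edges S" for x y
  proof -
    have n: "x \<in> nodes S" "y \<in> nodes S" "x \<noteq> y" using S.edge_nodes[OF xy] by simp_all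
    have fxy: "{f x, f y} \<in> edges T" using e n xy by simp
    have i: "{f x, f y} \<in> internal_edges T \<longleftrightarrow> {x, y} \<in> internal_edges S"
      using internal_edges_iso[OF iso n(1,2)] .
    have deg: "degree T (f x) = degree S x" "degree T (f y) = degree S y"
      using degree_iso[OF iso n(1)] degree_iso[OF iso n(2)] .
    have "card {v \<in> {f x, f y}. degree T v = 1} = card {v \<in> {x, y}. degree S v = 1}"
    proof -
      have "{v \<in> {f x, f y}. degree T v = 1} = f ` {v \<in> {x, y}. degree S v = 1}"
        using deg by auto
      moreover have "inj_on f {v \<in> {x, y}. degree S v = 1}"
        using inj n unfolding inj_on_def by auto
      ultimately show ?thesis by (simp add: card_image)
    qed
    moreover have "len T {f x, f y} = len S {x, y}" if "{x, y} \<in> internal_edges S"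
      using l[OF that] by simp
    ultimately show ?thesis
      using S.edge_dist[OF xy] T.edge_dist[OF fxy] i unfolding edge_weight_def by simp
  qed
  have path: "is_path T (map f vs) \<and> path_length dT (map f vs) = path_length dS vs"
    if "is_path S vs" for vs
    using that
  proof (induction rule: is_path_induct)
    case (single x)
    thus ?case using f by (simp add: is_path_single bij_betw_apply)
  next
    case (Cons x y zs)
    have y: "y \<in> nodes S" using S.edge_nodes(2)[OF Cons.hyps(2)] .
    have "f x \<notin> f ` set (y # zs)"
      using inj Cons.hyps(1,3) is_path_set[OF Cons.hyps(4)] by blast
    thus ?case using Cons edge[OF Cons.hyps(2)] e y f
      by (simp add: is_path_Cons_Cons bij_betw_apply)
  qed
  obtain vs where vs: "is_path S vs" "hd vs = u" "last vs = v"
    using S.path_exists[OF assms(4,5)] by blast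
  have "hd (map f vs) = f u" "last (map f vs) = f v"
    using vs is_path_not_Nil[OF vs(1)] by (simp_all add: hd_map last_map)
  thus ?thesis
    using S.dist_path_length[OF vs(1)] T.dist_path_length[of "map f vs"] path[OF vs(1)] vs by simp
qed

text \<open>Every branch node is a median of leaves and can thus be described by leaf distances
  alone. The leaves are found by prolonging three edges at \<open>v\<close>.\<close>

lemma (in metric_tree) three_leaves:
  assumes "v \<in> nodes T" "3 \<le> degree T v"
  obtains a b c where "a \<in> nodes T" "b \<in> nodes T" "c \<in> nodes T"
    "degree T a = 1" "degree T b = 1" "degree T c = 1"
    "between d a v b" "between d b v c" "between d a v c"
proof -
  obtain a b c where abc: "{v, a} \<in> edges T" "{v, b} \<in> edges T" "{v, c} \<in> edges T"
    "between d a v b" "between d b v c" "between d a v c"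
    using degree_ge_3E[OF assms] by blast
  have leaf: "\<exists>x. x \<in> nodes T \<and> degree T x = 1 \<and> between d v y x" if "{v, y} \<in> edges T" for y
    using leaf_beyond[OF edge_nodes[OF that]] by blast
  have ext: "between d x v x'" if e: "{v, y} \<in> edges T" "{v, y'} \<in> edges T" "between d y v y'"
    and x: "x \<in> nodes T" "between d v y x" and x': "x' \<in> nodes T" "between d v y' x'" for x x' y y'
  proof -
    note n = edge_nodes[OF e(1)] edge_nodes[OF e(2)]
    have "between d x y v" using between_sym[OF n(1) x(1) n(2)] x(2) by simp
    hence "between d x v y'" using between_concat(2)[OF x(1) n(5,2,1) _ e(3)] n by simp
    thus ?thesis using between_concat(1)[OF x(1) x'(1) n(1,5) _ x'(2)] n by simp
  qed
  obtain x y z where "x \<in> nodes T \<and> degree T x = 1 \<and> between d v a x"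
    "y \<in> nodes T \<and> degree T y = 1 \<and> between d v b y"
    "z \<in> nodes T \<and> degree T z = 1 \<and> between d v c z"
    using leaf[OF abc(1)] leaf[OF abc(2)] leaf[OF abc(3)] by blast
  thus ?thesis using that[of x y z] ext[OF abc(1,2,4)] ext[OF abc(2,3,5)] ext[OF abc(1,3,6)] by simp
qed

text \<open>The index maps are kept separate from the labellings so that \<open>\<beta>\<close> can
  absorb a permutation of the labels such as \<open>swap_label\<close>.\<close>

locale leaf_isometry =
  S: metric_tree S dS + T: metric_tree T dT
  for S :: "('v, 'm) ltree_scheme" and dS and T :: "('w, 'k) ltree_scheme" and dT +
  fixes L :: "'l set" and \<alpha> :: "'l \<Rightarrow> 'v" and \<beta> :: "'l \<Rightarrow> 'w"
  assumes leaves: "\<alpha> ` L = {v \<in> nodes S. degree S v = 1}" "\<beta> ` L = {v \<in> nodes T. degree T v = 1}"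
    and inner: "v \<in> nodes S \<Longrightarrow> degree S v \<noteq> 1 \<Longrightarrow> 3 \<le> degree S v"
      "w \<in> nodes T \<Longrightarrow> degree T w \<noteq> 1 \<Longrightarrow> 3 \<le> degree T w"
    and dist_eq: "k \<in> L \<Longrightarrow> l \<in> L \<Longrightarrow> dS (\<alpha> k) (\<alpha> l) = dT (\<beta> k) (\<beta> l)"
begin

text \<open>The vector of distances to the leaves serves as a coordinate of a node that makes sense
  in both trees.\<close>

definition matched :: "'v \<Rightarrow> 'w \<Rightarrow> bool" where
  "matched v w \<longleftrightarrow> v \<in> nodes S \<and> w \<in> nodes T \<and> (\<forall>l\<in>L. dS v (\<alpha> l) = dT w (\<beta> l))"

lemma alpha: "l \<in> L \<Longrightarrow> \<alpha> l \<in> nodes S" and beta: "l \<in> L \<Longrightarrow> \<beta> l \<in> nodes T"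
  using leaves by auto

lemma matched_leaf: "l \<in> L \<Longrightarrow> matched (\<alpha> l) (\<beta> l)"
  unfolding matched_def using alpha beta dist_eq by simp

text \<open>The right-hand side is the Gromov product of \<open>b\<close> and \<open>c\<close> at
  \<open>a\<close>.\<close>

lemma median_coord:
  assumes "tree_metric M d" "a \<in> M" "b \<in> M" "c \<in> M" "m \<in> M"
    and "between d a m b" "between d b m c" "between d a m c"
  shows "d a m = (d a b + d a c - d b c) / 2"
  using assms(6-8) tree_metric.dist_sym[OF assms(1,3,5)] unfolding between_def by (simp add: field_simps)

text \<open>An inner node is the median of three leaves; its partner is the median of the
  corresponding leaves. By \<open>median_coord\<close> the distances to these three agree, and
  \<open>median_dist\<close> extends this to all leaves.\<close>

lemma matched_exists:
  assumes "v \<in> nodes S"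
  shows "\<exists>w. matched v w"
proof (cases "degree S v = 1")
  case True
  hence "v \<in> \<alpha> ` L" using leaves assms by simp
  thus ?thesis using matched_leaf by blast
next
  case False
  then obtain x y z where xyz: "x \<in> nodes S" "y \<in> nodes S" "z \<in> nodes S"
    "degree S x = 1" "degree S y = 1" "degree S z = 1"
    and v: "between dS x v y" "between dS y v z" "between dS x v z"
    using S.three_leaves[OF assms inner(1)[OF assms]] by blast
  have "x \<in> \<alpha> ` L" "y \<in> \<alpha> ` L" "z \<in> \<alpha> ` L" using xyz leaves by simp_all
  then obtain i j k where ijk: "i \<in> L" "j \<in> L" "k \<in> L" "x = \<alpha> i" "y = \<alpha> j" "z = \<alpha> k" by blast
  note A = alpha[OF ijk(1)] alpha[OF ijk(2)] alpha[OF ijk(3)]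
  note B = beta[OF ijk(1)] beta[OF ijk(2)] beta[OF ijk(3)]
  obtain w where w: "w \<in> nodes T" "between dT (\<beta> i) w (\<beta> j)" "between dT (\<beta> j) w (\<beta> k)"
    "between dT (\<beta> i) w (\<beta> k)"
    using T.median[OF B] by blast
  have v': "between dS (\<alpha> i) v (\<alpha> j)" "between dS (\<alpha> j) v (\<alpha> k)" "between dS (\<alpha> i) v (\<alpha> k)"
    using v ijk by simp_all
  have vs: "between dS (\<alpha> j) v (\<alpha> i)" "between dS (\<alpha> k) v (\<alpha> j)" "between dS (\<alpha> k) v (\<alpha> i)"
    using v' S.between_sym A assms by blast+
  have ws: "between dT (\<beta> j) w (\<beta> i)" "between dT (\<beta> k) w (\<beta> j)" "between dT (\<beta> k) w (\<beta> i)"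
    using w T.between_sym B by blast+
  have eqs: "dS (\<alpha> i) v = dT (\<beta> i) w" "dS (\<alpha> j) v = dT (\<beta> j) w" "dS (\<alpha> k) v = dT (\<beta> k) w"
    using median_coord[OF S.tree_metric A assms v'] median_coord[OF T.tree_metric B w]
      median_coord[OF S.tree_metric A(2,1,3) assms vs(1) v'(3,2)]
      median_coord[OF T.tree_metric B(2,1,3) w(1) ws(1) w(4,3)]
      median_coord[OF S.tree_metric A(3,1,2) assms vs(3) v'(1) vs(2)]
      median_coord[OF T.tree_metric B(3,1,2) w(1) ws(3) w(2) ws(2)]
      dist_eq ijk by simp_all
  have "dS v (\<alpha> l) = dT w (\<beta> l)" if l: "l \<in> L" for l
  proof -
    have "dS (\<alpha> l) v = dT (\<beta> l) w"
      using S.median_dist[OF A assms alpha[OF l] v'] T.median_dist[OF B w(1) beta[OF l] w(2-4)]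
        eqs dist_eq[OF l ijk(1)] dist_eq[OF l ijk(2)] dist_eq[OF l ijk(3)] by simp
    thus ?thesis using S.dist_sym[OF assms alpha[OF l]] T.dist_sym[OF w(1) beta[OF l]] by simp
  qed
  hence "matched v w" unfolding matched_def using assms w(1) by simp
  thus ?thesis by blast
qed

text \<open>Prolonging the segment to a leaf writes the left side as a difference of two leaf
  distances, which is a lower bound for the other distance. Exchanging the two trees turns this into
  an equality.\<close>

lemma matched_dist_le:
  assumes "matched v w" "matched v' w'"
  shows "dS v v' \<le> dT w w'"
proof (cases "v = v'")
  case True
  thus ?thesis using assms S.dist_self T.dist_nonneg unfolding matched_def by simp
next
  case False
  have n: "v \<in> nodes S" "v' \<in> nodes S" "w \<in> nodes T" "w' \<in> nodes T"
    using assms unfolding matched_def by simp_all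
  obtain x where x: "x \<in> nodes S" "degree S x = 1" "between dS v v' x"
    using S.leaf_beyond[OF n(1,2) False] by blast
  have "x \<in> \<alpha> ` L" using leaves x by simp
  then obtain l where l: "l \<in> L" "x = \<alpha> l" by blast
  have "dS v (\<alpha> l) = dT w (\<beta> l)" "dS v' (\<alpha> l) = dT w' (\<beta> l)"
    using assms l unfolding matched_def by simp_all
  thus ?thesis using x(3) l T.triangle[OF n(3,4) beta[OF l(1)]] unfolding between_def by simp
qed

end

lemma leaf_isometry_swap: "leaf_isometry S dS T dT L \<alpha> \<beta> \<Longrightarrow> leaf_isometry T dT S dS L \<beta> \<alpha>"
  unfolding leaf_isometry_def leaf_isometry_axioms_def by auto

context leaf_isometry
begin

lemma matched_swap: "leaf_isometry.matched T dT S dS L \<beta> \<alpha> w v \<longleftrightarrow> matched v w"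
  unfolding leaf_isometry.matched_def[OF leaf_isometry_swap[OF leaf_isometry_axioms]] matched_def by auto

lemma matched_dist:
  assumes "matched v w" "matched v' w'"
  shows "dT w w' = dS v v'"
  using matched_dist_le[OF assms] leaf_isometry.matched_dist_le[OF leaf_isometry_swap[OF leaf_isometry_axioms], of w v w' v']
    assms by (simp add: matched_swap)

lemma isometry_exists:
  "\<exists>f. bij_betw f (nodes S) (nodes T) \<and>
     (\<forall>u\<in>nodes S. \<forall>v\<in>nodes S. dT (f u) (f v) = dS u v) \<and>
     (\<forall>u\<in>nodes S. \<forall>v\<in>nodes S. {u, v} \<in> edges S \<longleftrightarrow> {f u, f v} \<in> edges T) \<and>
     (\<forall>l\<in>L. f (\<alpha> l) = \<beta> l)"
proof -
  define f where "f v = (SOME w. matched v w)" for v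
  have f: "matched v (f v)" if "v \<in> nodes S" for v
    unfolding f_def using matched_exists[OF that] by (rule someI_ex)
  have fn: "f v \<in> nodes T" if "v \<in> nodes S" for v using f[OF that] unfolding matched_def by simp
  have unique: "w = w'" if "matched v w" "matched v w'" for v w w'
    using matched_dist[OF that] T.dist_zero S.dist_self that unfolding matched_def by simp
  have iso: "dT (f u) (f v) = dS u v" if "u \<in> nodes S" "v \<in> nodes S" for u v
    using matched_dist[OF f f] that by simp
  have inj: "inj_on f (nodes S)"
  proof (rule inj_onI)
    fix u v assume uv: "u \<in> nodes S" "v \<in> nodes S" "f u = f v"
    hence "dS u v = 0" using iso[OF uv(1,2)] T.dist_self[OF fn[OF uv(2)]] by simp
    thus "u = v" using S.dist_zero[OF uv(1,2)] by simp
  qed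
  have surj: "\<exists>v\<in>nodes S. w = f v" if w: "w \<in> nodes T" for w
  proof -
    obtain v where v: "matched v w"
      using leaf_isometry.matched_exists[OF leaf_isometry_swap[OF leaf_isometry_axioms] w]
      by (auto simp: matched_swap)
    hence "v \<in> nodes S" unfolding matched_def by simp
    thus ?thesis using unique[OF v f] by blast
  qed
  have bij: "bij_betw f (nodes S) (nodes T)"
    using inj surj fn by (intro bij_betw_imageI) auto
  hence img: "nodes T = f ` nodes S" by (simp add: bij_betw_def)
  have "{u, v} \<in> edges S \<longleftrightarrow> {f u, f v} \<in> edges T" if uv: "u \<in> nodes S" "v \<in> nodes S" for u v
  proof -
    have eq: "f x = f y \<longleftrightarrow> x = y" if "x \<in> nodes S" "y \<in> nodes S" for x y
      using inj that unfolding inj_on_def by auto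
    have "(\<forall>w\<in>nodes T. between dT (f u) w (f v) \<longrightarrow> w = f u \<or> w = f v) \<longleftrightarrow>
      (\<forall>x\<in>nodes S. between dT (f u) (f x) (f v) \<longrightarrow> f x = f u \<or> f x = f v)"
      by (simp add: img)
    also have "\<dots> \<longleftrightarrow> (\<forall>x\<in>nodes S. between dS u x v \<longrightarrow> x = u \<or> x = v)"
      using iso eq uv unfolding between_def by simp
    finally show ?thesis using uv fn eq by (simp add: S.edge_iff T.edge_iff)
  qed
  moreover have "f (\<alpha> l) = \<beta> l" if "l \<in> L" for l
    using unique[OF f[OF alpha] matched_leaf] that by simp
  ultimately show ?thesis using bij iso by (intro exI[of _ f]) simp
qed

end

text \<open>Reconstruction of a tree from its leaf distances. With \<open>\<pi>\<close> the identity
  it identifies two trees; with \<open>\<pi>\<close> equal to \<open>swap_label\<close>, applied to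
  one tree twice, it yields the involution.\<close>

lemma ltree_iso_map_exists:
  assumes "realized_tree S dS" "realized_tree T dT"
    and "leaf_labelled_tree L S" "leaf_labelled_tree L T" "bij_betw \<pi> L L"
    and "\<And>k l. k \<in> L \<Longrightarrow> l \<in> L \<Longrightarrow>
      dS (leaf S k) (leaf S l) = dT (leaf T (\<pi> k)) (leaf T (\<pi> l))"
    and "L \<noteq> {}"
  shows "\<exists>f. ltree_iso_map L S T \<pi> f \<and>
    (\<forall>u\<in>nodes S. \<forall>v\<in>nodes S. dT (f u) (f v) = dS u v)"
proof -
  interpret S: realized_tree S dS by (rule assms(1))
  interpret T: realized_tree T dT by (rule assms(2))
  obtain l0 where l0: "l0 \<in> L" using assms(7) by blast
  have inner: "3 \<le> degree X v" if "leaf_labelled_tree L X" "metric_tree X dX" "v \<in> nodes X" "degree X v \<noteq> 1"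
    for X :: "('z, 'y) ltree_scheme" and dX and v
  proof -
    have "leaf X l0 \<in> {v \<in> nodes X. degree X v = 1}"
      using that(1) l0 unfolding leaf_labelled_tree_def by (auto dest: bij_betw_apply)
    \<comment> \<open>A tree consisting of one isolated node is excluded by
      \<open>L \<noteq> {}\<close>.\<close>
    hence "degree X v \<noteq> 0" using metric_tree.degree_pos[OF that(2,3), of "leaf X l0"] that(4) by auto
    moreover have "degree X v \<noteq> 2" using that(1,3) unfolding leaf_labelled_tree_def by simp
    ultimately show ?thesis using that(4) by linarith
  qed
  have lT: "leaf T ` L = {v \<in> nodes T. degree T v = 1}"
    using assms(4) unfolding leaf_labelled_tree_def by (simp add: bij_betw_def)
  interpret leaf_isometry S dS T dT L "leaf S" "\<lambda>l. leaf T (\<pi> l)"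
  proof
    show "leaf S ` L = {v \<in> nodes S. degree S v = 1}"
      using assms(3) unfolding leaf_labelled_tree_def by (simp add: bij_betw_def)
    show "(\<lambda>l. leaf T (\<pi> l)) ` L = {v \<in> nodes T. degree T v = 1}"
      using lT assms(5) unfolding bij_betw_def by (simp flip: image_image)
  qed (use inner[OF assms(3) S.metric_tree_axioms] inner[OF assms(4) T.metric_tree_axioms] assms(6) in auto)
  obtain f where f: "bij_betw f (nodes S) (nodes T)"
    and iso: "\<forall>u\<in>nodes S. \<forall>v\<in>nodes S. dT (f u) (f v) = dS u v"
    and e: "\<forall>u\<in>nodes S. \<forall>v\<in>nodes S. {u, v} \<in> edges S \<longleftrightarrow> {f u, f v} \<in> edges T"
    and l: "\<forall>l\<in>L. f (leaf S l) = leaf T (\<pi> l)"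
    using isometry_exists by blast
  have "len T (f ` e) = len S e" if int: "e \<in> internal_edges S" for e
  proof -
    have "e \<in> edges S" using int unfolding internal_edges_def by simp
    then obtain u v where uv: "e = {u, v}" "u \<in> nodes S" "v \<in> nodes S" by (rule S.edgeE)
    have "{f u, f v} \<in> internal_edges T"
      using internal_edges_iso[OF S.metric_tree_axioms T.metric_tree_axioms f e uv(2,3)] int uv by simp
    hence "len T {f u, f v} = dT (f u) (f v)"
      using T.edge_dist[of "f u" "f v"] unfolding edge_weight_def internal_edges_def by simp
    moreover have "len S {u, v} = dS u v"
      using S.edge_dist[of u v] int uv \<open>e \<in> edges S\<close> unfolding edge_weight_def by simp
    ultimately show ?thesis using iso uv by simp
  qed
  thus ?thesis unfolding ltree_iso_map_def using f iso e l by (intro exI[of _ f]) simp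
qed

section \<open>Tropically singular minors\<close>

text \<open>The arguments stand for the even and the odd permutations of a 3 x 3 determinant; the
  minimum is attained twice iff no argument is strictly below the other five. In this form a common
  summand and the order of the arguments are visibly immaterial.\<close>

definition tied_min :: "real \<Rightarrow> real \<Rightarrow> real \<Rightarrow> real \<Rightarrow> real \<Rightarrow> real \<Rightarrow> bool" where
  "tied_min e1 e2 e3 o1 o2 o3 \<longleftrightarrow>
     (e2 \<le> e1 \<or> e3 \<le> e1 \<or> o1 \<le> e1 \<or> o2 \<le> e1 \<or> o3 \<le> e1) \<and>
     (e1 \<le> e2 \<or> e3 \<le> e2 \<or> o1 \<le> e2 \<or> o2 \<le> e2 \<or> o3 \<le> e2) \<and>
     (e1 \<le> e3 \<or> e2 \<le> e3 \<or> o1 \<le> e3 \<or> o2 \<le> e3 \<or> o3 \<le> e3) \<and>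
     (e1 \<le> o1 \<or> e2 \<le> o1 \<or> e3 \<le> o1 \<or> o2 \<le> o1 \<or> o3 \<le> o1) \<and>
     (e1 \<le> o2 \<or> e2 \<le> o2 \<or> e3 \<le> o2 \<or> o1 \<le> o2 \<or> o3 \<le> o2) \<and>
     (e1 \<le> o3 \<or> e2 \<le> o3 \<or> e3 \<le> o3 \<or> o1 \<le> o3 \<or> o2 \<le> o3)"

definition trop_singular :: "('i \<Rightarrow> 'j \<Rightarrow> real) \<Rightarrow> 'i \<Rightarrow> 'i \<Rightarrow> 'i \<Rightarrow> 'j \<Rightarrow> 'j \<Rightarrow> 'j \<Rightarrow> bool" where
  "trop_singular f i1 i2 i3 j1 j2 j3 \<longleftrightarrow> tied_min
     (f i1 j1 + f i2 j2 + f i3 j3) (f i1 j2 + f i2 j3 + f i3 j1) (f i1 j3 + f i2 j1 + f i3 j2)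
     (f i1 j1 + f i2 j3 + f i3 j2) (f i1 j2 + f i2 j1 + f i3 j3) (f i1 j3 + f i2 j2 + f i3 j1)"

lemma trop_singular_swap_rows:
  "trop_singular f i2 i1 i3 j1 j2 j3 \<longleftrightarrow> trop_singular f i1 i2 i3 j1 j2 j3"
  "trop_singular f i1 i3 i2 j1 j2 j3 \<longleftrightarrow> trop_singular f i1 i2 i3 j1 j2 j3"
  unfolding trop_singular_def tied_min_def Let_def by (simp_all only: ac_simps)

lemma trop_singular_swap_cols:
  "trop_singular f i1 i2 i3 j2 j1 j3 \<longleftrightarrow> trop_singular f i1 i2 i3 j1 j2 j3"
  "trop_singular f i1 i2 i3 j1 j3 j2 \<longleftrightarrow> trop_singular f i1 i2 i3 j1 j2 j3"
  unfolding trop_singular_def tied_min_def Let_def by (simp_all only: ac_simps)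

lemma trop_singular_transpose:
  "trop_singular (\<lambda>j i. f i j) j1 j2 j3 i1 i2 i3 \<longleftrightarrow> trop_singular f i1 i2 i3 j1 j2 j3"
  unfolding trop_singular_def tied_min_def Let_def by (simp_all only: ac_simps)

section \<open>Monomials of the 3 x 3 minors of the generic symmetric matrix\<close>

definition pair_monomial :: "nat \<Rightarrow> nat \<Rightarrow> monomial" where
  "pair_monomial i j = Poly_Mapping.single (min i j, max i j) 1"

lemma pair_monomial_eq_iff_key:
  "pair_monomial i j = pair_monomial k l \<longleftrightarrow> (min i j, max i j) = (min k l, max k l)"
  unfolding pair_monomial_def by (auto dest: arg_cong[where f=Poly_Mapping.keys])

lemma pair_monomial_eq_iff: "pair_monomial i j = pair_monomial k l \<longleftrightarrow> i = k \<and> j = l \<or> i = l \<and> j = k"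
  unfolding pair_monomial_eq_iff_key by (auto simp: min_def max_def)

lemma pair_monomial_lookup:
  "Poly_Mapping.lookup (pair_monomial i j) (min k l, max k l) =
    (if pair_monomial i j = pair_monomial k l then 1 else 0)"
  unfolding pair_monomial_eq_iff_key by (simp add: pair_monomial_def lookup_single when_def)

lemma tropical_weight_mono:
  assumes "\<And>i j. A $$ (min i j, max i j) = f i j"
  shows "tropical_weight A (pair_monomial i1 j1 + pair_monomial i2 j2 + pair_monomial i3 j3) = f i1 j1 + f i2 j2 + f i3 j3"
proof -
  have add: "tropical_weight A (m + m') = tropical_weight A m + tropical_weight A m'" for m m'
    unfolding tropical_weight_def by (rule setsum_keys_plus_distrib) (simp_all add: algebra_simps)
  have "tropical_weight A (pair_monomial i j) = f i j" for i j
    unfolding tropical_weight_def pair_monomial_def using assms[of i j] by simp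
  thus ?thesis by (simp add: add)
qed

definition mono3 :: "nat \<Rightarrow> nat \<Rightarrow> nat \<Rightarrow> nat \<Rightarrow> nat \<Rightarrow> nat \<Rightarrow> monomial" where
  "mono3 i1 i2 i3 a b c = pair_monomial i1 a + pair_monomial i2 b + pair_monomial i3 c"

text \<open>The variable at \<open>(i1, a)\<close> divides the left side, so it is one of the two
  variables on the right. Even after identifying \<open>(i, j)\<close> with \<open>(j, i)\<close>
  this would need \<open>a = b\<close> or \<open>i1 = i2\<close>.\<close>

lemma pair_monomial_swap_neq:
  assumes "i1 \<noteq> i2" "a \<noteq> b"
  shows "pair_monomial i1 a + pair_monomial i2 b \<noteq> pair_monomial i1 b + pair_monomial i2 a"
proof
  assume "pair_monomial i1 a + pair_monomial i2 b = pair_monomial i1 b + pair_monomial i2 a"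
  from this[THEN arg_cong[where f="\<lambda>m. Poly_Mapping.lookup m (min i1 a, max i1 a)"]]
  have "pair_monomial i1 b = pair_monomial i1 a \<or> pair_monomial i2 a = pair_monomial i1 a"
    unfolding lookup_add pair_monomial_lookup by (auto split: if_splits)
  thus False using assms by (auto simp: pair_monomial_eq_iff)
qed

text \<open>An even and an odd permutation of three letters differ by a transposition. Terms of
  opposite sign are therefore different monomials, and nothing cancels in a minor.\<close>

lemma mono3_transposition_neq:
  assumes "i1 \<noteq> i2" "i2 \<noteq> i3" "i1 \<noteq> i3" "a \<noteq> b" "b \<noteq> c" "a \<noteq> c"
  shows "mono3 i1 i2 i3 a b c \<noteq> mono3 i1 i2 i3 b a c"
    "mono3 i1 i2 i3 a b c \<noteq> mono3 i1 i2 i3 a c b"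
    "mono3 i1 i2 i3 a b c \<noteq> mono3 i1 i2 i3 c b a"
proof -
  show "mono3 i1 i2 i3 a b c \<noteq> mono3 i1 i2 i3 b a c"
    using pair_monomial_swap_neq[of i1 i2 a b] assms unfolding mono3_def by simp
  show "mono3 i1 i2 i3 a b c \<noteq> mono3 i1 i2 i3 a c b"
    using pair_monomial_swap_neq[of i2 i3 b c] assms unfolding mono3_def by (simp add: add.assoc)
  have r: "x + y + z = x + z + y" for x y z :: monomial by (simp add: ac_simps)
  show "mono3 i1 i2 i3 a b c \<noteq> mono3 i1 i2 i3 c b a"
    using pair_monomial_swap_neq[of i1 i3 a c] assms unfolding mono3_def
    by (subst r, subst (2) r) simp
qed

text \<open>Terms of equal sign coincide only when they are the two 3-cycles of a principal minor,
  both giving the product of the three off-diagonal variables.\<close>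

lemma mono3_cycle_eqD:
  assumes "i1 \<noteq> i2" "i2 \<noteq> i3" "i1 \<noteq> i3" "a \<noteq> b" "b \<noteq> c" "a \<noteq> c"
    and eq: "mono3 i1 i2 i3 a b c = mono3 i1 i2 i3 b c a"
  shows "c = i1 \<and> a = i2 \<and> b = i3"
proof -
  have "pair_monomial i1 b = pair_monomial i1 a \<or> pair_monomial i2 c = pair_monomial i1 a \<or> pair_monomial i3 a = pair_monomial i1 a"
    using eq[THEN arg_cong[where f="\<lambda>m. Poly_Mapping.lookup m (min i1 a, max i1 a)"]]
    unfolding lookup_add pair_monomial_lookup mono3_def by (auto split: if_splits)
  hence 1: "c = i1 \<and> a = i2" using assms by (auto simp: pair_monomial_eq_iff)
  have "pair_monomial i1 b = pair_monomial i2 b \<or> pair_monomial i2 c = pair_monomial i2 b \<or> pair_monomial i3 a = pair_monomial i2 b"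
    using eq[THEN arg_cong[where f="\<lambda>m. Poly_Mapping.lookup m (min i2 b, max i2 b)"]]
    unfolding lookup_add pair_monomial_lookup mono3_def by (auto split: if_splits)
  thus ?thesis using assms 1 by (auto simp: pair_monomial_eq_iff)
qed

lemma det_three:
  fixes M :: "'a :: comm_ring_1 mat"
  assumes "M \<in> carrier_mat 3 3"
  shows "det M = M $$ (0,0) * M $$ (1,1) * M $$ (2,2) + M $$ (0,1) * M $$ (1,2) * M $$ (2,0)
    + M $$ (0,2) * M $$ (1,0) * M $$ (2,1) - M $$ (0,0) * M $$ (1,2) * M $$ (2,1)
    - M $$ (0,1) * M $$ (1,0) * M $$ (2,2) - M $$ (0,2) * M $$ (1,1) * M $$ (2,0)"
proof -
  have s: "{0..<3} = {0, 1, 2 :: nat}" by auto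
  have f123: "finite {1, 2 :: nat}" "0 \<notin> {1, 2 :: nat}" by auto
  have f23: "finite {2 :: nat}" "1 \<notin> {2 :: nat}" by auto
  show ?thesis
    unfolding det_def'[OF assms] s
    unfolding sum_over_permutations_insert[OF f123] sum_over_permutations_insert[OF f23] permutes_sing
    by (simp add: sign_swap_id permutation_swap_id sign_compose sign_id transpose_def algebra_simps)
qed

text \<open>Monomials may coincide within one sign class; their coefficients then add up with equal
  signs and stay nonzero in characteristic 0.\<close>

lemma keys_signed_sum:
  fixes e1 :: monomial
  assumes "{e1, e2, e3} \<inter> {o1, o2, o3} = {}"
  shows "Poly_Mapping.keys (Poly_Mapping.single e1 1 + Poly_Mapping.single e2 1 + Poly_Mapping.single e3 1
      - Poly_Mapping.single o1 1 - Poly_Mapping.single o2 1 - Poly_Mapping.single o3 1 :: polynomial) =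
    {e1, e2, e3, o1, o2, o3}"
proof (rule Set.set_eqI)
  fix q
  let ?p = "Poly_Mapping.single e1 1 + Poly_Mapping.single e2 1 + Poly_Mapping.single e3 1
      - Poly_Mapping.single o1 1 - Poly_Mapping.single o2 1 - Poly_Mapping.single o3 1 :: polynomial"
  have l: "Poly_Mapping.lookup ?p q = of_bool (q = e1) + of_bool (q = e2) + of_bool (q = e3)
      - of_bool (q = o1) - of_bool (q = o2) - of_bool (q = o3)"
    by (auto simp: lookup_add lookup_minus lookup_single when_def)
  have "Poly_Mapping.lookup ?p q \<noteq> 0 \<longleftrightarrow> q \<in> {e1, e2, e3, o1, o2, o3}"
  proof (cases "q \<in> {e1, e2, e3}")
    case True
    hence "q \<noteq> o1" "q \<noteq> o2" "q \<noteq> o3" using assms by auto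
    moreover have "0 < (of_bool (q = e1) + of_bool (q = e2) + of_bool (q = e3) :: rat)" using True by auto
    ultimately show ?thesis unfolding l using True by auto
  next
    case False
    show ?thesis
    proof (cases "q \<in> {o1, o2, o3}")
      case True
      hence "0 < (of_bool (q = o1) + of_bool (q = o2) + of_bool (q = o3) :: rat)" by auto
      thus ?thesis unfolding l using True False by auto
    qed (use False in \<open>auto simp: l\<close>)
  qed
  thus "q \<in> Poly_Mapping.keys ?p \<longleftrightarrow> q \<in> {e1, e2, e3, o1, o2, o3}" by (simp add: in_keys_iff)
qed

text \<open>The right-hand side has the shape of \<open>tied_min\<close>. Nonemptiness supplies a
  minimal monomial for the converse direction.\<close>

lemma tropically_vanishes_iff:
  assumes "Poly_Mapping.keys p \<noteq> {}"
  shows "tropically_vanishes p A \<longleftrightarrow> (\<forall>m\<in>Poly_Mapping.keys p. \<exists>m'\<in>Poly_Mapping.keys p.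
    m' \<noteq> m \<and> tropical_weight A m' \<le> tropical_weight A m)" (is "?V \<longleftrightarrow> ?R")
proof
  assume ?V
  then obtain m m' where m: "m \<in> Poly_Mapping.keys p" "m' \<in> Poly_Mapping.keys p" "m \<noteq> m'"
    "tropical_weight A m = tropical_weight A m'"
    "\<forall>q\<in>Poly_Mapping.keys p. tropical_weight A m \<le> tropical_weight A q"
    unfolding tropically_vanishes_def by blast
  show ?R
  proof
    fix q assume q: "q \<in> Poly_Mapping.keys p"
    show "\<exists>m'\<in>Poly_Mapping.keys p. m' \<noteq> q \<and> tropical_weight A m' \<le> tropical_weight A q"
    proof (cases "q = m")
      case True
      thus ?thesis using m by (intro bexI[of _ m']) auto
    next
      case False
      thus ?thesis using m q by (intro bexI[of _ m]) auto
    qed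
  qed
next
  assume R: ?R
  let ?m = "arg_min_on (tropical_weight A) (Poly_Mapping.keys p)"
  have m: "?m \<in> Poly_Mapping.keys p" "\<forall>q\<in>Poly_Mapping.keys p. tropical_weight A ?m \<le> tropical_weight A q"
    using arg_min_if_finite[of "Poly_Mapping.keys p" "tropical_weight A"] assms by (auto simp: not_less)
  then obtain m' where m': "m' \<in> Poly_Mapping.keys p" "m' \<noteq> ?m" "tropical_weight A m' \<le> tropical_weight A ?m"
    using R by blast
  have "tropical_weight A ?m = tropical_weight A m'" using m m' by (intro order_antisym) auto
  thus ?V unfolding tropically_vanishes_def using m m' by (intro bexI[of _ ?m] bexI[of _ m']) auto
qed

lemma pick_three:
  fixes i1 i2 i3 :: nat
  assumes "i1 < i2" "i2 < i3"
  shows "pick {i1, i2, i3} 0 = i1" "pick {i1, i2, i3} 1 = i2" "pick {i1, i2, i3} 2 = i3"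
proof -
  show 0: "pick {i1, i2, i3} 0 = i1" using assms by (auto intro!: Least_equality)
  have "(LEAST a. a \<in> {i1, i2, i3} \<and> i1 < a) = i2" using assms by (intro Least_equality) auto
  thus 1: "pick {i1, i2, i3} 1 = i2" using 0 by simp
  have "(LEAST a. a \<in> {i1, i2, i3} \<and> i2 < a) = i3" using assms by (intro Least_equality) auto
  thus "pick {i1, i2, i3} 2 = i3" using 1 by (simp add: numeral_2_eq_2)
qed

lemma card_three_sorted:
  fixes I :: "nat set"
  assumes "card I = 3"
  obtains i1 i2 i3 where "I = {i1, i2, i3}" "i1 < i2" "i2 < i3"
proof -
  obtain x y z where xyz: "I = {x, y, z}" "x \<noteq> y" "y \<noteq> z" "x \<noteq> z"
    using assms by (auto simp: card_3_iff)
  define lo where "lo = min x (min y z)"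
  define hi where "hi = max x (max y z)"
  have "\<exists>m. I = {lo, m, hi} \<and> lo < m \<and> m < hi"
    using xyz unfolding lo_def hi_def min_def max_def
    by (intro exI[of _ "x + y + z - min x (min y z) - max x (max y z)"]) (auto simp: min_def max_def)
  thus ?thesis using that by blast
qed

lemma keys_minor:
  fixes i1 i2 i3 j1 j2 j3 :: nat
  assumes i: "i1 < i2" "i2 < i3" "i3 < n" and j: "j1 < j2" "j2 < j3" "j3 < n"
  shows "Poly_Mapping.keys (det (submatrix (generic_symmetric n) {i1, i2, i3} {j1, j2, j3})) =
    {mono3 i1 i2 i3 j1 j2 j3, mono3 i1 i2 i3 j2 j3 j1, mono3 i1 i2 i3 j3 j1 j2,
     mono3 i1 i2 i3 j1 j3 j2, mono3 i1 i2 i3 j2 j1 j3, mono3 i1 i2 i3 j3 j2 j1}"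
proof -
  let ?S = "submatrix (generic_symmetric n) {i1, i2, i3} {j1, j2, j3}"
  have dims: "dim_row (generic_symmetric n) = n" "dim_col (generic_symmetric n) = n"
    unfolding generic_symmetric_def by simp_all
  have "{i. i < n \<and> i \<in> {i1, i2, i3}} = {i1, i2, i3}" "{i. i < n \<and> i \<in> {j1, j2, j3}} = {j1, j2, j3}"
    using i j by auto
  hence c: "card {i. i < dim_row (generic_symmetric n) \<and> i \<in> {i1, i2, i3}} = 3"
    "card {i. i < dim_col (generic_symmetric n) \<and> i \<in> {j1, j2, j3}} = 3"
    using i j dims by simp_all
  have carrier: "?S \<in> carrier_mat 3 3" by (intro carrier_matI) (simp_all only: dim_submatrix c)
  have G: "generic_symmetric n $$ (a, b) = Poly_Mapping.single (pair_monomial a b) 1" if "a < n" "b < n" for a b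
    unfolding generic_symmetric_def variable_def pair_monomial_def using that by simp
  note idx = submatrix_index[of _ "generic_symmetric n" "{i1, i2, i3}" _ "{j1, j2, j3}", unfolded c]
  note ent = idx[of 0 0] idx[of 0 1] idx[of 0 2] idx[of 1 0] idx[of 1 1] idx[of 1 2]
    idx[of 2 0] idx[of 2 1] idx[of 2 2]
  note ent = ent[unfolded pick_three[OF i(1,2)] pick_three[OF j(1,2)]]
  have lt: "i1 < n" "i2 < n" "j1 < n" "j2 < n" using i j by simp_all
  have "det ?S = Poly_Mapping.single (mono3 i1 i2 i3 j1 j2 j3) 1 + Poly_Mapping.single (mono3 i1 i2 i3 j2 j3 j1) 1
     + Poly_Mapping.single (mono3 i1 i2 i3 j3 j1 j2) 1 - Poly_Mapping.single (mono3 i1 i2 i3 j1 j3 j2) 1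
     - Poly_Mapping.single (mono3 i1 i2 i3 j2 j1 j3) 1 - Poly_Mapping.single (mono3 i1 i2 i3 j3 j2 j1) 1"
    unfolding det_three[OF carrier] using ent
    by (simp add: G lt i(3) j(3) mult_single mono3_def)
  moreover have "{mono3 i1 i2 i3 j1 j2 j3, mono3 i1 i2 i3 j2 j3 j1, mono3 i1 i2 i3 j3 j1 j2} \<inter>
     {mono3 i1 i2 i3 j1 j3 j2, mono3 i1 i2 i3 j2 j1 j3, mono3 i1 i2 i3 j3 j2 j1} = {}"
    using mono3_transposition_neq[of i1 i2 i3 j1 j2 j3] mono3_transposition_neq[of i1 i2 i3 j2 j3 j1]
      mono3_transposition_neq[of i1 i2 i3 j3 j1 j2] i j by simp
  ultimately show ?thesis using keys_signed_sum by (simp add: insert_commute)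
qed

text \<open>Different row and column sets rule out coinciding 3-cycles, so all six monomials are
  distinct, as for a matrix without symmetry.\<close>

lemma vanishes_minor:
  fixes i1 i2 i3 j1 j2 j3 :: nat
  assumes i: "i1 < i2" "i2 < i3" "i3 < n" and j: "j1 < j2" "j2 < j3" "j3 < n"
    and A: "\<And>i j. A $$ (min i j, max i j) = f i j"
    and ne: "{i1, i2, i3} \<noteq> {j1, j2, j3}"
  shows "tropically_vanishes (det (submatrix (generic_symmetric n) {i1, i2, i3} {j1, j2, j3})) A \<longleftrightarrow>
    trop_singular f i1 i2 i3 j1 j2 j3"
proof -
  have w: "tropical_weight A (mono3 i1 i2 i3 a b c) = f i1 a + f i2 b + f i3 c" for a b c
    unfolding mono3_def using A by (rule tropical_weight_mono)
  have d: "i1 \<noteq> i2" "i2 \<noteq> i3" "i1 \<noteq> i3" "j1 \<noteq> j2" "j2 \<noteq> j3" "j1 \<noteq> j3" using i j by auto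
  have cyc: "mono3 i1 i2 i3 a b c \<noteq> mono3 i1 i2 i3 b c a" if "a \<noteq> b" "b \<noteq> c" "a \<noteq> c" "{a, b, c} = {j1, j2, j3}" for a b c
    using mono3_cycle_eqD[OF d(1-3) that(1-3)] ne that(4) by blast
  have "{j2, j3, j1} = {j1, j2, j3}" "{j3, j1, j2} = {j1, j2, j3}" "{j1, j3, j2} = {j1, j2, j3}"
    "{j3, j2, j1} = {j1, j2, j3}" "{j2, j1, j3} = {j1, j2, j3}" by auto
  note neqs = cyc[OF d(4,5,6) refl] cyc[of j2 j3 j1] cyc[of j3 j1 j2] cyc[of j1 j3 j2] cyc[of j3 j2 j1] cyc[of j2 j1 j3]
    mono3_transposition_neq[OF d(1-3), of j1 j2 j3] mono3_transposition_neq[OF d(1-3), of j2 j3 j1]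
    mono3_transposition_neq[OF d(1-3), of j3 j1 j2]
  have neqs': "distinct [mono3 i1 i2 i3 j1 j2 j3, mono3 i1 i2 i3 j2 j3 j1, mono3 i1 i2 i3 j3 j1 j2,
     mono3 i1 i2 i3 j1 j3 j2, mono3 i1 i2 i3 j2 j1 j3, mono3 i1 i2 i3 j3 j2 j1]"
    using neqs d \<open>{j2, j3, j1} = _\<close> \<open>{j3, j1, j2} = _\<close> \<open>{j1, j3, j2} = _\<close> \<open>{j3, j2, j1} = _\<close> \<open>{j2, j1, j3} = _\<close>
    by (simp add: eq_commute)
  show ?thesis
    unfolding tropically_vanishes_iff[of "det (submatrix (generic_symmetric n) {i1, i2, i3} {j1, j2, j3})",
        unfolded keys_minor[OF i j], OF insert_not_empty] trop_singular_def tied_min_def Let_def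
    using neqs' by (simp add: w eq_commute)
qed

text \<open>Five monomials remain, because the two 3-cycles give the same one. A tie between them no
  longer counts, and the disjunction asks that one of the other four weighs at most as much.\<close>

lemma vanishes_principal_minor:
  fixes i j k :: nat
  assumes i: "i < j" "j < k" "k < n"
    and A: "\<And>i j. A $$ (min i j, max i j) = f i j"
  shows "tropically_vanishes (det (submatrix (generic_symmetric n) {i, j, k} {i, j, k})) A \<longleftrightarrow>
    trop_singular f i j k i j k \<and>
    (f i i + f j j + f k k \<le> f i j + f j k + f k i \<or> f i i + 2 * f j k \<le> f i j + f j k + f k i \<or>
     f j j + 2 * f i k \<le> f i j + f j k + f k i \<or> f k k + 2 * f i j \<le> f i j + f j k + f k i)"
proof -
  have sym: "f a b = f b a" for a b using A[of a b] A[of b a] by (simp add: min.commute max.commute)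
  have w: "tropical_weight A (mono3 i j k a b c) = f i a + f j b + f k c" for a b c
    unfolding mono3_def using A by (rule tropical_weight_mono)
  have d: "i \<noteq> j" "j \<noteq> k" "i \<noteq> k" using i by auto
  have e: "mono3 i j k k i j = mono3 i j k j k i"
  proof -
    have "pair_monomial i k = pair_monomial k i" "pair_monomial j i = pair_monomial i j" "pair_monomial k j = pair_monomial j k" by (simp_all add: pair_monomial_eq_iff)
    thus ?thesis unfolding mono3_def by (simp add: ac_simps)
  qed
  note neqs = mono3_cycle_eqD[OF d, of i j k] mono3_cycle_eqD[OF d, of i k j]
    mono3_cycle_eqD[OF d, of k j i] mono3_cycle_eqD[OF d, of j i k]
    mono3_transposition_neq[OF d, of i j k] mono3_transposition_neq[OF d, of j k i]
  have neqs': "distinct [mono3 i j k i j k, mono3 i j k j k i,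
     mono3 i j k i k j, mono3 i j k j i k, mono3 i j k k j i]"
    using neqs d by (auto simp: eq_commute)
  have "tropically_vanishes (det (submatrix (generic_symmetric n) {i, j, k} {i, j, k})) A \<longleftrightarrow>
    (let e1 = f i i + f j j + f k k; e2 = f i j + f j k + f k i;
         o1 = f i i + f j k + f k j; o2 = f i j + f j i + f k k; o3 = f i k + f j j + f k i
     in (e2 \<le> e1 \<or> o1 \<le> e1 \<or> o2 \<le> e1 \<or> o3 \<le> e1) \<and>
        (e1 \<le> e2 \<or> o1 \<le> e2 \<or> o2 \<le> e2 \<or> o3 \<le> e2) \<and>
        (e1 \<le> o1 \<or> e2 \<le> o1 \<or> o2 \<le> o1 \<or> o3 \<le> o1) \<and>
        (e1 \<le> o2 \<or> e2 \<le> o2 \<or> o1 \<le> o2 \<or> o3 \<le> o2) \<and>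
        (e1 \<le> o3 \<or> e2 \<le> o3 \<or> o1 \<le> o3 \<or> o2 \<le> o3))"
    unfolding tropically_vanishes_iff[of "det (submatrix (generic_symmetric n) {i, j, k} {i, j, k})",
        unfolded keys_minor[OF i i] e, OF insert_not_empty] Let_def
    using neqs' by (simp add: w eq_commute)
  thus ?thesis unfolding trop_singular_def tied_min_def Let_def using sym[of i j] sym[of j k] sym[of i k] by argo
qed

text \<open>Minors are indexed by sets, the conditions on the matrix by triples in any order;
  adjacent transpositions connect the two.\<close>

lemma sorted_triple_wlog:
  fixes Q :: "nat \<Rightarrow> nat \<Rightarrow> nat \<Rightarrow> bool"
  assumes "\<And>a b c. Q a b c \<longleftrightarrow> Q b a c" "\<And>a b c. Q a b c \<longleftrightarrow> Q a c b"
    and sorted: "\<And>a b c. a < b \<Longrightarrow> b < c \<Longrightarrow> {a, b, c} \<subseteq> S \<Longrightarrow> Q a b c"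
    and "a \<in> S" "b \<in> S" "c \<in> S" "a \<noteq> b" "b \<noteq> c" "a \<noteq> c"
  shows "Q a b c"
proof -
  have S: "{a, b, c} \<subseteq> S" "{a, c, b} \<subseteq> S" "{b, a, c} \<subseteq> S" "{b, c, a} \<subseteq> S" "{c, a, b} \<subseteq> S" "{c, b, a} \<subseteq> S"
    using assms(4-6) by auto
  consider "a < b" "b < c" | "a < c" "c < b" | "b < a" "a < c" | "b < c" "c < a" | "c < a" "a < b" | "c < b" "b < a"
    using assms(7-9) by linarith
  thus ?thesis
  proof cases
    case 1 thus ?thesis using sorted S by blast
  next
    case 2 hence "Q a c b" using sorted S by blast
    thus ?thesis using assms(2)[of a b c] by simp
  next
    case 3 hence "Q b a c" using sorted S by blast
    thus ?thesis using assms(1)[of a b c] by simp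
  next
    case 4 hence "Q b c a" using sorted S by blast
    thus ?thesis using assms(1)[of a b c] assms(2)[of b a c] by simp
  next
    case 5 hence "Q c a b" using sorted S by blast
    thus ?thesis using assms(2)[of a b c] assms(1)[of a c b] by simp
  next
    case 6 hence "Q c b a" using sorted S by blast
    thus ?thesis using assms(1)[of a b c] assms(2)[of b a c] assms(1)[of b c a] by simp
  qed
qed

definition trop_rank_le_two :: "'i set \<Rightarrow> 'j set \<Rightarrow> ('i \<Rightarrow> 'j \<Rightarrow> real) \<Rightarrow> bool" where
  "trop_rank_le_two I J f \<longleftrightarrow> (\<forall>i1\<in>I. \<forall>i2\<in>I. \<forall>i3\<in>I. \<forall>j1\<in>J. \<forall>j2\<in>J. \<forall>j3\<in>J.
     i1 \<noteq> i2 \<and> i2 \<noteq> i3 \<and> i1 \<noteq> i3 \<and> j1 \<noteq> j2 \<and> j2 \<noteq> j3 \<and> j1 \<noteq> j3 \<longrightarrow>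
     trop_singular f i1 i2 i3 j1 j2 j3)"

lemma trop_rank_le_two_cong:
  assumes "\<And>i j. i \<in> I \<Longrightarrow> j \<in> J \<Longrightarrow> f i j = g i j"
  shows "trop_rank_le_two I J f \<longleftrightarrow> trop_rank_le_two I J g"
proof -
  have "trop_singular f i1 i2 i3 j1 j2 j3 \<longleftrightarrow> trop_singular g i1 i2 i3 j1 j2 j3"
    if "i1 \<in> I" "i2 \<in> I" "i3 \<in> I" "j1 \<in> J" "j2 \<in> J" "j3 \<in> J" for i1 i2 i3 j1 j2 j3
    unfolding trop_singular_def by (simp only: assms that)
  thus ?thesis unfolding trop_rank_le_two_def by (simp cong: ball_cong)
qed

text \<open>The product of the three off-diagonal entries occurs twice in a principal minor of the
  generic symmetric matrix, but counts as a single monomial. This is all that distinguishes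
  symmetric tropical rank 2 from tropical rank 2.\<close>

definition off_diagonal_beaten :: "nat \<Rightarrow> (nat \<Rightarrow> nat \<Rightarrow> real) \<Rightarrow> bool" where
  "off_diagonal_beaten n f \<longleftrightarrow> (\<forall>i<n. \<forall>j<n. \<forall>k<n. i \<noteq> j \<and> j \<noteq> k \<and> i \<noteq> k \<longrightarrow>
     f i i + f j j + f k k \<le> f i j + f j k + f k i \<or> f i i + 2 * f j k \<le> f i j + f j k + f k i \<or>
     f j j + 2 * f i k \<le> f i j + f j k + f k i \<or> f k k + 2 * f i j \<le> f i j + f j k + f k i)"

text \<open>Polynomials are left behind here: all minors together ask for ordinary tropical rank at
  most 2, and the principal ones contribute the additional condition.\<close>

lemma symmetric_rank2_iff:
  "symmetric_rank2_matrix n A \<longleftrightarrow> A \<in> carrier_mat n n \<and>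
     (\<forall>i<n. \<forall>j<n. A $$ (i, j) = A $$ (j, i)) \<and>
     trop_rank_le_two {..<n} {..<n} (\<lambda>i j. A $$ (i, j)) \<and> off_diagonal_beaten n (\<lambda>i j. A $$ (i, j))"
proof (cases "A \<in> carrier_mat n n \<and> (\<forall>i<n. \<forall>j<n. A $$ (i, j) = A $$ (j, i))")
  case False
  have "A $$ (i, j) = A $$ (j, i)" if "transpose_mat A = A" "A \<in> carrier_mat n n" "i < n" "j < n" for i j
  proof -
    have "transpose_mat A $$ (i, j) = A $$ (j, i)" using that(2-4) by simp
    thus ?thesis using that(1) by simp
  qed
  thus ?thesis using False unfolding symmetric_rank2_matrix_def by blast
next
  case True
  hence A: "A \<in> carrier_mat n n" and sym: "\<And>i j. i < n \<Longrightarrow> j < n \<Longrightarrow> A $$ (i, j) = A $$ (j, i)" by auto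
  define f where "f i j = A $$ (min i j, max i j)" for i j
  have f: "f i j = A $$ (i, j)" if "i < n" "j < n" for i j
    unfolding f_def using sym[OF that] by (simp add: min_def max_def)
  have fsym: "f i j = f j i" for i j unfolding f_def by (simp add: min.commute max.commute)
  have "transpose_mat A = A" using A sym by (intro eq_matI) auto
  hence "symmetric_rank2_matrix n A \<longleftrightarrow> (\<forall>I J. I \<subseteq> {..<n} \<and> J \<subseteq> {..<n} \<and> card I = 3 \<and> card J = 3 \<longrightarrow>
        tropically_vanishes (det (submatrix (generic_symmetric n) I J)) A)"
    using A unfolding symmetric_rank2_matrix_def has_symmetric_tropical_rank_def by simp
  also have "\<dots> \<longleftrightarrow> trop_rank_le_two {..<n} {..<n} f \<and> off_diagonal_beaten n f"
  proof (intro iffI conjI)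
    assume R: "trop_rank_le_two {..<n} {..<n} f \<and> off_diagonal_beaten n f"
    show "\<forall>I J. I \<subseteq> {..<n} \<and> J \<subseteq> {..<n} \<and> card I = 3 \<and> card J = 3 \<longrightarrow>
        tropically_vanishes (det (submatrix (generic_symmetric n) I J)) A"
    proof (intro allI impI)
      fix I J assume IJ: "I \<subseteq> {..<n} \<and> J \<subseteq> {..<n} \<and> card I = 3 \<and> card J = 3"
      then obtain i1 i2 i3 where i: "I = {i1, i2, i3}" "i1 < i2" "i2 < i3"
        using card_three_sorted by blast
      obtain j1 j2 j3 where j: "J = {j1, j2, j3}" "j1 < j2" "j2 < j3"
        using IJ card_three_sorted by blast
      have lt: "i3 < n" "j3 < n" "i1 < n" "i2 < n" "j1 < n" "j2 < n" using IJ i j by auto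
      have sing: "trop_singular f i1 i2 i3 j1 j2 j3"
        using R lt i j unfolding trop_rank_le_two_def by simp
      show "tropically_vanishes (det (submatrix (generic_symmetric n) I J)) A"
      proof (cases "I = J")
        case False
        thus ?thesis unfolding i(1) j(1)
          using vanishes_minor[OF i(2,3) lt(1) j(2,3) lt(2), of A f] sing f_def i(1) j(1) by simp
      next
        case True
        have "i1 = pick J 0" "i2 = pick J 1" "i3 = pick J 2" "j1 = pick J 0" "j2 = pick J 1" "j3 = pick J 2"
          using pick_three[OF i(2,3)] pick_three[OF j(2,3)] i(1) j(1) True by metis+
        hence eq: "j1 = i1" "j2 = i2" "j3 = i3" by simp_all
        have "f i1 i1 + f i2 i2 + f i3 i3 \<le> f i1 i2 + f i2 i3 + f i3 i1 \<or>
          f i1 i1 + 2 * f i2 i3 \<le> f i1 i2 + f i2 i3 + f i3 i1 \<or>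
          f i2 i2 + 2 * f i1 i3 \<le> f i1 i2 + f i2 i3 + f i3 i1 \<or>
          f i3 i3 + 2 * f i1 i2 \<le> f i1 i2 + f i2 i3 + f i3 i1"
          using R i(2,3) lt(1,3,4) unfolding off_diagonal_beaten_def by simp
        thus ?thesis using vanishes_principal_minor[OF i(2,3) lt(1), of A f] sing f_def i(1) j(1) eq by simp
      qed
    qed
  next
    assume V: "\<forall>I J. I \<subseteq> {..<n} \<and> J \<subseteq> {..<n} \<and> card I = 3 \<and> card J = 3 \<longrightarrow>
        tropically_vanishes (det (submatrix (generic_symmetric n) I J)) A"
    have V': "tropically_vanishes (det (submatrix (generic_symmetric n) {i1, i2, i3} {j1, j2, j3})) A"
      if "i1 < i2" "i2 < i3" "i3 < n" "j1 < j2" "j2 < j3" "j3 < n" for i1 i2 i3 j1 j2 j3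
      using V[rule_format, of "{i1, i2, i3}" "{j1, j2, j3}"] that by simp
    have beat: "trop_singular f i j k i j k \<and>
      (f i i + f j j + f k k \<le> f i j + f j k + f k i \<or> f i i + 2 * f j k \<le> f i j + f j k + f k i \<or>
       f j j + 2 * f i k \<le> f i j + f j k + f k i \<or> f k k + 2 * f i j \<le> f i j + f j k + f k i)"
      if "i < j" "j < k" "k < n" for i j k
      using V'[OF that that] vanishes_principal_minor[OF that, of A f] f_def by simp
    have sing: "trop_singular f i1 i2 i3 j1 j2 j3"
      if "i1 < i2" "i2 < i3" "i3 < n" "j1 < j2" "j2 < j3" "j3 < n" for i1 i2 i3 j1 j2 j3
    proof (cases "{i1, i2, i3} = {j1, j2, j3}")
      case False
      thus ?thesis using V'[OF that] vanishes_minor[OF that, of A f] f_def by simp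
    next
      case True
      hence "j1 = i1" "j2 = i2" "j3 = i3"
        using pick_three[OF that(1,2)] pick_three[OF that(4,5)] by metis+
      thus ?thesis using beat[OF that(1-3)] by simp
    qed
    have sing': "trop_singular f i1 i2 i3 j1 j2 j3"
      if i: "i1 < i2" "i2 < i3" "i3 < n" and j: "j1 \<in> {..<n}" "j2 \<in> {..<n}" "j3 \<in> {..<n}"
      "j1 \<noteq> j2" "j2 \<noteq> j3" "j1 \<noteq> j3" for i1 i2 i3 j1 j2 j3
      by (rule sorted_triple_wlog[of "trop_singular f i1 i2 i3", OF _ _ _ j])
        (rule trop_singular_swap_cols, rule trop_singular_swap_cols, use sing[OF i] in simp)
    have "trop_singular f i1 i2 i3 j1 j2 j3"
      if i: "i1 \<in> {..<n}" "i2 \<in> {..<n}" "i3 \<in> {..<n}" "i1 \<noteq> i2" "i2 \<noteq> i3" "i1 \<noteq> i3"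
      and j: "j1 \<in> {..<n}" "j2 \<in> {..<n}" "j3 \<in> {..<n}"
      "j1 \<noteq> j2" "j2 \<noteq> j3" "j1 \<noteq> j3" for i1 i2 i3 j1 j2 j3
      by (rule sorted_triple_wlog[of "\<lambda>i1 i2 i3. trop_singular f i1 i2 i3 j1 j2 j3", OF _ _ _ i])
        (rule trop_singular_swap_rows, rule trop_singular_swap_rows, use sing'[OF _ _ _ j] in simp)
    thus "trop_rank_le_two {..<n} {..<n} f" unfolding trop_rank_le_two_def by blast
    let ?Q = "\<lambda>i j k. f i i + f j j + f k k \<le> f i j + f j k + f k i \<or> f i i + 2 * f j k \<le> f i j + f j k + f k i \<or>
       f j j + 2 * f i k \<le> f i j + f j k + f k i \<or> f k k + 2 * f i j \<le> f i j + f j k + f k i"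
    have "?Q i j k" if i: "i \<in> {..<n}" "j \<in> {..<n}" "k \<in> {..<n}" "i \<noteq> j" "j \<noteq> k" "i \<noteq> k" for i j k
    proof (rule sorted_triple_wlog[of ?Q, OF _ _ _ i])
      fix a b c
      show "?Q a b c \<longleftrightarrow> ?Q b a c" "?Q a b c \<longleftrightarrow> ?Q a c b"
        by (auto simp: fsym[of b a] fsym[of c b] fsym[of c a] add_ac)
    qed (use beat in auto)
    thus "off_diagonal_beaten n f" unfolding off_diagonal_beaten_def by blast
  qed
  also have "trop_rank_le_two {..<n} {..<n} f \<longleftrightarrow> trop_rank_le_two {..<n} {..<n} (\<lambda>i j. A $$ (i, j))"
    by (rule trop_rank_le_two_cong) (simp add: f)
  also have "off_diagonal_beaten n f \<longleftrightarrow> off_diagonal_beaten n (\<lambda>i j. A $$ (i, j))"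
    unfolding off_diagonal_beaten_def by (simp add: f)
  finally show ?thesis using True by blast
qed

section \<open>Three tropically collinear vectors are tropically dependent\<close>

definition min_twice :: "real \<Rightarrow> real \<Rightarrow> real \<Rightarrow> bool" where
  "min_twice a b c \<longleftrightarrow> a = b \<and> a \<le> c \<or> a = c \<and> a \<le> b \<or> b = c \<and> b \<le> a"

text \<open>Tropical singularity of the 3 x 3 matrix with rows \<open>(x, 0, y)\<close>; its rows
  are regarded as points of the plane.\<close>

definition collinear3 :: "real \<Rightarrow> real \<Rightarrow> real \<Rightarrow> real \<Rightarrow> real \<Rightarrow> real \<Rightarrow> bool" where
  "collinear3 x1 y1 x2 y2 x3 y3 \<longleftrightarrow>
     tied_min (x1 + y3) (x3 + y2) (x2 + y1) (x1 + y2) (x2 + y3) (x3 + y1)"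

text \<open>\<open>min_twice (x - cx) (y - cy) 0\<close> says that \<open>(x, y)\<close> lies on the tropical line with centre \<open>(cx, cy)\<close>.\<close>

lemma general_position_line:
  fixes x1 :: real
  assumes "x1 < x2" "y1 \<noteq> y2" "x1 - y1 \<noteq> x2 - y2"
  obtains cx cy where "min_twice (x1 - cx) (y1 - cy) 0" "min_twice (x2 - cx) (y2 - cy) 0"
    "\<And>x y. collinear3 x1 y1 x2 y2 x y \<Longrightarrow> min_twice (x - cx) (y - cy) 0"
proof -
  \<comment> \<open>The rays of a tropical line leave its centre upwards, to the right, and
    diagonally to the lower left. Two points in general position lie on different rays; the cases
    are up and right, lower left and up, lower left and right. The centre is where these two rays
    meet.\<close>
  consider "y2 < y1" | "y1 < y2" "x2 - x1 < y2 - y1" | "y1 < y2" "y2 - y1 < x2 - x1"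
    using assms by linarith
  thus ?thesis
  proof cases
    case 1
    show ?thesis by (rule that[of x1 y2]; (unfold collinear3_def tied_min_def min_twice_def)?; use 1 assms in argo)
  next
    case 2
    show ?thesis by (rule that[of x2 "y1 + (x2 - x1)"]; (unfold collinear3_def tied_min_def min_twice_def)?; use 2 assms in argo)
  next
    case 3
    show ?thesis by (rule that[of "x1 + (y2 - y1)" y2]; (unfold collinear3_def tied_min_def min_twice_def)?; use 3 assms in argo)
  qed
qed

text \<open>If the direction of alignment could change, three points would form a triangle with one
  vertical, one horizontal and one diagonal side. Such a triangle is on no tropical line and is
  excluded by \<open>coll\<close>.\<close>

lemma aligned_points:
  fixes x y :: "'i \<Rightarrow> real"
  assumes aligned: "\<And>i j. i \<in> R \<Longrightarrow> j \<in> R \<Longrightarrow> x i = x j \<or> y i = y j \<or> x i - y i = x j - y j"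
    and coll: "\<And>i j k. i \<in> R \<Longrightarrow> j \<in> R \<Longrightarrow> k \<in> R \<Longrightarrow> i \<noteq> j \<Longrightarrow> j \<noteq> k \<Longrightarrow> i \<noteq> k \<Longrightarrow>
      collinear3 (x i) (y i) (x j) (y j) (x k) (y k)"
  shows "(\<forall>i\<in>R. \<forall>j\<in>R. x i = x j) \<or> (\<forall>i\<in>R. \<forall>j\<in>R. y i = y j) \<or> (\<forall>i\<in>R. \<forall>j\<in>R. x i - y i = x j - y j)"
proof (rule ccontr)
  assume neg: "\<not> ?thesis"
  then obtain i j where ij: "i \<in> R" "j \<in> R" "x i < x j" by (metis linorder_less_linear)
  have "y i = y j \<or> x i - y i = x j - y j" using aligned[OF ij(1,2)] ij(3) by auto
  thus False
  proof
    assume yij: "y i = y j"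
    have "y k = y i" if k: "k \<in> R" for k
    proof (rule ccontr)
      assume ne: "y k \<noteq> y i"
      hence d: "i \<noteq> j" "j \<noteq> k" "i \<noteq> k" using ij yij by auto
      show False
        using coll[OF ij(1,2) k d] aligned[OF ij(1) k] aligned[OF ij(2) k] ne yij ij(3)
        unfolding collinear3_def tied_min_def by argo
    qed
    thus False using neg by metis
  next
    assume yij: "x i - y i = x j - y j"
    have "x k - y k = x i - y i" if k: "k \<in> R" for k
    proof (rule ccontr)
      assume ne: "x k - y k \<noteq> x i - y i"
      hence d: "i \<noteq> j" "j \<noteq> k" "i \<noteq> k" using ij yij by auto
      show False
        using coll[OF ij(1,2) k d] aligned[OF ij(1) k] aligned[OF ij(2) k] ne yij ij(3)
        unfolding collinear3_def tied_min_def by argo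
    qed
    thus False using neg by metis
  qed
qed

text \<open>Two points in general position determine a line, and every further point is forced onto
  it. Without such a pair all points are aligned and fit on a single ray.\<close>

lemma common_tropical_line:
  fixes x y :: "'i \<Rightarrow> real"
  assumes "finite R"
    and coll: "\<And>i j k. i \<in> R \<Longrightarrow> j \<in> R \<Longrightarrow> k \<in> R \<Longrightarrow> i \<noteq> j \<Longrightarrow> j \<noteq> k \<Longrightarrow> i \<noteq> k \<Longrightarrow>
      collinear3 (x i) (y i) (x j) (y j) (x k) (y k)"
  shows "\<exists>cx cy. \<forall>i\<in>R. min_twice (x i - cx) (y i - cy) 0"
proof (cases "\<exists>i\<in>R. \<exists>j\<in>R. x i \<noteq> x j \<and> y i \<noteq> y j \<and> x i - y i \<noteq> x j - y j")
  case True
  then obtain i j where ij: "i \<in> R" "j \<in> R" "x i < x j" "y i \<noteq> y j" "x i - y i \<noteq> x j - y j"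
    by (metis linorder_less_linear)
  obtain cx cy where c: "min_twice (x i - cx) (y i - cy) 0" "min_twice (x j - cx) (y j - cy) 0"
    "\<And>x' y'. collinear3 (x i) (y i) (x j) (y j) x' y' \<Longrightarrow> min_twice (x' - cx) (y' - cy) 0"
    using general_position_line[OF ij(3-5)] by blast
  have "min_twice (x k - cx) (y k - cy) 0" if k: "k \<in> R" for k
  proof (cases "k = i \<or> k = j")
    case True
    thus ?thesis using c(1,2) by auto
  next
    case False
    thus ?thesis using c(3)[OF coll[OF ij(1,2) k]] ij(3) by auto
  qed
  thus ?thesis by blast
next
  case False
  show ?thesis
  proof (cases "R = {}")
    case R: False
    have fin: "finite (x ` R)" "x ` R \<noteq> {}" "finite (y ` R)" "y ` R \<noteq> {}" using assms(1) R by auto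
    obtain r where r: "r \<in> R" using R by blast
    have "(\<forall>i\<in>R. \<forall>j\<in>R. x i = x j) \<or> (\<forall>i\<in>R. \<forall>j\<in>R. y i = y j) \<or> (\<forall>i\<in>R. \<forall>j\<in>R. x i - y i = x j - y j)"
      by (rule aligned_points) (use False coll in blast)+
    \<comment> \<open>The centre is the extreme point from which the ray starts: the lowest point
      for the upward ray, the leftmost for the ray to the right, and the uppermost for the diagonal
      ray, which descends.\<close>
    thus ?thesis
    proof (elim disjE)
      assume e: "\<forall>i\<in>R. \<forall>j\<in>R. x i = x j"
      have "min_twice (x i - x r) (y i - Min (y ` R)) 0" if "i \<in> R" for i
      proof -
        have "x i = x r" "Min (y ` R) \<le> y i"
          using e[rule_format, OF that r] Min_le[OF fin(3)] that by simp_all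
        thus ?thesis unfolding min_twice_def by simp
      qed
      thus ?thesis by blast
    next
      assume e: "\<forall>i\<in>R. \<forall>j\<in>R. y i = y j"
      have "min_twice (x i - Min (x ` R)) (y i - y r) 0" if "i \<in> R" for i
      proof -
        have "y i = y r" "Min (x ` R) \<le> x i"
          using e[rule_format, OF that r] Min_le[OF fin(1)] that by simp_all
        thus ?thesis unfolding min_twice_def by simp
      qed
      thus ?thesis by blast
    next
      assume e: "\<forall>i\<in>R. \<forall>j\<in>R. x i - y i = x j - y j"
      have "min_twice (x i - Max (x ` R)) (y i - (Max (x ` R) - (x r - y r))) 0" if "i \<in> R" for i
      proof -
        have "x i - y i = x r - y r" "x i \<le> Max (x ` R)"
          using e[rule_format, OF that r] Max_ge[OF fin(1)] that by simp_all
        thus ?thesis unfolding min_twice_def by simp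
      qed
      thus ?thesis by blast
    qed
  qed auto
qed

text \<open>Subtracting column \<open>q\<close> turns each row into a point of the plane. A tropical
  line through all these points is a dependency of the columns \<open>p\<close>, \<open>q\<close>,
  \<open>s\<close>, with the negated coordinates of the centre and 0 as coefficients.\<close>

lemma trop_dependent:
  fixes f :: "'i \<Rightarrow> 'j \<Rightarrow> real"
  assumes "finite R"
    and sing: "\<And>i1 i2 i3. i1 \<in> R \<Longrightarrow> i2 \<in> R \<Longrightarrow> i3 \<in> R \<Longrightarrow> i1 \<noteq> i2 \<Longrightarrow> i2 \<noteq> i3 \<Longrightarrow> i1 \<noteq> i3 \<Longrightarrow>
      trop_singular f i1 i2 i3 p q s"
  obtains a b c where "\<And>i. i \<in> R \<Longrightarrow> min_twice (a + f i p) (b + f i q) (c + f i s)"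
proof -
  have "\<exists>cx cy. \<forall>i\<in>R. min_twice ((f i p - f i q) - cx) ((f i s - f i q) - cy) 0"
  proof (rule common_tropical_line[OF assms(1)])
    fix i j k assume "i \<in> R" "j \<in> R" "k \<in> R" "i \<noteq> j" "j \<noteq> k" "i \<noteq> k"
    hence sing: "trop_singular f i j k p q s" by (rule sing)
    \<comment> \<open>The normalisation changes all six terms of the determinant by the same
      amount.\<close>
    define K where "K = f i q + f j q + f k q"
    have shift: "f i p - f i q + (f k s - f k q) = f i p + f j q + f k s - K"
      "f k p - f k q + (f j s - f j q) = f i q + f j s + f k p - K"
      "f j p - f j q + (f i s - f i q) = f i s + f j p + f k q - K"
      "f i p - f i q + (f j s - f j q) = f i p + f j s + f k q - K"
      "f j p - f j q + (f k s - f k q) = f i q + f j p + f k s - K"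
      "f k p - f k q + (f i s - f i q) = f i s + f j q + f k p - K"
      unfolding K_def by simp_all
    show "collinear3 (f i p - f i q) (f i s - f i q) (f j p - f j q) (f j s - f j q) (f k p - f k q) (f k s - f k q)"
      using sing unfolding collinear3_def shift trop_singular_def tied_min_def by (simp only: diff_le_eq diff_add_cancel)
  qed
  then obtain cx cy where c: "\<forall>i\<in>R. min_twice ((f i p - f i q) - cx) ((f i s - f i q) - cy) 0" by blast
  have "min_twice (- cx + f i p) (0 + f i q) (- cy + f i s)" if "i \<in> R" for i
    using c[rule_format, OF that] unfolding min_twice_def by argo
  thus ?thesis using that by blast
qed

lemma tied_min_dependent:
  assumes "min_twice a1 b1 c1" "min_twice a2 b2 c2" "min_twice a3 b3 c3"
  shows "tied_min (a1 + b2 + c3) (a2 + b3 + c1) (a3 + b1 + c2) (a1 + b3 + c2) (a2 + b1 + c3) (a3 + b2 + c1)"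
  using assms unfolding min_twice_def tied_min_def by (smt (verit))

text \<open>A converse to \<open>trop_dependent\<close>. Alternating between the two carries rank 2
  from the columns of a matrix to arbitrary points of its hull.\<close>

lemma trop_singular_dependent:
  assumes "min_twice (a + f i1 j1) (b + f i2 j1) (c + f i3 j1)"
    "min_twice (a + f i1 j2) (b + f i2 j2) (c + f i3 j2)"
    "min_twice (a + f i1 j3) (b + f i2 j3) (c + f i3 j3)"
  shows "trop_singular f i1 i2 i3 j1 j2 j3"
proof -
  define K where "K = - (a + b + c)"
  have shift: "a + f i1 j1 + (b + f i2 j2) + (c + f i3 j3) = f i1 j1 + f i2 j2 + f i3 j3 - K"
    "a + f i1 j2 + (b + f i2 j3) + (c + f i3 j1) = f i1 j2 + f i2 j3 + f i3 j1 - K"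
    "a + f i1 j3 + (b + f i2 j1) + (c + f i3 j2) = f i1 j3 + f i2 j1 + f i3 j2 - K"
    "a + f i1 j1 + (b + f i2 j3) + (c + f i3 j2) = f i1 j1 + f i2 j3 + f i3 j2 - K"
    "a + f i1 j2 + (b + f i2 j1) + (c + f i3 j3) = f i1 j2 + f i2 j1 + f i3 j3 - K"
    "a + f i1 j3 + (b + f i2 j2) + (c + f i3 j1) = f i1 j3 + f i2 j2 + f i3 j1 - K"
    unfolding K_def by simp_all
  show ?thesis
    using tied_min_dependent[OF assms, unfolded shift] unfolding trop_singular_def tied_min_def
    by (simp only: diff_le_eq diff_add_cancel)
qed

section \<open>The tropical hull of a matrix of tropical rank two\<close>

lemma finite_max_index:
  fixes f :: "nat \<Rightarrow> real"
  assumes "0 < r"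
  obtains i where "i < r" "\<And>k. k < r \<Longrightarrow> f k \<le> f i"
proof -
  have fin: "finite (f ` {..<r})" "f ` {..<r} \<noteq> {}" using assms by auto
  obtain i where "i < r" "Max (f ` {..<r}) = f i" using Max_in[OF fin] by auto
  thus ?thesis using that[of i] Max_ge[OF fin(1)] by simp
qed

lemma finite_min_index:
  fixes f :: "nat \<Rightarrow> real"
  assumes "0 < r"
  obtains i where "i < r" "\<And>k. k < r \<Longrightarrow> f i \<le> f k"
proof -
  obtain i where i: "i < r" "\<And>k. k < r \<Longrightarrow> - f k \<le> - f i"
    using finite_max_index[OF assms, of "\<lambda>k. - f k"] by blast
  show ?thesis using that[OF i(1)] i(2) by simp
qed

section \<open>The Hilbert metric\<close>

lemma hilbert_dist_eqI:
  assumes "x \<in> carrier_vec r" "i < r" "j < r"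
    and "\<And>k. k < r \<Longrightarrow> x $ k - y $ k \<le> x $ i - y $ i" "\<And>k. k < r \<Longrightarrow> x $ j - y $ j \<le> x $ k - y $ k"
  shows "hilbert_dist x y = (x $ i - y $ i) - (x $ j - y $ j)"
proof -
  have d: "dim_vec x = r" using assms(1) by simp
  have "(MAX k\<in>{..<r}. x $ k - y $ k) = x $ i - y $ i"
    using assms(2,4) by (intro Max_eqI) auto
  moreover have "(MIN k\<in>{..<r}. x $ k - y $ k) = x $ j - y $ j"
    using assms(3,5) by (intro Min_eqI) auto
  ultimately show ?thesis unfolding hilbert_dist_def d by simp
qed

lemma hilbert_dist_witness:
  assumes "x \<in> carrier_vec r" "0 < r"
  shows "\<exists>i<r. \<exists>j<r. hilbert_dist x y = (x $ i - y $ i) - (x $ j - y $ j) \<and>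
    (\<forall>k<r. x $ k - y $ k \<le> x $ i - y $ i) \<and> (\<forall>k<r. x $ j - y $ j \<le> x $ k - y $ k)"
proof -
  obtain i where i: "i < r" "\<And>k. k < r \<Longrightarrow> x $ k - y $ k \<le> x $ i - y $ i"
    using finite_max_index[OF assms(2), of "\<lambda>k. x $ k - y $ k"] by blast
  obtain j where j: "j < r" "\<And>k. k < r \<Longrightarrow> x $ j - y $ j \<le> x $ k - y $ k"
    using finite_min_index[OF assms(2), of "\<lambda>k. x $ k - y $ k"] by blast
  show ?thesis using hilbert_dist_eqI[OF assms(1) i(1) j(1) i(2) j(2)] i j by blast
qed

lemma hilbert_dist_ge:
  assumes "x \<in> carrier_vec r" "i < r" "j < r"
  shows "(x $ i - y $ i) - (x $ j - y $ j) \<le> hilbert_dist x y"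
proof -
  have r: "0 < r" using assms(2) by simp
  obtain k l where kl: "hilbert_dist x y = (x $ k - y $ k) - (x $ l - y $ l)"
    "\<forall>m<r. x $ m - y $ m \<le> x $ k - y $ k" "\<forall>m<r. x $ l - y $ l \<le> x $ m - y $ m"
    using hilbert_dist_witness[OF assms(1) r, of y] by blast
  show ?thesis using kl(1) kl(2)[rule_format, OF assms(2)] kl(3)[rule_format, OF assms(3)] by linarith
qed

lemma hilbert_dist_sym:
  assumes "x \<in> carrier_vec r" "y \<in> carrier_vec r" "0 < r"
  shows "hilbert_dist x y = hilbert_dist y x"
proof -
  obtain i j where ij0: "i < r" "j < r" "hilbert_dist x y = (x $ i - y $ i) - (x $ j - y $ j)"
    "\<forall>k<r. x $ k - y $ k \<le> x $ i - y $ i" "\<forall>k<r. x $ j - y $ j \<le> x $ k - y $ k"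
    using hilbert_dist_witness[OF assms(1,3), of y] by blast
  note ij = ij0(1-3) ij0(4,5)[rule_format]
  have "hilbert_dist y x = (y $ j - x $ j) - (y $ i - x $ i)"
    using ij(4,5) by (intro hilbert_dist_eqI[OF assms(2) ij(2,1)]) (simp_all add: algebra_simps)
  thus ?thesis using ij(3) by simp
qed

lemma hilbert_dist_triangle:
  assumes "x \<in> carrier_vec r" "y \<in> carrier_vec r" "0 < r"
  shows "hilbert_dist x z \<le> hilbert_dist x y + hilbert_dist y z"
proof -
  obtain i j where ij: "i < r" "j < r" "hilbert_dist x z = (x $ i - z $ i) - (x $ j - z $ j)"
    using hilbert_dist_witness[OF assms(1,3), of z] by blast
  show ?thesis
    using hilbert_dist_ge[OF assms(1) ij(1,2), of y] hilbert_dist_ge[OF assms(2) ij(1,2), of z] ij(3)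
    by linarith
qed

text \<open>Points of a tropical segment: relative to the end points the coordinates are monotone
  in the difference of the end points, so that all three distances are attained at the same indices.\<close>

lemma between_segment:
  assumes "x \<in> carrier_vec r" "y \<in> carrier_vec r" "m \<in> carrier_vec r" "0 < r"
    and m: "\<And>i. i < r \<Longrightarrow> m $ i = min (a + x $ i) (b + y $ i)"
  shows "between hilbert_dist x m y"
proof -
  obtain i j where ij0: "i < r" "j < r" "hilbert_dist x y = (x $ i - y $ i) - (x $ j - y $ j)"
    "\<forall>k<r. x $ k - y $ k \<le> x $ i - y $ i" "\<forall>k<r. x $ j - y $ j \<le> x $ k - y $ k"
    using hilbert_dist_witness[OF assms(1,4), of y] by blast
  note ij = ij0(1-3) ij0(4,5)[rule_format]
  have le: "x $ k - m $ k \<le> x $ i - m $ i" "x $ j - m $ j \<le> x $ k - m $ k"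
    "m $ k - y $ k \<le> m $ i - y $ i" "m $ j - y $ j \<le> m $ k - y $ k" if "k < r" for k
    using ij(4)[OF that] ij(5)[OF that] m[OF that] m[OF ij(1)] m[OF ij(2)] by linarith+
  have "hilbert_dist x m = (x $ i - m $ i) - (x $ j - m $ j)"
    by (rule hilbert_dist_eqI[OF assms(1) ij(1,2) le(1,2)])
  moreover have "hilbert_dist m y = (m $ i - y $ i) - (m $ j - y $ j)"
    by (rule hilbert_dist_eqI[OF assms(3) ij(1,2) le(3,4)])
  ultimately show ?thesis unfolding between_def using ij(3) by simp
qed

locale trop_hull =
  fixes A :: "real mat" and r n :: nat
  assumes A: "A \<in> carrier_mat r n" and r: "0 < r" and n: "0 < n"
    and rank: "trop_rank_le_two {..<r} {..<n} (\<lambda>i j. A $$ (i, j))"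
begin

abbreviation P where "P \<equiv> tropical_hull A"

abbreviation hd where "hd \<equiv> hilbert_dist"

lemma dims: "dim_row A = r" "dim_col A = n"
  using A by simp_all

lemma combination_index:
  assumes "i < r"
  shows "\<And>j. j < n \<Longrightarrow> tropical_combination A c $ i \<le> c j + A $$ (i, j)"
    and "\<exists>j<n. tropical_combination A c $ i = c j + A $$ (i, j)"
proof -
  have e: "tropical_combination A c $ i = (MIN j\<in>{..<n}. c j + A $$ (i, j))"
    unfolding tropical_combination_def using assms dims by simp
  have fin: "finite ((\<lambda>j. c j + A $$ (i, j)) ` {..<n})" "(\<lambda>j. c j + A $$ (i, j)) ` {..<n} \<noteq> {}"
    using n by auto
  show "tropical_combination A c $ i \<le> c j + A $$ (i, j)" if "j < n" for j
    unfolding e using Min_le[OF fin(1)] that by simp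
  show "\<exists>j<n. tropical_combination A c $ i = c j + A $$ (i, j)"
    unfolding e using Min_in[OF fin] by auto
qed

lemma combination_carrier: "tropical_combination A c \<in> carrier_vec r"
  unfolding tropical_combination_def using dims by simp

lemma torus_rep_index: "x \<in> carrier_vec r \<Longrightarrow> i < r \<Longrightarrow> torus_rep x $ i = x $ i - x $ 0"
  unfolding torus_rep_def by simp

lemma torus_rep_carrier: "x \<in> carrier_vec r \<Longrightarrow> torus_rep x \<in> carrier_vec r"
  unfolding torus_rep_def by (metis carrier_vecD vec_carrier)

lemma combination_eqI:
  assumes "x \<in> carrier_vec r" "\<And>i j. i < r \<Longrightarrow> j < n \<Longrightarrow> x $ i \<le> c j + A $$ (i, j)"
    "\<And>i. i < r \<Longrightarrow> \<exists>j<n. x $ i = c j + A $$ (i, j)"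
  shows "tropical_combination A c = x"
proof (rule eq_vecI)
  fix i assume "i < dim_vec x"
  hence i: "i < r" using assms(1) by simp
  obtain j where "j < n" "x $ i = c j + A $$ (i, j)" using assms(3)[OF i] by blast
  moreover obtain k where "k < n" "tropical_combination A c $ i = c k + A $$ (i, k)"
    using combination_index(2)[OF i] by blast
  ultimately show "tropical_combination A c $ i = x $ i"
    using assms(2)[OF i, of k] combination_index(1)[OF i, of j c] by simp
qed (use combination_carrier[of c] assms(1) in simp)

lemma hull_carrier: "x \<in> P \<Longrightarrow> x \<in> carrier_vec r"
  unfolding tropical_hull_def using torus_rep_carrier combination_carrier by auto

lemma hull_zero: "x \<in> P \<Longrightarrow> x $ 0 = 0"
  unfolding tropical_hull_def using torus_rep_index[OF combination_carrier r] by auto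

lemma hullE:
  assumes "x \<in> P"
  obtains c where "\<And>i j. i < r \<Longrightarrow> j < n \<Longrightarrow> x $ i \<le> c j + A $$ (i, j)"
    "\<And>i. i < r \<Longrightarrow> \<exists>j<n. x $ i = c j + A $$ (i, j)"
proof -
  obtain c where c: "x = torus_rep (tropical_combination A c)"
    using assms unfolding tropical_hull_def by blast
  let ?k = "tropical_combination A c $ 0"
  have "x $ i = tropical_combination A c $ i - ?k" if "i < r" for i
    using torus_rep_index[OF combination_carrier that] c by simp
  hence "x $ i \<le> (c j - ?k) + A $$ (i, j)" if "i < r" "j < n" for i j
    using combination_index(1)[OF that, of c] that by simp
  moreover have "\<exists>j<n. x $ i = (c j - ?k) + A $$ (i, j)" if "i < r" for i
    using combination_index(2)[OF that, of c] \<open>\<And>i. i < r \<Longrightarrow> x $ i = _\<close>[OF that] by auto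
  ultimately show ?thesis using that[of "\<lambda>j. c j - ?k"] by blast
qed

lemma hullI:
  assumes "x \<in> carrier_vec r" "\<And>i j. i < r \<Longrightarrow> j < n \<Longrightarrow> x $ i \<le> c j + A $$ (i, j)"
    "\<And>i. i < r \<Longrightarrow> \<exists>j<n. x $ i = c j + A $$ (i, j)"
  shows "torus_rep x \<in> P"
  unfolding tropical_hull_def using combination_eqI[of x c, OF assms] by blast

lemma hull_combine:
  assumes "x \<in> P" "y \<in> P" "m \<in> carrier_vec r" "\<And>i. i < r \<Longrightarrow> m $ i = min (a + x $ i) (b + y $ i)"
  shows "torus_rep m \<in> P"
proof -
  obtain c where c: "\<And>i j. i < r \<Longrightarrow> j < n \<Longrightarrow> x $ i \<le> c j + A $$ (i, j)"
    "\<And>i. i < r \<Longrightarrow> \<exists>j<n. x $ i = c j + A $$ (i, j)" using hullE[OF assms(1)] by blast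
  obtain e where e: "\<And>i j. i < r \<Longrightarrow> j < n \<Longrightarrow> y $ i \<le> e j + A $$ (i, j)"
    "\<And>i. i < r \<Longrightarrow> \<exists>j<n. y $ i = e j + A $$ (i, j)" using hullE[OF assms(2)] by blast
  show ?thesis
  proof (rule hullI[OF assms(3), of "\<lambda>j. min (a + c j) (b + e j)"])
    fix i j assume ij: "i < r" "j < n"
    show "m $ i \<le> min (a + c j) (b + e j) + A $$ (i, j)"
      using assms(4)[OF ij(1)] c(1)[OF ij] e(1)[OF ij] by linarith
  next
    fix i assume i: "i < r"
    obtain j k where jk: "j < n" "x $ i = c j + A $$ (i, j)" "k < n" "y $ i = e k + A $$ (i, k)"
      using c(2)[OF i] e(2)[OF i] by blast
    have "m $ i = min (a + c j) (b + e j) + A $$ (i, j) \<or> m $ i = min (a + c k) (b + e k) + A $$ (i, k)"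
      using assms(4)[OF i] jk c(1)[OF i jk(3)] e(1)[OF i jk(1)] by linarith
    thus "\<exists>j<n. m $ i = min (a + c j) (b + e j) + A $$ (i, j)" using jk by blast
  qed
qed

definition column :: "nat \<Rightarrow> real vec" where
  "column j = torus_rep (col A j)"

lemma column_index: "i < r \<Longrightarrow> j < n \<Longrightarrow> column j $ i = A $$ (i, j) - A $$ (0, j)"
  unfolding column_def torus_rep_def using dims r by simp

lemma column_hull:
  assumes j: "j < n"
  shows "column j \<in> P"
  unfolding column_def
proof (rule hullI)
  define c where "c k = (MAX i\<in>{..<r}. A $$ (i, j) - A $$ (i, k))" for k
  have cj: "c j = 0"
    unfolding c_def using r by (intro Max_eqI) auto
  have ge: "A $$ (i, j) - A $$ (i, k) \<le> c k" if "i < r" for i k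
    unfolding c_def using that by (intro Max_ge) auto
  show "col A j \<in> carrier_vec r" using col_dim[of A j] dims by simp
  show "col A j $ i \<le> c k + A $$ (i, k)" if "i < r" for i k
    using ge[OF that, of k] that j dims by simp
  show "\<exists>k<n. col A j $ i = c k + A $$ (i, k)" if "i < r" for i
    using that j cj dims by (intro exI[of _ j]) simp
qed

lemma hull_eqI:
  assumes "x \<in> P" "y \<in> P" "\<And>i. i < r \<Longrightarrow> x $ i - y $ i = k"
  shows "x = y"
proof (rule eq_vecI)
  have "k = 0" using assms(3)[OF r] hull_zero[OF assms(1)] hull_zero[OF assms(2)] by simp
  thus "x $ i = y $ i" if "i < dim_vec y" for i
    using assms(3)[of i] that hull_carrier[OF assms(2)] by simp
qed (use hull_carrier[OF assms(1)] hull_carrier[OF assms(2)] in simp)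

text \<open>A dependency of three rows holds at every column and is inherited by tropical
  combinations, because a minimum attained twice survives taking minima. So it is an equation of the
  whole hull.\<close>

lemma three_rows:
  assumes "i1 < r" "i2 < r" "i3 < r" "i1 \<noteq> i2" "i2 \<noteq> i3" "i1 \<noteq> i3"
  obtains a b c where "\<And>x. x \<in> P \<Longrightarrow> min_twice (a + x $ i1) (b + x $ i2) (c + x $ i3)"
proof -
  have "trop_singular (\<lambda>j i. A $$ (i, j)) j1 j2 j3 i1 i2 i3"
    if "j1 \<in> {..<n}" "j2 \<in> {..<n}" "j3 \<in> {..<n}" "j1 \<noteq> j2" "j2 \<noteq> j3" "j1 \<noteq> j3" for j1 j2 j3
    using rank assms that unfolding trop_rank_le_two_def trop_singular_transpose[of "\<lambda>i j. A $$ (i, j)"]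
    by simp
  then obtain a b c where abc: "\<And>j. j \<in> {..<n} \<Longrightarrow>
      min_twice (a + A $$ (i1, j)) (b + A $$ (i2, j)) (c + A $$ (i3, j))"
    using trop_dependent[of "{..<n}" "\<lambda>j i. A $$ (i, j)" i1 i2 i3] by blast
  have "min_twice (a + x $ i1) (b + x $ i2) (c + x $ i3)" if x: "x \<in> P" for x
  proof -
    obtain e where e: "\<And>i j. i < r \<Longrightarrow> j < n \<Longrightarrow> x $ i \<le> e j + A $$ (i, j)"
      "\<And>i. i < r \<Longrightarrow> \<exists>j<n. x $ i = e j + A $$ (i, j)" using hullE[OF x] by blast
    obtain j1 j2 j3 where j: "j1 < n" "x $ i1 = e j1 + A $$ (i1, j1)"
      "j2 < n" "x $ i2 = e j2 + A $$ (i2, j2)" "j3 < n" "x $ i3 = e j3 + A $$ (i3, j3)"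
      using e(2)[OF assms(1)] e(2)[OF assms(2)] e(2)[OF assms(3)] by blast
    show ?thesis
      using abc[of j1] abc[of j2] abc[of j3] j e(1)[OF assms(1) j(1)] e(1)[OF assms(2) j(1)] e(1)[OF assms(3) j(1)]
        e(1)[OF assms(1) j(3)] e(1)[OF assms(2) j(3)] e(1)[OF assms(3) j(3)]
        e(1)[OF assms(1) j(5)] e(1)[OF assms(2) j(5)] e(1)[OF assms(3) j(5)]
      unfolding min_twice_def lessThan_iff by (smt (verit))
  qed
  thus ?thesis using that by blast
qed

text \<open>By \<open>three_rows\<close> every 3 x 3 matrix of coordinates of three hull points is
  singular; this in turn makes the points themselves dependent.\<close>

lemma three_points:
  assumes "x \<in> P" "y \<in> P" "z \<in> P"
  obtains a b c where "\<And>i. i < r \<Longrightarrow> min_twice (a + x $ i) (b + y $ i) (c + z $ i)"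
proof -
  have sing: "trop_singular (\<lambda>i p. p $ i) i1 i2 i3 x y z" if t: "i1 \<in> {..<r}" "i2 \<in> {..<r}" "i3 \<in> {..<r}"
    "i1 \<noteq> i2" "i2 \<noteq> i3" "i1 \<noteq> i3" for i1 i2 i3
  proof -
    obtain a b c where "\<And>p. p \<in> P \<Longrightarrow> min_twice (a + p $ i1) (b + p $ i2) (c + p $ i3)"
      using three_rows[of i1 i2 i3] t unfolding lessThan_iff by blast
    thus ?thesis using trop_singular_dependent[of a "\<lambda>i p. p $ i" i1 x b i2 c i3 y z] assms by blast
  qed
  obtain a b c where "\<And>i. i \<in> {..<r} \<Longrightarrow> min_twice (a + x $ i) (b + y $ i) (c + z $ i)"
    using trop_dependent[of "{..<r}" "\<lambda>i p. p $ i" x y z] sing by blast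
  thus ?thesis using that[of a b c] by simp
qed

lemma hull_between_segment:
  assumes "x \<in> P" "y \<in> P" "m \<in> P" "\<And>i. i < r \<Longrightarrow> m $ i = min (a + x $ i) (b + y $ i)"
  shows "between hd x m y"
  using between_segment[OF hull_carrier[OF assms(1)] hull_carrier[OF assms(2)] hull_carrier[OF assms(3)] r assms(4)]
  by simp

lemma hd_self: "x \<in> P \<Longrightarrow> hd x x = 0"
  using hilbert_dist_eqI[OF hull_carrier r r, of x x] by simp

lemma hd_sym: "x \<in> P \<Longrightarrow> y \<in> P \<Longrightarrow> hd x y = hd y x"
  using hilbert_dist_sym[OF hull_carrier hull_carrier r] by simp

lemma hd_triangle: "x \<in> P \<Longrightarrow> y \<in> P \<Longrightarrow> z \<in> P \<Longrightarrow> hd x z \<le> hd x y + hd y z"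
  using hilbert_dist_triangle[OF hull_carrier hull_carrier r] by simp

lemma hd_pos:
  assumes "x \<in> P" "y \<in> P" "x \<noteq> y"
  shows "0 < hd x y"
proof (rule ccontr)
  assume "\<not> 0 < hd x y"
  hence "(x $ i - y $ i) - (x $ 0 - y $ 0) \<le> 0" "(x $ 0 - y $ 0) - (x $ i - y $ i) \<le> 0" if "i < r" for i
    using hilbert_dist_ge[OF hull_carrier[OF assms(1)] that r, of y]
      hilbert_dist_ge[OF hull_carrier[OF assms(1)] r that, of y] by simp_all
  hence "x $ i - y $ i = x $ 0 - y $ 0" if "i < r" for i using that by fastforce
  hence "x = y" by (rule hull_eqI[OF assms(1,2)])
  thus False using assms(3) by simp
qed

text \<open>If in each coordinate the minimum is attained twice, it is already the minimum over any
  two of the three translated points. Hence one point lies on all three tropical segments.\<close>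

lemma hull_median:
  assumes "x \<in> P" "y \<in> P" "z \<in> P"
  obtains m a b c where "m \<in> P" "\<And>i. i < r \<Longrightarrow> m $ i = min (a + x $ i) (b + y $ i)"
    "\<And>i. i < r \<Longrightarrow> m $ i = min (b + y $ i) (c + z $ i)"
    "\<And>i. i < r \<Longrightarrow> m $ i = min (a + x $ i) (c + z $ i)"
proof -
  obtain a b c where abc: "\<And>i. i < r \<Longrightarrow> min_twice (a + x $ i) (b + y $ i) (c + z $ i)"
    using three_points[OF assms] by blast
  define m where "m = vec r (\<lambda>i. min (a + x $ i) (b + y $ i))"
  have m: "m $ i = min (a + x $ i) (b + y $ i)" "m $ i = min (b + y $ i) (c + z $ i)"
    "m $ i = min (a + x $ i) (c + z $ i)" if "i < r" for i
    using abc[OF that] that unfolding m_def min_twice_def by (simp_all, linarith+)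
  have mc: "m \<in> carrier_vec r" unfolding m_def by simp
  have P: "torus_rep m \<in> P" using hull_combine[OF assms(1,2) mc m(1)] .
  have t: "torus_rep m $ i = min ((a - m $ 0) + x $ i) ((b - m $ 0) + y $ i)"
    "torus_rep m $ i = min ((b - m $ 0) + y $ i) ((c - m $ 0) + z $ i)"
    "torus_rep m $ i = min ((a - m $ 0) + x $ i) ((c - m $ 0) + z $ i)" if "i < r" for i
    using torus_rep_index[OF mc that] m[OF that] by linarith+
  show ?thesis using that[OF P t] .
qed

text \<open>Geodesics of the Hilbert metric are not unique in general. Here the median of
  \<open>x\<close>, \<open>y\<close>, \<open>p\<close> has distance 0 from \<open>p\<close>, so
  metric betweenness in the hull always comes from the tropical segment.\<close>

lemma between_imp_segment:
  assumes "x \<in> P" "y \<in> P" "p \<in> P" "between hd x p y"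
  obtains a b where "\<And>i. i < r \<Longrightarrow> p $ i = min (a + x $ i) (b + y $ i)"
proof -
  obtain m a b c where m: "m \<in> P" "\<And>i. i < r \<Longrightarrow> m $ i = min (a + x $ i) (b + y $ i)"
    "\<And>i. i < r \<Longrightarrow> m $ i = min (b + y $ i) (c + p $ i)"
    "\<And>i. i < r \<Longrightarrow> m $ i = min (a + x $ i) (c + p $ i)"
    using hull_median[OF assms(1-3)] by blast
  have "between hd x m y" "between hd y m p" "between hd x m p"
    using hull_between_segment[OF assms(1,2) m(1,2)] hull_between_segment[OF assms(2,3) m(1,3)]
      hull_between_segment[OF assms(1,3) m(1,4)] by simp_all
  hence "hd m p \<le> 0"
    using assms(4) hd_sym[OF assms(2) m(1)] hd_sym[OF assms(2,3)] unfolding between_def by linarith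
  hence "m = p" using hd_pos[OF m(1) assms(3)] by linarith
  thus ?thesis using that m(2) by blast
qed

lemma hull_tree_metric: "tree_metric P hd"
proof (rule tree_metricI)
  fix x y z assume xyz: "x \<in> P" "y \<in> P" "z \<in> P"
  obtain m a b c where m: "m \<in> P" "\<And>i. i < r \<Longrightarrow> m $ i = min (a + x $ i) (b + y $ i)"
    "\<And>i. i < r \<Longrightarrow> m $ i = min (b + y $ i) (c + z $ i)"
    "\<And>i. i < r \<Longrightarrow> m $ i = min (a + x $ i) (c + z $ i)"
    using hull_median[OF xyz] by blast
  thus "\<exists>m\<in>P. between hd x m y \<and> between hd y m z \<and> between hd x m z"
    using hull_between_segment[OF xyz(1,2) m(1,2)] hull_between_segment[OF xyz(2,3) m(1,3)]
      hull_between_segment[OF xyz(1,3) m(1,4)] by blast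
next
  fix x y p q assume P: "x \<in> P" "y \<in> P" "p \<in> P" "q \<in> P" "between hd x p y" "between hd x q y"
  obtain a b where p: "\<And>i. i < r \<Longrightarrow> p $ i = min (a + x $ i) (b + y $ i)"
    using between_imp_segment[OF P(1,2,3,5)] by blast
  obtain a' b' where q: "\<And>i. i < r \<Longrightarrow> q $ i = min (a' + x $ i) (b' + y $ i)"
    using between_imp_segment[OF P(1,2,4,6)] by blast
  show "between hd x p q \<or> between hd x q p"
  \<comment> \<open>The parameter \<open>b - a\<close> orders the points of the tropical segment
    from \<open>x\<close> to \<open>y\<close>.\<close>
  proof (cases "b - a \<le> b' - a'")
    case True
    have "q $ i = min (a' + x $ i) ((b' - b) + p $ i)" if "i < r" for i
      using p[OF that] q[OF that] True by linarith
    thus ?thesis using hull_between_segment[OF P(1,3,4)] by blast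
  next
    case False
    have "p $ i = min (a + x $ i) ((b - b') + q $ i)" if "i < r" for i
      using p[OF that] q[OF that] False by linarith
    thus ?thesis using hull_between_segment[OF P(1,4,3)] by blast
  qed
qed (fact hd_self hd_pos hd_sym hd_triangle)+

sublocale tree_metric P hd
  by (rule hull_tree_metric)

text \<open>The direction from \<open>p\<close> towards \<open>q\<close> is the sum of the unit vectors of \<open>germ p q\<close>.\<close>

definition germ :: "real vec \<Rightarrow> real vec \<Rightarrow> nat set" where
  "germ p q = {i. i < r \<and> (\<exists>j<r. q $ j - p $ j < q $ i - p $ i)}"

lemma germ_min: "i < r \<Longrightarrow> i \<notin> germ p q \<Longrightarrow> j < r \<Longrightarrow> q $ i - p $ i \<le> q $ j - p $ j"
  unfolding germ_def by force

lemma germ_subset: "germ p q \<subseteq> {..<r}"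
  unfolding germ_def by auto

lemma germ_min_index:
  "\<exists>j<r. j \<notin> germ p q \<and> (\<forall>k<r. q $ j - p $ j \<le> q $ k - p $ k) \<and>
     (\<forall>k<r. k \<in> germ p q \<longleftrightarrow> q $ j - p $ j < q $ k - p $ k)"
proof -
  obtain j where j: "j < r" "\<And>k. k < r \<Longrightarrow> q $ j - p $ j \<le> q $ k - p $ k"
    using finite_min_index[OF r, of "\<lambda>k. q $ k - p $ k"] by blast
  have "k \<in> germ p q \<longleftrightarrow> q $ j - p $ j < q $ k - p $ k" if "k < r" for k
    unfolding germ_def using that j by (auto intro: le_less_trans)
  thus ?thesis using j by (intro exI[of _ j]) simp
qed

lemma germ_max:
  assumes "p \<in> P" "q \<in> P" "p \<noteq> q" "i < r" "\<And>k. k < r \<Longrightarrow> q $ k - p $ k \<le> q $ i - p $ i"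
  shows "i \<in> germ p q"
proof (rule ccontr)
  assume "i \<notin> germ p q"
  hence "q $ k - p $ k = q $ i - p $ i" if "k < r" for k
    using germ_min[OF assms(4), of p q k] assms(5)[OF that] that by simp
  hence "q = p" by (rule hull_eqI[OF assms(2,1)])
  thus False using assms(3) by simp
qed

lemma germ_nonempty:
  assumes "p \<in> P" "q \<in> P" "p \<noteq> q"
  shows "germ p q \<noteq> {}"
proof -
  obtain i where "i < r" "\<And>k. k < r \<Longrightarrow> q $ k - p $ k \<le> q $ i - p $ i"
    using finite_max_index[OF r, of "\<lambda>k. q $ k - p $ k"] by blast
  thus ?thesis using germ_max[OF assms] by blast
qed

lemma germ_self: "germ p p = {}"
  unfolding germ_def by simp

text \<open>The point \<open>p\<close> is a minimum of translates of \<open>q\<close> and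
  \<open>q'\<close> exactly if in each coordinate one of the differences \<open>q - p\<close> and
  \<open>q' - p\<close> is minimal; a germ collects the coordinates where this fails.\<close>

lemma between_iff_germ:
  assumes "p \<in> P" "q \<in> P" "q' \<in> P"
  shows "between hd q p q' \<longleftrightarrow> germ p q \<inter> germ p q' = {}"
proof
  assume "between hd q p q'"
  then obtain a b where ab: "\<And>i. i < r \<Longrightarrow> p $ i = min (a + q $ i) (b + q' $ i)"
    using between_imp_segment[OF assms(2,3,1)] by blast
  have False if i: "i \<in> germ p q" "i \<in> germ p q'" for i
  proof -
    obtain j k where "j < r" "k < r" "i < r" "q $ j - p $ j < q $ i - p $ i" "q' $ k - p $ k < q' $ i - p $ i"
      using i unfolding germ_def by blast
    thus False using ab[of i] ab[of j] ab[of k] by linarith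
  qed
  thus "germ p q \<inter> germ p q' = {}" by blast
next
  assume disj: "germ p q \<inter> germ p q' = {}"
  obtain j where j0: "j < r" "\<forall>k<r. q $ j - p $ j \<le> q $ k - p $ k"
    "\<forall>k<r. k \<in> germ p q \<longleftrightarrow> q $ j - p $ j < q $ k - p $ k"
    using germ_min_index[where p=p and q=q] by blast
  note j = j0(1) j0(2,3)[rule_format]
  obtain l where l0: "l < r" "\<forall>k<r. q' $ l - p $ l \<le> q' $ k - p $ k"
    "\<forall>k<r. k \<in> germ p q' \<longleftrightarrow> q' $ l - p $ l < q' $ k - p $ k"
    using germ_min_index[where p=p and q=q'] by blast
  note l = l0(1) l0(2,3)[rule_format]
  have "p $ i = min ((p $ j - q $ j) + q $ i) ((p $ l - q' $ l) + q' $ i)" if "i < r" for i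
  proof -
    have "\<not> (q $ j - p $ j < q $ i - p $ i \<and> q' $ l - p $ l < q' $ i - p $ i)"
      using disj j(3)[OF that] l(3)[OF that] by blast
    thus ?thesis using j(2)[OF that] l(2)[OF that] by linarith
  qed
  thus "between hd q p q'" by (rule hull_between_segment[OF assms(2,3,1)])
qed

lemma germ_between:
  assumes "p \<in> P" "q \<in> P" "m \<in> P" "between hd p m q" "m \<noteq> p"
  shows "germ p m = germ p q"
proof -
  obtain a b where ab: "\<And>i. i < r \<Longrightarrow> m $ i = min (a + p $ i) (b + q $ i)"
    using between_imp_segment[OF assms(1,2,3,4)] by blast
  obtain j where j0: "j < r" "\<forall>k<r. q $ j - p $ j \<le> q $ k - p $ k"
    "\<forall>k<r. k \<in> germ p q \<longleftrightarrow> q $ j - p $ j < q $ k - p $ k"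
    using germ_min_index[where p=p and q=q] by blast
  note j = j0(1) j0(2,3)[rule_format]
  have lt: "b + (q $ j - p $ j) < a"
  proof (rule ccontr)
    assume "\<not> b + (q $ j - p $ j) < a"
    hence "m $ i - p $ i = a" if "i < r" for i using ab[OF that] j(2)[OF that] by linarith
    hence "m = p" by (rule hull_eqI[OF assms(3,1)])
    thus False using assms(5) by simp
  qed
  have mj: "m $ j - p $ j = b + (q $ j - p $ j)" using ab[OF j(1)] lt by linarith
  have "k \<in> germ p m \<longleftrightarrow> k \<in> germ p q" if k: "k < r" for k
  proof
    assume "k \<in> germ p m"
    then obtain i where "i < r" "m $ i - p $ i < m $ k - p $ k" unfolding germ_def by blast
    hence "q $ j - p $ j < q $ k - p $ k" using ab[of i] ab[OF k] j(2)[of i] by linarith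
    thus "k \<in> germ p q" using j(3)[OF k] by simp
  next
    assume "k \<in> germ p q"
    hence "m $ j - p $ j < m $ k - p $ k" using j(3)[OF k] ab[OF k] mj lt by linarith
    thus "k \<in> germ p m" unfolding germ_def using k j(1) by blast
  qed
  thus ?thesis using germ_subset[of p m] germ_subset[of p q] by auto
qed

text \<open>Germs label the branches at \<open>p\<close>: if two of them meet, \<open>p\<close> is
  not between \<open>q\<close> and \<open>q'\<close>, and both paths begin with the path to the
  median.\<close>

lemma germ_disjoint_or_eq:
  assumes "p \<in> P" "q \<in> P" "q' \<in> P" "germ p q \<inter> germ p q' \<noteq> {}"
  shows "germ p q = germ p q'"
proof -
  obtain m where m: "m \<in> P" "between hd p m q" "between hd q m q'" "between hd p m q'"
    using median[OF assms(1-3)] by blast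
  have "m \<noteq> p" using m(3) assms(4) between_iff_germ[OF assms(1-3)] by blast
  thus ?thesis using germ_between[OF assms(1,2) m(1,2)] germ_between[OF assms(1,3) m(1,4)] by simp
qed

definition germs :: "real vec \<Rightarrow> nat set set" where
  "germs p = germ p ` (P - {p})"

lemma germs_finite: "finite (germs p)"
proof (rule finite_subset)
  show "germs p \<subseteq> Pow {..<r}" unfolding germs_def using germ_subset by blast
qed simp

lemma germs_disjoint: "p \<in> P \<Longrightarrow> S \<in> germs p \<Longrightarrow> S' \<in> germs p \<Longrightarrow> S \<inter> S' \<noteq> {} \<Longrightarrow> S = S'"
  unfolding germs_def using germ_disjoint_or_eq by blast

lemma germsD:
  assumes "p \<in> P" "S \<in> germs p"
  shows "S \<noteq> {}" "S \<subseteq> {..<r}" "\<exists>j<r. j \<notin> S"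
proof -
  obtain q where q: "q \<in> P" "q \<noteq> p" "S = germ p q" using assms(2) unfolding germs_def by blast
  show "S \<noteq> {}" using germ_nonempty[OF assms(1) q(1)] q by auto
  show "S \<subseteq> {..<r}" using germ_subset q by simp
  show "\<exists>j<r. j \<notin> S" using germ_min_index[where p=p and q=q] q(3) by blast
qed

lemma Union_germs_iff: "p \<in> P \<Longrightarrow> j \<in> \<Union>(germs p) \<longleftrightarrow> (\<exists>q\<in>P. j \<in> germ p q)"
  unfolding germs_def using germ_self by auto

text \<open>All columns are scaled to have entry 0 in row \<open>j\<close> before the minimum is
  taken. This maximises coordinate \<open>j\<close> relative to every other one among the points of
  the hull, see \<open>base_minimal\<close>, so no germ at this point contains
  \<open>j\<close>.\<close>

definition base :: "nat \<Rightarrow> real vec" where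
  "base j = torus_rep (tropical_combination A (\<lambda>k. - A $$ (j, k)))"

lemma base_hull: "base j \<in> P"
  unfolding base_def tropical_hull_def by blast

lemma base_index:
  assumes "i < r"
  shows "base j $ i = tropical_combination A (\<lambda>k. - A $$ (j, k)) $ i
    - tropical_combination A (\<lambda>k. - A $$ (j, k)) $ 0"
  unfolding base_def using torus_rep_index[OF combination_carrier assms] .

lemma base_comb_self:
  assumes "j < r"
  shows "tropical_combination A (\<lambda>k. - A $$ (j, k)) $ j = 0"
  using combination_index(2)[OF assms, of "\<lambda>k. - A $$ (j, k)"] by auto

lemma base_minimal:
  assumes "j < r" "q \<in> P" "i < r"
  shows "q $ j - base j $ j \<le> q $ i - base j $ i"
proof -
  obtain c where c: "\<And>i k. i < r \<Longrightarrow> k < n \<Longrightarrow> q $ i \<le> c k + A $$ (i, k)"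
    "\<And>i. i < r \<Longrightarrow> \<exists>k<n. q $ i = c k + A $$ (i, k)" using hullE[OF assms(2)] by blast
  obtain k where k: "k < n" "q $ i = c k + A $$ (i, k)" using c(2)[OF assms(3)] by blast
  have "tropical_combination A (\<lambda>k. - A $$ (j, k)) $ i \<le> - A $$ (j, k) + A $$ (i, k)"
    using combination_index(1)[OF assms(3) k(1), of "\<lambda>k. - A $$ (j, k)"] .
  moreover have "q $ j \<le> c k + A $$ (j, k)" using c(1)[OF assms(1) k(1)] .
  ultimately show ?thesis
    using base_index[OF assms(1), of j] base_index[OF assms(3), of j] base_comb_self[OF assms(1)] k(2)
    by linarith
qed

lemma base_germ:
  assumes "j < r" "q \<in> P"
  shows "j \<notin> germ (base j) q"
  using base_minimal[OF assms] unfolding germ_def by force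

lemma base_unique:
  assumes "j < r" "p \<in> P" "\<And>q. q \<in> P \<Longrightarrow> j \<notin> germ p q"
  shows "p = base j"
proof (rule hull_eqI[OF assms(2) base_hull])
  fix i assume i: "i < r"
  show "p $ i - base j $ i = p $ j - base j $ j"
    using base_minimal[OF assms(1,2) i] germ_min[OF assms(1) assms(3)[OF base_hull[of j]] i] by linarith
qed

lemma base_eq_iff:
  assumes "j < r" "p \<in> P"
  shows "base j = p \<longleftrightarrow> j \<notin> \<Union>(germs p)"
  using Union_germs_iff[OF assms(2)] base_germ[OF assms(1)] base_unique[OF assms] by blast

lemma germ_base:
  assumes "j < r" "p \<in> P" "base j \<noteq> p"
  shows "j \<in> germ p (base j)"
proof (rule germ_max[OF assms(2) base_hull])
  show "base j $ k - p $ k \<le> base j $ j - p $ j" if "k < r" for k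
    using base_minimal[OF assms(1,2) that] by linarith
qed (use assms in auto)

section \<open>Edge directions and balancing\<close>

definition direction :: "nat set \<Rightarrow> int vec" where
  "direction S = vec r (\<lambda>i. of_bool (i \<in> S) - of_bool (0 \<in> S))"

lemma direction_index: "i < r \<Longrightarrow> direction S $ i = of_bool (i \<in> S) - of_bool (0 \<in> S)"
  unfolding direction_def by simp

lemma direction_edge:
  assumes p: "p \<in> P" and S: "S \<in> germs p"
  shows "direction S \<in> edge_directions r P p"
proof -
  obtain q where q: "q \<in> P" "q \<noteq> p" "S = germ p q" using S unfolding germs_def by blast
  note SD = germsD[OF p S]
  obtain j where j0: "j < r" "j \<notin> germ p q" "\<forall>k<r. k \<in> germ p q \<longleftrightarrow> q $ j - p $ j < q $ k - p $ k"
    "\<forall>k<r. q $ j - p $ j \<le> q $ k - p $ k"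
    using germ_min_index[where p=p and q=q] by blast
  \<comment> \<open>Up to this length the tropical segment towards \<open>q\<close> raises exactly
    the coordinates in \<open>S\<close>, all at the same speed.\<close>
  define \<epsilon> where "\<epsilon> = Min ((\<lambda>i. (q $ i - p $ i) - (q $ j - p $ j)) ` S)"
  have fin: "finite S" using SD(2) by (rule finite_subset) simp
  have eps_le: "\<epsilon> \<le> (q $ i - p $ i) - (q $ j - p $ j)" if "i \<in> S" for i
    unfolding \<epsilon>_def using fin that by (intro Min_le) auto
  have "\<epsilon> \<in> (\<lambda>i. (q $ i - p $ i) - (q $ j - p $ j)) ` S"
    unfolding \<epsilon>_def using fin SD(1) by (intro Min_in) auto
  then obtain i0 where "i0 \<in> S" "\<epsilon> = (q $ i0 - p $ i0) - (q $ j - p $ j)" by blast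
  hence eps: "0 < \<epsilon>" using j0(3) q(3) SD(2) by auto
  have seg: "p + t \<cdot>\<^sub>v map_vec of_int (direction S) \<in> P" if t: "0 \<le> t" "t \<le> \<epsilon>" for t
  proof -
    define m where "m = vec r (\<lambda>i. p $ i + t * of_bool (i \<in> S))"
    have mc: "m \<in> carrier_vec r" unfolding m_def by simp
    have "m $ i = min (t + p $ i) ((p $ j - q $ j) + q $ i)" if i: "i < r" for i
    proof (cases "i \<in> S")
      case True
      thus ?thesis unfolding m_def using i t eps_le[OF True] by simp
    next
      case False
      hence "q $ i - p $ i = q $ j - p $ j" using j0(3,4) i q(3) by (metis order_antisym_conv not_less)
      thus ?thesis unfolding m_def using i t False by simp
    qed
    hence "torus_rep m \<in> P" by (rule hull_combine[OF p q(1) mc])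
    moreover have "torus_rep m = p + t \<cdot>\<^sub>v map_vec of_int (direction S)"
    proof (rule eq_vecI)
      show "dim_vec (torus_rep m) = dim_vec (p + t \<cdot>\<^sub>v map_vec of_int (direction S))"
        using torus_rep_carrier[OF mc] by (simp add: direction_def)
      fix i assume "i < dim_vec (p + t \<cdot>\<^sub>v map_vec of_int (direction S))"
      hence i: "i < r" by (simp add: direction_def)
      have "torus_rep m $ i = (p $ i + t * of_bool (i \<in> S)) - (p $ 0 + t * of_bool (0 \<in> S))"
        using torus_rep_index[OF mc i] i r unfolding m_def by simp
      also have "\<dots> = p $ i + t * of_int (direction S $ i)"
        using hull_zero[OF p] by (simp add: direction_index[OF i] algebra_simps)
      finally show "torus_rep m $ i = (p + t \<cdot>\<^sub>v map_vec of_int (direction S)) $ i"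
        using i by (simp add: direction_def)
    qed
    ultimately show ?thesis by simp
  qed
  \<comment> \<open>Neither \<open>S\<close> nor its complement is empty, so after normalisation at
    coordinate 0 some entry is 1 or -1 and the vector is primitive.\<close>
  have "\<exists>k<r. is_unit (direction S $ k)"
  proof (cases "0 \<in> S")
    case True
    then obtain k where "k < r" "k \<notin> S" using SD(3) by blast
    thus ?thesis using True direction_index[of k S] by (intro exI[of _ k]) simp
  next
    case False
    obtain k where "k \<in> S" "k < r" using SD(1,2) by auto
    thus ?thesis using False direction_index[of k S] by (intro exI[of _ k]) simp
  qed
  hence "(GCD i\<in>{..<r}. direction S $ i) = 1" by (auto intro: Gcd_eq_1_I)
  moreover have "direction S \<in> carrier_vec r" "direction S $ 0 = 0"
    using direction_index[OF r] by (simp_all add: direction_def)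
  ultimately show ?thesis unfolding edge_directions_def using eps seg by blast
qed

text \<open>The midpoint of a classical segment inside the hull lies on the tropical segment between
  its ends. This allows the entries of \<open>v\<close> only two values, and primitivity makes these
  differ by 1.\<close>

lemma edge_direction_germ:
  assumes p: "p \<in> P" and v: "v \<in> edge_directions r P p"
  shows "v \<in> direction ` germs p"
proof -
  have vc: "v \<in> carrier_vec r" and v0: "v $ 0 = 0" and gcd: "(GCD i\<in>{..<r}. v $ i) = 1"
    using v unfolding edge_directions_def by simp_all
  obtain \<epsilon> where eps: "0 < \<epsilon>" "\<And>t. 0 \<le> t \<Longrightarrow> t \<le> \<epsilon> \<Longrightarrow> p + t \<cdot>\<^sub>v map_vec of_int v \<in> P"
    using v unfolding edge_directions_def by blast
  define x where "x t = p + t \<cdot>\<^sub>v map_vec of_int v" for t :: real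
  have xi: "x t $ i = p $ i + t * of_int (v $ i)" if "i < r" for t i
    unfolding x_def using that vc hull_carrier[OF p] by simp
  have xP: "x t \<in> P" if "0 \<le> t" "t \<le> \<epsilon>" for t unfolding x_def using eps(2) that by simp
  have q: "x \<epsilon> \<in> P" and h: "x (\<epsilon> / 2) \<in> P" using xP eps(1) by simp_all
  have vz: "\<exists>i<r. v $ i \<noteq> 0"
  proof (rule ccontr)
    assume "\<not> ?thesis"
    hence "(GCD i\<in>{..<r}. v $ i) = 0" by (intro Gcd_0_iff[THEN iffD2]) auto
    thus False using gcd by simp
  qed
  have qp: "x \<epsilon> \<noteq> p"
  proof
    assume e: "x \<epsilon> = p"
    obtain i where "i < r" "v $ i \<noteq> 0" using vz by blast
    thus False using xi[of i \<epsilon>] e eps(1) by simp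
  qed
  obtain i where i: "i < r" "\<And>k. k < r \<Longrightarrow> real_of_int (v $ k) \<le> real_of_int (v $ i)"
    using finite_max_index[OF r, of "\<lambda>k. real_of_int (v $ k)"] by blast
  obtain j where j: "j < r" "\<And>k. k < r \<Longrightarrow> real_of_int (v $ j) \<le> real_of_int (v $ k)"
    using finite_min_index[OF r, of "\<lambda>k. real_of_int (v $ k)"] by blast
  have dist: "hd (x t) (x s) = (t - s) * (real_of_int (v $ i) - real_of_int (v $ j))"
    if ts: "0 \<le> s" "s \<le> t" "t \<le> \<epsilon>" for s t
  proof -
    have e: "x t $ k - x s $ k = (t - s) * real_of_int (v $ k)" if "k < r" for k
      using xi[OF that] by (simp add: algebra_simps)
    have "hd (x t) (x s) = (x t $ i - x s $ i) - (x t $ j - x s $ j)"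
    proof (rule hilbert_dist_eqI[OF _ i(1) j(1)])
      show "x t \<in> carrier_vec r" using hull_carrier[OF xP] ts by simp
      show "x t $ k - x s $ k \<le> x t $ i - x s $ i" "x t $ j - x s $ j \<le> x t $ k - x s $ k" if "k < r" for k
        unfolding e[OF that] e[OF i(1)] e[OF j(1)] using i(2)[OF that] j(2)[OF that] ts
        by (simp_all add: mult_left_mono)
    qed
    thus ?thesis unfolding e[OF i(1)] e[OF j(1)] by (simp add: algebra_simps)
  qed
  have x0: "x 0 = p"
    unfolding x_def using vc hull_carrier[OF p] by (intro eq_vecI) auto
  have "between hd (x \<epsilon>) (x (\<epsilon> / 2)) (x 0)"
    unfolding between_def using dist[of "\<epsilon> / 2" \<epsilon>] dist[of 0 "\<epsilon> / 2"] dist[of 0 \<epsilon>] eps(1)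
    by (simp add: algebra_simps)
  then obtain b a where ab: "\<And>k. k < r \<Longrightarrow> x (\<epsilon> / 2) $ k = min (b + x \<epsilon> $ k) (a + p $ k)"
    using between_imp_segment[OF q p h] x0 by blast
  have ab': "\<epsilon> / 2 * real_of_int (v $ k) = min (b + \<epsilon> * real_of_int (v $ k)) a" if "k < r" for k
    using ab[OF that] xi[OF that] by (simp add: min_def split: if_splits)
  define S where "S = germ p (x \<epsilon>)"
  have mem: "k \<in> S \<longleftrightarrow> v $ j < v $ k" if k: "k < r" for k
  proof -
    have "k \<in> S \<longleftrightarrow> (\<exists>l<r. \<epsilon> * real_of_int (v $ l) < \<epsilon> * real_of_int (v $ k))"
      unfolding S_def germ_def using k by (simp add: xi cong: conj_cong)
    also have "\<dots> \<longleftrightarrow> (\<exists>l<r. v $ l < v $ k)" using eps(1) by simp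
    also have "\<dots> \<longleftrightarrow> v $ j < v $ k"
      using j by (metis le_less_trans of_int_le_iff)
    finally show ?thesis .
  qed
  \<comment> \<open>On \<open>S\<close> the minimum in \<open>ab'\<close> must be the constant
    \<open>a\<close>; the other alternative would give \<open>v $ k \<le> v $ j\<close>.\<close>
  have const: "\<epsilon> / 2 * real_of_int (v $ k) = a" if k: "k < r" "k \<in> S" for k
  proof (rule ccontr)
    assume "\<epsilon> / 2 * real_of_int (v $ k) \<noteq> a"
    hence "\<epsilon> / 2 * real_of_int (v $ k) = b + \<epsilon> * real_of_int (v $ k)"
      using ab'[OF k(1)] by (simp add: min_def split: if_splits)
    moreover have "\<epsilon> / 2 * real_of_int (v $ j) \<le> b + \<epsilon> * real_of_int (v $ j)"
      using ab'[OF j(1)] by (simp add: min_def split: if_splits)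
    ultimately have "\<epsilon> * real_of_int (v $ k) \<le> \<epsilon> * real_of_int (v $ j)" by simp
    hence "v $ k \<le> v $ j" using eps(1) by simp
    thus False using mem[OF k(1)] k(2) by simp
  qed
  have eqS: "v $ k = v $ l" if "k < r" "l < r" "k \<in> S" "l \<in> S" for k l
  proof -
    have "\<epsilon> * real_of_int (v $ k) = \<epsilon> * real_of_int (v $ l)"
      using const[OF that(1,3)] const[OF that(2,4)] by linarith
    thus ?thesis using eps(1) by simp
  qed
  have eqN: "v $ k = v $ j" if "k < r" "k \<notin> S" for k
    using mem[OF that(1)] that j(2)[OF that(1)] by simp
  have unit: "is_unit d" if d: "\<And>k. k < r \<Longrightarrow> d dvd v $ k" for d :: int
  proof -
    have "d dvd (GCD i\<in>{..<r}. v $ i)" by (rule Gcd_greatest) (use d in auto)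
    thus ?thesis using gcd by simp
  qed
  have jS: "j \<notin> S" using mem[OF j(1)] by simp
  have "v = direction S"
  proof (rule eq_vecI)
    fix k assume "k < dim_vec (direction S)"
    hence k: "k < r" by (simp add: direction_def)
    show "v $ k = direction S $ k"
    proof (cases "0 \<in> S")
      case True
      hence zero: "v $ l = 0" if "l < r" "l \<in> S" for l using eqS[OF that(1) r that(2)] v0 by simp
      have neg: "v $ j < 0" using mem[OF r] True v0 by simp
      have "is_unit (v $ j)" by (rule unit) (metis dvd_0_right dvd_refl eqN zero)
      hence "v $ j = - 1" using neg by auto
      thus ?thesis using True zero[OF k] eqN[OF k] direction_index[OF k, of S] by auto
    next
      case False
      hence zero: "v $ j = 0" using eqN[OF r] v0 by simp
      have "\<exists>l<r. l \<in> S" using vz eqN zero by metis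
      then obtain l where l: "l < r" "l \<in> S" by blast
      have pos: "0 < v $ l" using mem[OF l(1)] l(2) zero by simp
      have "is_unit (v $ l)" by (rule unit) (metis dvd_0_right dvd_refl eqN zero eqS l)
      hence "v $ l = 1" using pos by auto
      thus ?thesis using False zero eqN[OF k] eqS[OF k l(1) _ l(2)] direction_index[OF k, of S] by auto
    qed
  qed (use vc in \<open>simp add: direction_def\<close>)
  moreover have "S \<in> germs p" unfolding germs_def S_def using q qp by blast
  ultimately show ?thesis by blast
qed

lemma edge_directions_eq: "p \<in> P \<Longrightarrow> edge_directions r P p = direction ` germs p"
  using direction_edge edge_direction_germ by blast

lemma direction_inj:
  assumes p: "p \<in> P"
  shows "inj_on direction (germs p)"
proof (rule inj_onI, rule ccontr)
  fix S S' assume S: "S \<in> germs p" "S' \<in> germs p" "direction S = direction S'" "S \<noteq> S'"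
  have disj: "S \<inter> S' = {}" using germs_disjoint[OF p S(1,2)] S(4) by blast
  have idx: "(of_bool (i \<in> S) - of_bool (0 \<in> S) :: int) = of_bool (i \<in> S') - of_bool (0 \<in> S')" if "i < r" for i
    using direction_index[OF that, of S] direction_index[OF that, of S'] S(3) by simp
  obtain i where i: "i \<in> S" "i < r" using germsD(1,2)[OF p S(1)] by auto
  obtain i' where i': "i' \<in> S'" "i' < r" using germsD(1,2)[OF p S(2)] by auto
  show False using idx[OF i(2)] idx[OF i'(2)] i(1) i'(1) disj by (auto simp: of_bool_def split: if_splits)
qed

text \<open>The germs at \<open>p\<close> are disjoint, so their indicator functions add up to that
  of the union. The subtracted term is the normalisation at coordinate 0.\<close>

lemma direction_sum:
  assumes p: "p \<in> P" and i: "i < r"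
  shows "(\<Sum>v\<in>edge_directions r P p. v $ i) = of_bool (i \<in> \<Union>(germs p)) - of_bool (0 \<in> \<Union>(germs p))"
proof -
  have card: "(\<Sum>S\<in>germs p. of_bool (k \<in> S)) = (of_nat (card (germs p \<inter> {S. k \<in> S})) :: int)" for k
    by (rule sum_of_bool_eq; rule germs_finite)
  have cnt: "(\<Sum>S\<in>germs p. of_bool (k \<in> S)) = (of_bool (k \<in> \<Union>(germs p)) :: int)" for k
    unfolding card
  proof (cases "k \<in> \<Union>(germs p)")
    case True
    then obtain S where S: "S \<in> germs p" "k \<in> S" by blast
    have "germs p \<inter> {S. k \<in> S} = {S}" using germs_disjoint[OF p _ S(1)] S by blast
    thus "int (card (germs p \<inter> {S. k \<in> S})) = of_bool (k \<in> \<Union>(germs p))" using True by simp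
  next
    case False
    hence "germs p \<inter> {S. k \<in> S} = {}" by blast
    thus "int (card (germs p \<inter> {S. k \<in> S})) = of_bool (k \<in> \<Union>(germs p))" using False by simp
  qed
  have "(\<Sum>v\<in>edge_directions r P p. v $ i) = (\<Sum>S\<in>germs p. direction S $ i)"
    unfolding edge_directions_eq[OF p] by (simp add: sum.reindex[OF direction_inj[OF p]])
  also have "\<dots> = (\<Sum>S\<in>germs p. of_bool (i \<in> S)) - (\<Sum>S\<in>germs p. of_bool (0 \<in> S))"
    by (simp add: direction_index[OF i] sum_subtractf)
  finally show ?thesis unfolding cnt .
qed

lemma unit_vec_sum:
  assumes "i < r"
  shows "(\<Sum>j\<in>{j. j < r \<and> a j = p}. unit_vec r j $ i) = (of_bool (a i = p) :: int)"
proof -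
  have "(\<Sum>j\<in>{j. j < r \<and> a j = p}. unit_vec r j $ i) = (\<Sum>j\<in>{j. j < r \<and> a j = p}. if j = i then 1 else 0 :: int)"
    using assms by (intro sum.cong) auto
  also have "\<dots> = of_bool (a i = p)" using assms by simp
  finally show ?thesis .
qed

text \<open>Balance at \<open>p\<close> says that the number of germs containing \<open>i\<close>,
  plus 1 if ray \<open>i\<close> is attached there, does not depend on \<open>i\<close>. For
  \<open>base\<close> this number is always 1. If ray \<open>j\<close> were attached elsewhere, the
  number would be 0 at \<open>base j\<close>, although the edge towards \<open>a j\<close> has a
  nonempty germ.\<close>

lemma balanced_rays_iff: "balanced_rays A a \<longleftrightarrow> a = restrict base {..<r}"
proof
  assume a: "a = restrict base {..<r}"
  have "\<exists>c. \<forall>i<r. (\<Sum>v\<in>edge_directions r P p. v $ i) +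
      (\<Sum>j\<in>{j. j < r \<and> a j = p}. unit_vec r j $ i) = c" if p: "p \<in> P" for p
  proof (intro exI allI impI)
    fix i assume i: "i < r"
    have "a i = p \<longleftrightarrow> i \<notin> \<Union>(germs p)" using base_eq_iff[OF i p] a i by simp
    thus "(\<Sum>v\<in>edge_directions r P p. v $ i) + (\<Sum>j\<in>{j. j < r \<and> a j = p}. unit_vec r j $ i)
      = 1 - of_bool (0 \<in> \<Union>(germs p))"
      unfolding direction_sum[OF p i] unit_vec_sum[OF i] by auto
  qed
  thus "balanced_rays A a" unfolding balanced_rays_def dims using a base_hull by auto
next
  assume "balanced_rays A a"
  hence aP: "a \<in> {..<r} \<rightarrow>\<^sub>E P" and bal: "\<forall>p\<in>P. \<exists>c. \<forall>i<r. (\<Sum>v\<in>edge_directions r P p. v $ i) +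
      (\<Sum>j\<in>{j. j < r \<and> a j = p}. unit_vec r j $ i) = c"
    unfolding balanced_rays_def dims by simp_all
  have bal': "\<exists>c::int. \<forall>i<r. of_bool (i \<in> \<Union>(germs p)) + of_bool (a i = p) = c" if p: "p \<in> P" for p
  proof -
    obtain c where c: "\<forall>i<r. (\<Sum>v\<in>edge_directions r P p. v $ i) +
      (\<Sum>j\<in>{j. j < r \<and> a j = p}. unit_vec r j $ i) = c" using bal p by blast
    have "of_bool (i \<in> \<Union>(germs p)) + of_bool (a i = p) = c + of_bool (0 \<in> \<Union>(germs p))" if i: "i < r" for i
      using c[rule_format, OF i] unfolding direction_sum[OF p i] unit_vec_sum[OF i] by linarith
    thus ?thesis by blast
  qed
  have "a j = base j" if j: "j < r" for j
  proof (rule ccontr)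
    assume neq: "a j \<noteq> base j"
    have aj: "a j \<in> P" using aP j by auto
    obtain c :: int where c: "\<forall>i<r. of_bool (i \<in> \<Union>(germs (base j))) + of_bool (a i = base j) = c"
      using bal'[OF base_hull] by blast
    have "j \<notin> \<Union>(germs (base j))" using base_eq_iff[OF j base_hull, of j] by simp
    hence "c = 0" using c j neq by force
    hence "i \<notin> \<Union>(germs (base j))" if "i < r" for i using c that by (auto simp: of_bool_def split: if_splits)
    moreover have "germ (base j) (a j) \<noteq> {}" using germ_nonempty[OF base_hull aj] neq by simp
    moreover have "germ (base j) (a j) \<in> germs (base j)" unfolding germs_def using aj neq by blast
    moreover have "germ (base j) (a j) \<subseteq> {..<r}" by (rule germ_subset)
    ultimately show False by blast
  qed
  thus "a = restrict base {..<r}" using aP by (intro ext) (auto simp: PiE_def extensional_def)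
qed

lemma ray_base_eq: "j < r \<Longrightarrow> ray_base A j = base j"
  unfolding ray_base_def balanced_rays_iff by simp

section \<open>Distances of columns and ray bases in terms of matrix entries\<close>

lemma column_max_dist:
  assumes "i < n" "k < n"
  shows "hd (column i) (column k) =
    Max ((\<lambda>(j, l). A $$ (j, i) - A $$ (j, k) - A $$ (l, i) + A $$ (l, k)) ` ({..<r} \<times> {..<r}))"
proof -
  obtain a b where ab: "a < r" "b < r" "hd (column i) (column k) =
      (column i $ a - column k $ a) - (column i $ b - column k $ b)"
    using hilbert_dist_witness[OF hull_carrier[OF column_hull[OF assms(1)]] r, of "column k"] by blast
  show ?thesis
  proof (rule Max_eqI[symmetric])
    show "hd (column i) (column k) \<in> (\<lambda>(j, l). A $$ (j, i) - A $$ (j, k) - A $$ (l, i) + A $$ (l, k)) ` ({..<r} \<times> {..<r})"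
      using ab by (intro image_eqI[of _ _ "(a, b)"]) (simp_all add: column_index assms)
  next
    fix y assume "y \<in> (\<lambda>(j, l). A $$ (j, i) - A $$ (j, k) - A $$ (l, i) + A $$ (l, k)) ` ({..<r} \<times> {..<r})"
    then obtain j l where "j < r" "l < r" "y = A $$ (j, i) - A $$ (j, k) - A $$ (l, i) + A $$ (l, k)" by auto
    thus "y \<le> hd (column i) (column k)"
      using hilbert_dist_ge[OF hull_carrier[OF column_hull[OF assms(1)]], of j l "column k"]
      by (simp add: column_index assms)
  qed simp
qed

lemma base_comb_le:
  assumes "i < r" "k < n"
  shows "base j $ i + tropical_combination A (\<lambda>k. - A $$ (j, k)) $ 0 \<le> A $$ (i, k) - A $$ (j, k)"
  using combination_index(1)[OF assms, of "\<lambda>k. - A $$ (j, k)"] base_index[OF assms(1), of j] by simp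

lemma base_comb_attained:
  assumes "i < r"
  shows "\<exists>k<n. base j $ i + tropical_combination A (\<lambda>k. - A $$ (j, k)) $ 0 = A $$ (i, k) - A $$ (j, k)"
  using combination_index(2)[OF assms, of "\<lambda>k. - A $$ (j, k)"] base_index[OF assms(1), of j]
  by (auto simp: algebra_simps)

text \<open>By \<open>base_minimal\<close> the minimum in the Hilbert distance is attained at
  \<open>j\<close>, and each coordinate of the base is itself a minimum over the columns. What is
  left is one maximum over a row and a column.\<close>

lemma column_base_dist:
  assumes "i < n" "j < r"
  shows "hd (column i) (base j) =
    Max ((\<lambda>(l, k). A $$ (l, i) - A $$ (l, k) + A $$ (j, k) - A $$ (j, i)) ` ({..<r} \<times> {..<n}))"
proof -
  note cP = column_hull[OF assms(1)]
  define z where "z = tropical_combination A (\<lambda>k. - A $$ (j, k)) $ 0"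
  have zj: "base j $ j + z = 0" unfolding z_def using base_index[OF assms(2)] base_comb_self[OF assms(2)] by simp
  have ge: "(column i $ a - base j $ a) - (column i $ j - base j $ j) \<le> hd (column i) (base j)" if "a < r" for a
    by (rule hilbert_dist_ge[OF hull_carrier[OF cP] that assms(2)])
  obtain a b where ab: "a < r" "b < r" "hd (column i) (base j) =
      (column i $ a - base j $ a) - (column i $ b - base j $ b)"
    using hilbert_dist_witness[OF hull_carrier[OF cP] r, of "base j"] by blast
  have eq: "hd (column i) (base j) = (column i $ a - base j $ a) - (column i $ j - base j $ j)"
    using ge[OF ab(1)] ab(3) base_minimal[OF assms(2) cP ab(2)] by linarith
  obtain k where k: "k < n" "base j $ a + z = A $$ (a, k) - A $$ (j, k)"
    using base_comb_attained[OF ab(1), of j] unfolding z_def by blast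
  show ?thesis
  proof (rule Max_eqI[symmetric])
    show "hd (column i) (base j) \<in> (\<lambda>(l, k). A $$ (l, i) - A $$ (l, k) + A $$ (j, k) - A $$ (j, i)) ` ({..<r} \<times> {..<n})"
      using ab(1) k eq zj column_index[OF ab(1) assms(1)] column_index[OF assms(2,1)]
      by (intro image_eqI[of _ _ "(a, k)"]) simp_all
  next
    fix y assume "y \<in> (\<lambda>(l, k). A $$ (l, i) - A $$ (l, k) + A $$ (j, k) - A $$ (j, i)) ` ({..<r} \<times> {..<n})"
    then obtain l k where lk: "l < r" "k < n" "y = A $$ (l, i) - A $$ (l, k) + A $$ (j, k) - A $$ (j, i)" by auto
    thus "y \<le> hd (column i) (base j)"
      using ge[OF lk(1)] base_comb_le[OF lk(1,2), of j] zj column_index[OF lk(1) assms(1)] column_index[OF assms(2,1)]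
      unfolding z_def by simp
  qed simp
qed

lemma base_base_dist:
  assumes "j < r" "l < r"
  shows "hd (base j) (base l) =
    Max ((\<lambda>(i, k). A $$ (j, i) - A $$ (l, i) - A $$ (j, k) + A $$ (l, k)) ` ({..<n} \<times> {..<n}))"
proof -
  define z where "z j = tropical_combination A (\<lambda>k. - A $$ (j, k)) $ 0" for j
  have zj: "base j $ j + z j = 0" "base l $ l + z l = 0"
    unfolding z_def using base_index base_comb_self assms by simp_all
  have eq: "hd (base j) (base l) = (base j $ j - base l $ j) - (base j $ l - base l $ l)"
  proof (rule hilbert_dist_eqI[OF hull_carrier[OF base_hull] assms])
    show "base j $ k - base l $ k \<le> base j $ j - base l $ j" if "k < r" for k
      using base_minimal[OF assms(1) base_hull that, of l] by linarith
    show "base j $ l - base l $ l \<le> base j $ k - base l $ k" if "k < r" for k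
      using base_minimal[OF assms(2) base_hull that, of j] by linarith
  qed
  obtain i where i: "i < n" "base j $ l + z j = A $$ (l, i) - A $$ (j, i)"
    using base_comb_attained[OF assms(2), of j] unfolding z_def by blast
  obtain k where k: "k < n" "base l $ j + z l = A $$ (j, k) - A $$ (l, k)"
    using base_comb_attained[OF assms(1), of l] unfolding z_def by blast
  show ?thesis
  proof (rule Max_eqI[symmetric])
    show "hd (base j) (base l) \<in> (\<lambda>(i, k). A $$ (j, i) - A $$ (l, i) - A $$ (j, k) + A $$ (l, k)) ` ({..<n} \<times> {..<n})"
      using i k eq zj by (intro image_eqI[of _ _ "(i, k)"]) simp_all
  next
    fix y assume "y \<in> (\<lambda>(i, k). A $$ (j, i) - A $$ (l, i) - A $$ (j, k) + A $$ (l, k)) ` ({..<n} \<times> {..<n})"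
    then obtain i k where ik: "i < n" "k < n" "y = A $$ (j, i) - A $$ (l, i) - A $$ (j, k) + A $$ (l, k)" by auto
    thus "y \<le> hd (base j) (base l)"
      using eq base_comb_le[OF assms(2) ik(1), of j] base_comb_le[OF assms(1) ik(2), of l] zj
      unfolding z_def by simp
  qed simp
qed

text \<open>Let \<open>m\<close> be the median of \<open>x\<close> and the two bases. Neither
  \<open>j\<close> nor \<open>l\<close> is in the germ at \<open>m\<close> towards \<open>x\<close>,
  so passing from \<open>x\<close> to \<open>m\<close> changes neither side. On the path between the
  two bases, a step of length t changes the difference of distances by 2t and the coordinates
  \<open>j\<close> and \<open>l\<close> against each other by t.\<close>

lemma base_dist_diff:
  assumes x: "x \<in> P" and jl: "j < r" "l < r"
  shows "hd x (base j) - hd x (base l) =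
    2 * (x $ l - x $ j) + (base j $ j - base j $ l + base l $ j - base l $ l)"
proof -
  obtain m where m: "m \<in> P" "between hd x m (base j)" "between hd (base j) m (base l)" "between hd x m (base l)"
    using median[OF x base_hull base_hull] by blast
  have notin: "k \<notin> germ m x" if k: "k < r" "between hd x m (base k)" for k
  proof (cases "base k = m")
    case True
    thus ?thesis using base_germ[OF k(1) x] by simp
  next
    case False
    hence "k \<in> germ m (base k)" by (rule germ_base[OF k(1) m(1)])
    thus ?thesis using between_iff_germ[OF m(1) x base_hull] k(2) by blast
  qed
  have xm: "x $ j - m $ j = x $ l - m $ l"
    using germ_min[OF jl(1) notin[OF jl(1) m(2)] jl(2)] germ_min[OF jl(2) notin[OF jl(2) m(4)] jl(1)] by linarith
  have jl_eq: "hd (base j) (base l) = (base j $ j - base l $ j) - (base j $ l - base l $ l)"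
  proof (rule hilbert_dist_eqI[OF hull_carrier[OF base_hull] jl])
    show "base j $ k - base l $ k \<le> base j $ j - base l $ j" if "k < r" for k
      using base_minimal[OF jl(1) base_hull that, of l] by linarith
    show "base j $ l - base l $ l \<le> base j $ k - base l $ k" if "k < r" for k
      using base_minimal[OF jl(2) base_hull that, of j] by linarith
  qed
  have "(m $ l - base j $ l) - (m $ j - base j $ j) \<le> hd m (base j)"
    "(m $ j - base l $ j) - (m $ l - base l $ l) \<le> hd m (base l)"
    using hilbert_dist_ge[OF hull_carrier[OF m(1)]] jl by simp_all
  moreover have "hd (base j) m = hd m (base j)" by (rule hd_sym[OF base_hull m(1)])
  moreover have "hd x m + hd m (base j) = hd x (base j)" "hd (base j) m + hd m (base l) = hd (base j) (base l)"
    "hd x m + hd m (base l) = hd x (base l)" using m(2-4) unfolding between_def by simp_all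
  ultimately have "hd m (base j) = (m $ l - base j $ l) - (m $ j - base j $ j)"
    "hd m (base l) = (m $ j - base l $ j) - (m $ l - base l $ l)" using jl_eq by linarith+
  moreover have "hd x (base j) - hd x (base l) = hd m (base j) - hd m (base l)"
    using m(2,4) unfolding between_def by linarith
  ultimately show ?thesis using xm by (simp add: algebra_simps)
qed

text \<open>This is \<open>base_dist_diff\<close> for a column, with row 0 as reference, solved for
  the entry; the remaining terms depend on the column or on the row alone.\<close>

lemma entry_eq_dist:
  "\<exists>u v. \<forall>i<n. \<forall>j<r. A $$ (j, i) = - hd (column i) (base j) / 2 + u i + v j"
proof (intro exI allI impI)
  fix i j assume ij: "i < n" "j < r"
  show "A $$ (j, i) = - hd (column i) (base j) / 2 + (A $$ (0, i) + hd (column i) (base 0) / 2)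
    + (base j $ j - base j $ 0 + base 0 $ j - base 0 $ 0) / 2"
    using base_dist_diff[OF column_hull[OF ij(1)] ij(2) r] column_index[OF ij(2,1)] column_index[OF r ij(1)]
    by (simp add: field_simps)
qed

end

section \<open>The tree of a matrix of tropical rank two\<close>

context trop_hull
begin

abbreviation leaves where "leaves \<equiv> labels n r"

lemma label_base_simps:
  "label_base A (Unprimed i) = column i" "j < r \<Longrightarrow> label_base A (Primed j) = base j"
  by (simp_all add: column_def ray_base_eq)

declare label_base.simps [simp del]

lemma label_base_hull: "l \<in> leaves \<Longrightarrow> label_base A l \<in> P"
  unfolding labels_def using label_base_simps column_hull base_hull by auto

lemma finite_leaves: "finite leaves"
  unfolding labels_def by simp

text \<open>In the metric \<open>ext\<close> every leaf has distance one from its base, so that leaves are nodes of their own.\<close>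

definition offset :: "label + real vec \<Rightarrow> real" where
  "offset u = (case u of Inl _ \<Rightarrow> 1 | Inr _ \<Rightarrow> 0)"

definition points :: "(label + real vec) set" where
  "points = Inl ` leaves \<union> Inr ` P"

definition ext :: "label + real vec \<Rightarrow> label + real vec \<Rightarrow> real" where
  "ext u v = (if u = v then 0 else offset u + offset v + node_dist A u v)"

lemma offset_simps: "offset (Inl l) = 1" "offset (Inr p) = 0"
  unfolding offset_def by simp_all

lemma offset_nonneg: "0 \<le> offset u"
  unfolding offset_def by (cases u) simp_all

lemma node_base_hull: "u \<in> points \<Longrightarrow> node_base A u \<in> P"
  unfolding points_def using label_base_hull by auto

lemma ext_neq: "u \<noteq> v \<Longrightarrow> ext u v = offset u + offset v + hd (node_base A u) (node_base A v)"
  unfolding ext_def node_dist_def by simp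

lemma ext_Inr:
  assumes "u \<in> points" "p \<in> P"
  shows "ext u (Inr p) = offset u + hd (node_base A u) p" "ext (Inr p) u = offset u + hd p (node_base A u)"
  using hd_self[OF assms(2)] offset_simps(2)[of p] by (cases "u = Inr p"; simp add: ext_def node_dist_def)+

lemma ext_le: "u \<in> points \<Longrightarrow> ext u v \<le> offset u + offset v + hd (node_base A u) (node_base A v)"
  using offset_nonneg[of u] hd_self[OF node_base_hull] by (cases "u = v") (simp_all add: ext_neq, simp add: ext_def)

lemma between_ext_Inr:
  assumes "u \<in> points" "v \<in> points" "u \<noteq> v" "p \<in> P"
  shows "between ext u (Inr p) v \<longleftrightarrow> between hd (node_base A u) p (node_base A v)"
  unfolding between_def ext_Inr(1)[OF assms(1,4)] ext_Inr(2)[OF assms(2,4)] ext_neq[OF assms(3)] by auto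

text \<open>Passing through a leaf would traverse its unit edge twice.\<close>

lemma between_ext_Inl:
  assumes "u \<in> points" "v \<in> points" "Inl l \<in> points" "between ext u (Inl l) v"
  shows "u = Inl l \<or> v = Inl l"
proof (rule ccontr)
  assume "\<not> ?thesis"
  hence neq: "u \<noteq> Inl l" "Inl l \<noteq> v" by auto
  show False
    using assms(4) ext_le[OF assms(1), of v]
      hd_triangle[OF node_base_hull[OF assms(1)] node_base_hull[OF assms(3)] node_base_hull[OF assms(2)]]
    unfolding between_def ext_neq[OF neq(1)] ext_neq[OF neq(2)] offset_simps by linarith
qed

lemma ext_self: "ext u u = 0"
  unfolding ext_def by simp

lemma ext_sym: "u \<in> points \<Longrightarrow> v \<in> points \<Longrightarrow> ext u v = ext v u"
  using hd_sym[OF node_base_hull node_base_hull] by (cases "u = v") (simp_all add: ext_neq)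

lemma ext_pos:
  assumes "u \<in> points" "v \<in> points" "u \<noteq> v"
  shows "0 < ext u v"
proof (cases u)
  case (Inl l)
  have "0 \<le> hd (node_base A u) (node_base A v)" by (rule dist_nonneg) (use node_base_hull assms in auto)
  thus ?thesis using Inl ext_neq[OF assms(3)] offset_nonneg[of v] offset_simps(1)[of l] by simp
next
  case (Inr p)
  have p: "p \<in> P" using assms(1) Inr unfolding points_def by auto
  show ?thesis
  proof (cases v)
    case (Inl l)
    have "0 \<le> hd (node_base A u) (node_base A v)" by (rule dist_nonneg) (use node_base_hull assms in auto)
    thus ?thesis using Inl ext_neq[OF assms(3)] offset_nonneg[of u] offset_simps(1)[of l] by simp
  next
    case (Inr q)
    have q: "q \<in> P" using assms(2) Inr unfolding points_def by auto
    have "0 < hd p q" using hd_pos[OF p q] assms(3) \<open>u = Inr p\<close> Inr by simp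
    thus ?thesis using ext_neq[OF assms(3)] \<open>u = Inr p\<close> Inr offset_simps(2) by simp
  qed
qed

lemma ext_triangle:
  assumes "u \<in> points" "v \<in> points" "w \<in> points"
  shows "ext u w \<le> ext u v + ext v w"
proof (cases "u = v \<or> v = w")
  case True
  thus ?thesis using ext_self by auto
next
  case False
  thus ?thesis
    using ext_le[OF assms(1), of w] ext_neq[of u v] ext_neq[of v w] offset_nonneg[of v]
      hd_triangle[OF node_base_hull[OF assms(1)] node_base_hull[OF assms(2)] node_base_hull[OF assms(3)]]
    by simp
qed

lemma pointsE:
  assumes "x \<in> points"
  obtains l where "x = Inl l" "l \<in> leaves" | p where "x = Inr p" "p \<in> P"
  using assms unfolding points_def by auto

lemma Inr_points: "p \<in> P \<Longrightarrow> Inr p \<in> points"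
  unfolding points_def by simp

lemma Inl_points: "l \<in> leaves \<Longrightarrow> Inl l \<in> points"
  unfolding points_def by simp

lemma ext_tree_metric: "tree_metric points ext"
proof (rule tree_metricI)
  fix a b c assume M: "a \<in> points" "b \<in> points" "c \<in> points"
  have bl: "between ext x x y" "between ext y x x" for x y unfolding between_def ext_self by simp_all
  show "\<exists>m\<in>points. between ext a m b \<and> between ext b m c \<and> between ext a m c"
  proof (cases "a = b \<or> b = c \<or> a = c")
    case True
    thus ?thesis using bl M by metis
  next
    case False
    obtain m where m: "m \<in> P" "between hd (node_base A a) m (node_base A b)"
      "between hd (node_base A b) m (node_base A c)" "between hd (node_base A a) m (node_base A c)"
      using median[OF node_base_hull[OF M(1)] node_base_hull[OF M(2)] node_base_hull[OF M(3)]] by blast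
    thus ?thesis
      using between_ext_Inr[OF M(1,2) _ m(1)] between_ext_Inr[OF M(2,3) _ m(1)]
        between_ext_Inr[OF M(1,3) _ m(1)] False Inr_points[OF m(1)] by blast
  qed
next
  fix a b x y assume M: "a \<in> points" "b \<in> points" "x \<in> points" "y \<in> points"
    and xb: "between ext a x b" and yb: "between ext a y b"
  have bl: "between ext u u v" "between ext v u u" for u v unfolding between_def ext_self by simp_all
  show "between ext a x y \<or> between ext a y x"
  proof (cases "x = a \<or> x = b \<or> y = a \<or> y = b \<or> a = b")
    case True
    moreover have "x = a" if ab: "a = b"
    proof (rule ccontr)
      assume "x \<noteq> a"
      hence "0 < ext a x" "0 < ext x a" using ext_pos M by auto
      thus False using xb ab ext_self[of b] unfolding between_def by simp
    qed
    ultimately show ?thesis using bl xb yb by blast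
  next
    case False
    obtain p where p: "x = Inr p" "p \<in> P"
      using pointsE[OF M(3)] between_ext_Inl[OF M(1,2)] M(3) xb False by metis
    obtain q where q: "y = Inr q" "q \<in> P"
      using pointsE[OF M(4)] between_ext_Inl[OF M(1,2)] M(4) yb False by metis
    have "between hd (node_base A a) p (node_base A b)" "between hd (node_base A a) q (node_base A b)"
      using between_ext_Inr[OF M(1,2)] p q xb yb False by blast+
    hence "between hd (node_base A a) p q \<or> between hd (node_base A a) q p"
      using between_linear[OF node_base_hull[OF M(1)] node_base_hull[OF M(2)] p(2) q(2)] by blast
    thus ?thesis
      unfolding between_def p(1) q(1) ext_Inr(1)[OF M(1) p(2)] ext_Inr(1)[OF M(1) q(2)]
        ext_Inr(1)[OF Inr_points[OF p(2)] q(2)] ext_Inr(1)[OF Inr_points[OF q(2)] p(2)] offset_simps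
      by auto
  qed
qed (simp_all add: ext_self ext_pos ext_sym ext_triangle)

lemma valence_eq: "p \<in> P \<Longrightarrow> valence A p = card (germs p) + card {l \<in> leaves. label_base A l = p}"
  unfolding valence_def dims edge_directions_eq by (simp add: card_image direction_inj)

text \<open>The directions at \<open>p\<close> are represented by leaves: those attached at
  \<open>p\<close>, and for each germ a primed leaf with index in it, which lies in that direction
  by \<open>germ_base\<close>.\<close>

lemma valence_leaves:
  assumes p: "p \<in> P"
  shows "\<exists>X\<subseteq>leaves. card X = valence A p \<and>
    (\<forall>l\<in>X. \<forall>l'\<in>X. l \<noteq> l' \<longrightarrow> between hd (label_base A l) p (label_base A l'))"
proof -
  define Y where "Y = {l \<in> leaves. label_base A l = p}"
  define c where "c S = (SOME j. j \<in> S)" for S :: "nat set"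
  have c: "c S \<in> S" "c S < r" if "S \<in> germs p" for S
  proof -
    show "c S \<in> S" unfolding c_def using germsD(1)[OF p that] by (simp add: some_in_eq)
    thus "c S < r" using germsD(2)[OF p that] by auto
  qed
  have cb: "base (c S) \<noteq> p" "germ p (base (c S)) = S" if S: "S \<in> germs p" for S
  proof -
    show b: "base (c S) \<noteq> p" using base_eq_iff[OF c(2)[OF S] p] c(1)[OF S] S by blast
    have "c S \<in> germ p (base (c S))" by (rule germ_base[OF c(2)[OF S] p b])
    moreover have "germ p (base (c S)) \<in> germs p" unfolding germs_def using base_hull b by blast
    ultimately show "germ p (base (c S)) = S" using germs_disjoint[OF p _ S] c(1)[OF S] by blast
  qed
  define Z where "Z = (\<lambda>S. Primed (c S)) ` germs p"
  have inj: "inj_on (\<lambda>S. Primed (c S)) (germs p)"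
    by (rule inj_onI) (metis label.inject(2) cb(2))
  have lbZ: "label_base A l \<noteq> p \<and> germ p (label_base A l) \<in> germs p \<and> l = Primed (c (germ p (label_base A l)))"
    if l: "l \<in> Z" for l
  proof -
    obtain S where S: "S \<in> germs p" "l = Primed (c S)" using l unfolding Z_def by blast
    thus ?thesis using cb[OF S(1)] label_base_simps(2)[OF c(2)[OF S(1)]] by simp
  qed
  have Zl: "Z \<subseteq> leaves" unfolding Z_def labels_def using c(2) by blast
  have "Y \<inter> Z = {}" using lbZ unfolding Y_def by blast
  moreover have "finite Y" "finite Z" unfolding Y_def Z_def using finite_leaves germs_finite by simp_all
  ultimately have "card (Y \<union> Z) = valence A p"
    unfolding valence_eq[OF p] using card_Un_disjoint[of Y Z] card_image[OF inj] by (simp add: Y_def Z_def)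
  moreover have "between hd (label_base A l) p (label_base A l')"
    if l: "l \<in> Y \<union> Z" "l' \<in> Y \<union> Z" "l \<noteq> l'" for l l'
  proof -
    have L: "l \<in> leaves" "l' \<in> leaves" using l Zl unfolding Y_def by auto
    have "germ p (label_base A l) \<inter> germ p (label_base A l') = {}"
    proof (cases "label_base A l = p \<or> label_base A l' = p")
      case True
      thus ?thesis using germ_self by auto
    next
      case False
      hence "l \<in> Z" "l' \<in> Z" using l unfolding Y_def by auto
      thus ?thesis using lbZ[of l] lbZ[of l'] l(3) germs_disjoint[OF p] by metis
    qed
    thus ?thesis using between_iff_germ[OF p label_base_hull[OF L(1)] label_base_hull[OF L(2)]] by simp
  qed
  moreover have "Y \<union> Z \<subseteq> leaves" using Zl unfolding Y_def by auto
  ultimately show ?thesis by (intro exI[of _ "Y \<union> Z"]) blast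
qed

text \<open>Points that are pairwise separated by \<open>p\<close> leave it in different directions,
  and the valence counts these directions.\<close>

lemma valence_ge_3:
  assumes p: "p \<in> P" and M: "a \<in> points" "b \<in> points" "c \<in> points"
    and neq: "a \<noteq> Inr p" "b \<noteq> Inr p" "c \<noteq> Inr p"
    and btw: "between ext a (Inr p) b" "between ext b (Inr p) c" "between ext a (Inr p) c"
  shows "3 \<le> valence A p"
proof -
  \<comment> \<open>All leaves attached at \<open>p\<close> have the empty germ, but each of them is
    a direction of its own; hence the disjoint union.\<close>
  define dirn where "dirn u = (if node_base A u = p then Inl u else Inr (germ p (node_base A u)))" for u
  define D where "D = (Inl :: label + real vec \<Rightarrow> (label + real vec) + nat set) ` Inl ` {l \<in> leaves. label_base A l = p} \<union> Inr ` germs p"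
  have mem: "dirn u \<in> D" if u: "u \<in> points" "u \<noteq> Inr p" for u
  proof (cases "node_base A u = p")
    case True
    thus ?thesis using u pointsE[OF u(1)] unfolding dirn_def D_def by (cases u) auto
  next
    case False
    thus ?thesis using node_base_hull[OF u(1)] unfolding dirn_def D_def germs_def by auto
  qed
  have differ: "dirn u \<noteq> dirn v" if u: "u \<in> points" "v \<in> points" "u \<noteq> Inr p" "between ext u (Inr p) v" for u v
  proof
    assume e: "dirn u = dirn v"
    have uv: "u \<noteq> v"
    proof
      assume "u = v"
      moreover have "0 < ext u (Inr p)" "0 < ext (Inr p) u" using ext_pos u(1,3) Inr_points[OF p] by auto
      ultimately show False using u(4) ext_self[of v] unfolding between_def by simp
    qed
    have "node_base A u \<noteq> p" using e uv unfolding dirn_def by (auto split: if_splits)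
    moreover have "germ p (node_base A u) = germ p (node_base A v)" if "node_base A u \<noteq> p"
      using e that unfolding dirn_def by (auto split: if_splits)
    moreover have "germ p (node_base A u) \<inter> germ p (node_base A v) = {}"
      using between_iff_germ[OF p node_base_hull[OF u(1)] node_base_hull[OF u(2)]]
        between_ext_Inr[OF u(1,2) uv p] u(4) by simp
    ultimately show False using germ_nonempty[OF p node_base_hull[OF u(1)]] by auto
  qed
  have "card {dirn a, dirn b, dirn c} = 3"
    using differ[OF M(1,2) neq(1) btw(1)] differ[OF M(2,3) neq(2) btw(2)] differ[OF M(1,3) neq(1) btw(3)] by simp
  moreover have "{dirn a, dirn b, dirn c} \<subseteq> D" using mem M neq by simp
  moreover have fin: "finite {l \<in> leaves. label_base A l = p}" using finite_leaves by simp
  moreover have "card D = valence A p"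
  proof -
    have "card D = card ((Inl :: label + real vec \<Rightarrow> (label + real vec) + nat set) ` Inl ` {l \<in> leaves. label_base A l = p}) +
      card ((Inr :: nat set \<Rightarrow> (label + real vec) + nat set) ` germs p)"
      unfolding D_def using fin germs_finite by (intro card_Un_disjoint) auto
    also have "\<dots> = card {l \<in> leaves. label_base A l = p} + card (germs p)"
      by (simp add: card_image image_image inj_on_def)
    finally show ?thesis unfolding valence_eq[OF p] by simp
  qed
  moreover have "finite D" unfolding D_def using fin germs_finite by simp
  ultimately show ?thesis by (metis card_mono)
qed

text \<open>Every coordinate of a point of the hull is attained by some column.\<close>

lemma column_not_germ:
  assumes p: "p \<in> P" and k: "k < r"
  obtains i where "i < n" "k \<notin> germ p (column i)"
proof -
  obtain c where c: "\<And>i j. i < r \<Longrightarrow> j < n \<Longrightarrow> p $ i \<le> c j + A $$ (i, j)"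
    "\<And>i. i < r \<Longrightarrow> \<exists>j<n. p $ i = c j + A $$ (i, j)" using hullE[OF p] by blast
  obtain i where i: "i < n" "p $ k = c i + A $$ (k, i)" using c(2)[OF k] by blast
  have "column i $ k - p $ k \<le> column i $ m - p $ m" if "m < r" for m
    using column_index[OF k i(1)] column_index[OF that i(1)] c(1)[OF that i(1)] i(2) by linarith
  hence "k \<notin> germ p (column i)" unfolding germ_def by force
  thus ?thesis using that i(1) by blast
qed

text \<open>A germ and its complement are both nonempty. A column whose germ avoids some index in
  \<open>germ p q\<close>, and a ray whose index is outside it, both lie behind \<open>p\<close>.
  This becomes the split condition of the tree.\<close>

lemma leaves_beyond:
  assumes p: "p \<in> P" and q: "q \<in> P" "p \<noteq> q"
  shows "\<exists>i<n. between hd (column i) p q" "\<exists>j<r. between hd (base j) p q"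
proof -
  have Sg: "germ p q \<in> germs p" unfolding germs_def using q by blast
  have other: "germ p x \<inter> germ p q = {}" if "x \<in> P" "germ p x \<noteq> germ p q" for x
    using germ_disjoint_or_eq[OF p that(1) q(1)] that(2) by blast
  obtain k where k: "k \<in> germ p q" "k < r" using germsD(1,2)[OF p Sg] by auto
  obtain i where i: "i < n" "k \<notin> germ p (column i)" using column_not_germ[OF p k(2)] by blast
  have "germ p (column i) \<inter> germ p q = {}" using other[OF column_hull[OF i(1)]] i(2) k(1) by blast
  thus "\<exists>i<n. between hd (column i) p q" using between_iff_germ[OF p column_hull[OF i(1)] q(1)] i(1) by blast
  obtain j where j: "j < r" "j \<notin> germ p q" using germsD(3)[OF p Sg] by blast
  have "germ p (base j) \<inter> germ p q = {}"
  proof (cases "base j = p")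
    case True
    thus ?thesis using germ_self by simp
  next
    case False
    thus ?thesis using other[OF base_hull] germ_base[OF j(1) p] j(2) by blast
  qed
  thus "\<exists>j<r. between hd (base j) p q" using between_iff_germ[OF p base_hull q(1)] j(1) by blast
qed

lemma germs_Union_full:
  assumes p: "p \<in> P" and full: "\<Union>(germs p) = {..<r}"
  shows "2 \<le> card (germs p)"
proof (rule ccontr)
  assume "\<not> 2 \<le> card (germs p)"
  hence "card (germs p) = 0 \<or> card (germs p) = 1" by linarith
  hence "germs p = {} \<or> (\<exists>S. germs p = {S})" using germs_finite[of p] by (auto simp: card_1_singleton_iff)
  thus False
  proof
    assume "germs p = {}"
    thus False using full r by auto
  next
    assume "\<exists>S. germs p = {S}"
    then obtain S where S: "germs p = {S}" by blast
    thus False using germsD(3)[OF p, of S] full by auto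
  qed
qed

lemma primed_base_exists:
  assumes "p \<in> P" "\<Union>(germs p) \<noteq> {..<r}"
  shows "\<exists>j<r. base j = p"
proof -
  have "\<Union>(germs p) \<subseteq> {..<r}" using germsD(2)[OF assms(1)] by blast
  then obtain j where "j < r" "j \<notin> \<Union>(germs p)" using assms(2) by blast
  thus ?thesis using base_eq_iff[OF _ assms(1)] by blast
qed

lemma no_germs: "p \<in> P \<Longrightarrow> germs p = {} \<Longrightarrow> q \<in> P \<Longrightarrow> q = p"
  unfolding germs_def by auto

lemma card_labels_ge:
  assumes "X \<subseteq> {l \<in> leaves. label_base A l = p}"
  shows "card X \<le> card {l \<in> leaves. label_base A l = p}"
  using assms finite_leaves by (intro card_mono) auto

lemma two_labels_at:
  assumes "i < n" "j < r" "column i = p" "base j = p"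
  shows "2 \<le> card {l \<in> leaves. label_base A l = p}"
proof -
  have "{Unprimed i, Primed j} \<subseteq> {l \<in> leaves. label_base A l = p}"
    using assms label_base_simps unfolding labels_def by auto
  from card_labels_ge[OF this] show ?thesis by simp
qed

text \<open>If the germs cover all coordinates there are at least two, each being a proper subset.
  Otherwise a missing coordinate is a ray attached at \<open>p\<close>, and an edge, or a column if
  the hull is a single point, counts once more.\<close>

lemma valence_ge_2:
  assumes p: "p \<in> P"
  shows "2 \<le> valence A p"
proof (cases "\<Union>(germs p) = {..<r}")
  case True
  thus ?thesis using germs_Union_full[OF p] valence_eq[OF p] by simp
next
  case False
  then obtain j where j: "j < r" "base j = p" using primed_base_exists[OF p] by blast
  show ?thesis
  proof (cases "germs p = {}")
    case True
    have "column 0 = p" using no_germs[OF p True column_hull[OF n]] .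
    thus ?thesis using two_labels_at[OF n j(1) _ j(2)] valence_eq[OF p] by simp
  next
    case False
    have "{Primed j} \<subseteq> {l \<in> leaves. label_base A l = p}"
      using j label_base_simps(2) unfolding labels_def by auto
    from card_labels_ge[OF this] have "1 \<le> card {l \<in> leaves. label_base A l = p}" by simp
    moreover have "1 \<le> card (germs p)" using False germs_finite[of p] by (simp add: Suc_leI card_gt_0_iff)
    ultimately show ?thesis using valence_eq[OF p] by simp
  qed
qed

text \<open>A leaf is attached to a vertex, unless the tree is a single edge.\<close>

lemma valence_label:
  assumes l: "l \<in> leaves" "valence A (label_base A l) = 2"
  shows "leaves = {Unprimed 0, Primed 0} \<and> P = {label_base A l}"
proof -
  define p where "p = label_base A l"
  have p: "p \<in> P" unfolding p_def using label_base_hull[OF l(1)] .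
  have "{l} \<subseteq> {l \<in> leaves. label_base A l = p}" using l p_def by auto
  from card_labels_ge[OF this] have c1: "1 \<le> card {l \<in> leaves. label_base A l = p}" by simp
  have v: "card (germs p) + card {l \<in> leaves. label_base A l = p} = 2"
    using valence_eq[OF p] l(2) p_def by simp
  have nf: "\<Union>(germs p) \<noteq> {..<r}"
  proof
    assume "\<Union>(germs p) = {..<r}"
    from germs_Union_full[OF p this] show False using v c1 by simp
  qed
  then obtain j where j: "j < r" "base j = p" using primed_base_exists[OF p] by blast
  have g0: "germs p = {}"
  proof (rule ccontr)
    assume ne: "germs p \<noteq> {}"
    hence "1 \<le> card (germs p)" using germs_finite[of p] by (simp add: Suc_leI card_gt_0_iff)
    hence "card (germs p) = 1" using v c1 by simp
    then obtain S where S: "germs p = {S}" by (auto simp: card_1_singleton_iff)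
    obtain k where k: "k \<in> S" "k < r" using germsD(1,2)[OF p, of S] S by auto
    obtain i where i: "i < n" "k \<notin> germ p (column i)" using column_not_germ[OF p k(2)] by blast
    have "column i = p"
    proof (rule ccontr)
      assume "column i \<noteq> p"
      hence "germ p (column i) \<in> germs p" unfolding germs_def using column_hull[OF i(1)] by blast
      thus False using S i(2) k(1) by simp
    qed
    hence "2 \<le> card {l \<in> leaves. label_base A l = p}" using two_labels_at[OF i(1) j(1) _ j(2)] by simp
    thus False using v \<open>card (germs p) = 1\<close> by simp
  qed
  have Pp: "P = {p}" using no_germs[OF p g0] p by blast
  hence "{l \<in> leaves. label_base A l = p} = leaves" using label_base_hull by blast
  hence "card leaves = 2" using v g0 by simp
  moreover have "{Unprimed 0, Primed 0} \<subseteq> leaves" using r n unfolding labels_def by auto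
  ultimately have "{Unprimed 0, Primed 0} = leaves" using finite_leaves by (intro card_subset_eq) simp_all
  thus ?thesis using Pp p_def by simp
qed

lemma tree_nodes_eq: "tree_nodes A = Inl ` leaves \<union> Inr ` {p \<in> P. valence A p \<noteq> 2}"
  unfolding tree_nodes_def inner_nodes_def dims by simp

lemma Inr_node: "Inr p \<in> tree_nodes A \<longleftrightarrow> p \<in> P \<and> valence A p \<noteq> 2"
  unfolding tree_nodes_eq by auto

lemma Inl_node: "Inl l \<in> tree_nodes A \<longleftrightarrow> l \<in> leaves"
  unfolding tree_nodes_eq by auto

lemma nodes_subset: "tree_nodes A \<subseteq> points"
  unfolding tree_nodes_eq points_def by auto

lemma node_valence: "Inr p \<in> tree_nodes A \<Longrightarrow> 3 \<le> valence A p"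
  unfolding Inr_node using valence_ge_2[of p] by force

text \<open>Every branch point is the median of three leaves, and there are finitely many
  triples.\<close>

lemma finite_branch_points: "finite {p \<in> P. valence A p \<noteq> 2}"
proof (rule finite_subset)
  define f where "f = (\<lambda>(a, b, c). SOME m. m \<in> P \<and>
    between hd (label_base A a) m (label_base A b) \<and> between hd (label_base A b) m (label_base A c) \<and>
    between hd (label_base A a) m (label_base A c))"
  show "finite (f ` (leaves \<times> leaves \<times> leaves))" using finite_leaves by simp
  show "{p \<in> P. valence A p \<noteq> 2} \<subseteq> f ` (leaves \<times> leaves \<times> leaves)"
  proof
    fix p assume "p \<in> {p \<in> P. valence A p \<noteq> 2}"
    hence p: "p \<in> P" and v: "3 \<le> valence A p" using node_valence Inr_node by auto
    obtain X where X: "X \<subseteq> leaves" "card X = valence A p"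
      "\<forall>l\<in>X. \<forall>l'\<in>X. l \<noteq> l' \<longrightarrow> between hd (label_base A l) p (label_base A l')"
      using valence_leaves[OF p] by blast
    obtain Y where Y: "Y \<subseteq> X" "card Y = 3" using v X(2) obtain_subset_with_card_n[of 3 X] by auto
    then obtain a b c where abc: "Y = {a, b, c}" "a \<noteq> b" "b \<noteq> c" "a \<noteq> c" by (auto simp: card_3_iff)
    have m: "between hd (label_base A a) p (label_base A b)" "between hd (label_base A b) p (label_base A c)"
      "between hd (label_base A a) p (label_base A c)" using X(3) Y(1) abc by auto
    have L: "a \<in> leaves" "b \<in> leaves" "c \<in> leaves" using X(1) Y(1) abc by auto
    have "f (a, b, c) = p"
      unfolding f_def prod.case
    proof (rule some_equality)
      fix m' assume "m' \<in> P \<and> between hd (label_base A a) m' (label_base A b) \<and>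
        between hd (label_base A b) m' (label_base A c) \<and> between hd (label_base A a) m' (label_base A c)"
      thus "m' = p"
        using median_unique[OF label_base_hull[OF L(1)] label_base_hull[OF L(2)] label_base_hull[OF L(3)] _ p] m
        by blast
    qed (use p m in simp)
    thus "p \<in> f ` (leaves \<times> leaves \<times> leaves)" using L by (intro image_eqI[of _ _ "(a, b, c)"]) simp_all
  qed
qed

text \<open>A median of three nodes that differs from all of them has valence at least 3, so no
  median is lost by restricting to nodes.\<close>

lemma nodes_tree_metric: "tree_metric (tree_nodes A) ext"
proof (rule tree_metric.tree_metric_subset[OF ext_tree_metric nodes_subset])
  fix a b c m assume N: "a \<in> tree_nodes A" "b \<in> tree_nodes A" "c \<in> tree_nodes A" and m: "m \<in> points"
    and btw: "between ext a m b" "between ext b m c" "between ext a m c"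
  have M: "a \<in> points" "b \<in> points" "c \<in> points" using N nodes_subset by auto
  show "m \<in> tree_nodes A"
  proof (cases "m = a \<or> m = b \<or> m = c")
    case True
    thus ?thesis using N by blast
  next
    case False
    from m show ?thesis
    proof (cases rule: pointsE)
      case (1 l)
      thus ?thesis using between_ext_Inl[OF M(1,2), of l] m btw(1) False by auto
    next
      case (2 p)
      hence "3 \<le> valence A p" using valence_ge_3[OF 2(2) M] btw False by auto
      thus ?thesis using 2 Inr_node by simp
    qed
  qed
qed

lemma tree_of_simps: "nodes (tree_of A) = tree_nodes A" "leaf (tree_of A) = Inl"
  unfolding tree_of_def by simp_all

text \<open>The edges of \<open>tree_of\<close> test only inner nodes, with distances of bases. For
  \<open>ext\<close> this amounts to the same: a leaf is never strictly between, and the unit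
  lengths at the two ends cancel.\<close>

lemma tree_of_metric: "metric_tree (tree_of A) ext"
proof (rule metric_tree.intro)
  show "finite (nodes (tree_of A))" unfolding tree_of_simps tree_nodes_eq using finite_leaves finite_branch_points by simp
  have "Unprimed 0 \<in> leaves" unfolding labels_def using n by simp
  thus "nodes (tree_of A) \<noteq> {}" unfolding tree_of_simps tree_nodes_eq by blast
  show "tree_metric (nodes (tree_of A)) ext" unfolding tree_of_simps by (rule nodes_tree_metric)
  have iff: "(\<forall>w\<in>inner_nodes A. node_dist A u w + node_dist A w v = node_dist A u v \<longrightarrow> w \<in> {u, v}) \<longleftrightarrow>
    (\<forall>w\<in>tree_nodes A. between ext u w v \<longrightarrow> w \<in> {u, v})"
    if uv: "u \<in> tree_nodes A" "v \<in> tree_nodes A" "u \<noteq> v" for u v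
  proof -
    have M: "u \<in> points" "v \<in> points" using uv nodes_subset by auto
    have inner: "between ext u (Inr p) v \<longleftrightarrow> node_dist A u (Inr p) + node_dist A (Inr p) v = node_dist A u v"
      if "p \<in> P" for p
      using between_ext_Inr[OF M uv(3) that] unfolding between_def node_dist_def by simp
    have leaf: "Inl l \<in> {u, v}" if "l \<in> leaves" "between ext u (Inl l) v" for l
      using between_ext_Inl[OF M Inl_points[OF that(1)] that(2)] by auto
    show ?thesis
    proof (intro iffI ballI impI)
      fix w assume H: "\<forall>w\<in>inner_nodes A. node_dist A u w + node_dist A w v = node_dist A u v \<longrightarrow> w \<in> {u, v}"
        and w: "w \<in> tree_nodes A" "between ext u w v"
      show "w \<in> {u, v}"
      proof (cases w)
        case (Inl l)
        thus ?thesis using leaf w Inl_node by simp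
      next
        case (Inr p)
        hence "p \<in> P" "w \<in> inner_nodes A" using w(1) Inr_node unfolding inner_nodes_def by auto
        thus ?thesis using H inner[of p] w(2) Inr by blast
      qed
    next
      fix w assume H: "\<forall>w\<in>tree_nodes A. between ext u w v \<longrightarrow> w \<in> {u, v}"
        and w: "w \<in> inner_nodes A" "node_dist A u w + node_dist A w v = node_dist A u v"
      obtain p where p: "w = Inr p" "p \<in> P" "valence A p \<noteq> 2" using w(1) unfolding inner_nodes_def by blast
      hence "w \<in> tree_nodes A" using Inr_node by simp
      thus "w \<in> {u, v}" using H inner[OF p(2)] w(2) p(1) by blast
    qed
  qed
  have "edges (tree_of A) = {{u, v} | u v. u \<in> tree_nodes A \<and> v \<in> tree_nodes A \<and> u \<noteq> v \<and>
       (\<forall>w\<in>inner_nodes A. node_dist A u w + node_dist A w v = node_dist A u v \<longrightarrow> w \<in> {u, v})}"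
    unfolding tree_of_def by simp
  also have "\<dots> = {{u, v} | u v. u \<in> tree_nodes A \<and> v \<in> tree_nodes A \<and> u \<noteq> v \<and>
       (\<forall>w\<in>tree_nodes A. between ext u w v \<longrightarrow> w \<in> {u, v})}"
    using iff by (intro Collect_cong ex_cong1) blast
  finally show "edges (tree_of A) = {{u, v} | u v. u \<in> nodes (tree_of A) \<and> v \<in> nodes (tree_of A) \<and> u \<noteq> v \<and>
       (\<forall>w\<in>nodes (tree_of A). between ext u w v \<longrightarrow> w \<in> {u, v})}"
    unfolding tree_of_simps .
qed

sublocale T: metric_tree "tree_of A" ext
  by (rule tree_of_metric)

lemma degree_leaf:
  assumes l: "l \<in> leaves"
  shows "degree (tree_of A) (Inl l) = 1"
proof -
  have "Unprimed 0 \<in> leaves" "Primed 0 \<in> leaves" unfolding labels_def using n r by auto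
  moreover have "Unprimed 0 \<noteq> l \<or> Primed 0 \<noteq> l" by auto
  ultimately obtain k where k: "k \<in> leaves" "k \<noteq> l" by blast
  show ?thesis
  proof (rule T.degree_one[of _ "Inl k"])
    fix a b assume ab: "a \<in> nodes (tree_of A)" "b \<in> nodes (tree_of A)" "between ext a (Inl l) b"
    hence M: "a \<in> points" "b \<in> points" using nodes_subset unfolding tree_of_simps by auto
    show "a = Inl l \<or> b = Inl l" by (rule between_ext_Inl[OF M Inl_points[OF l] ab(3)])
  qed (use k l in \<open>simp_all add: tree_of_simps Inl_node\<close>)
qed

lemma degree_branch_point:
  assumes p: "Inr p \<in> tree_nodes A"
  shows "3 \<le> degree (tree_of A) (Inr p)"
proof -
  have pP: "p \<in> P" using p Inr_node by simp
  obtain X where X: "X \<subseteq> leaves" "card X = valence A p"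
    "\<forall>l\<in>X. \<forall>l'\<in>X. l \<noteq> l' \<longrightarrow> between hd (label_base A l) p (label_base A l')"
    using valence_leaves[OF pP] by blast
  obtain Y where Y: "Y \<subseteq> X" "card Y = 3"
    using node_valence[OF p] X(2) obtain_subset_with_card_n[of 3 X] by auto
  then obtain a b c where abc: "Y = {a, b, c}" "a \<noteq> b" "b \<noteq> c" "a \<noteq> c" by (auto simp: card_3_iff)
  have L: "a \<in> leaves" "b \<in> leaves" "c \<in> leaves" using X(1) Y(1) abc by auto
  have btw: "between ext (Inl l) (Inr p) (Inl l')" if "l \<in> X" "l' \<in> X" "l \<noteq> l'" for l l'
    using between_ext_Inr[OF Inl_points Inl_points _ pP, of l l'] X(1,3) that by auto
  show ?thesis
    by (rule T.degree_ge_3[of _ "Inl a" "Inl b" "Inl c"])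
      (use p L btw Y(1) abc in \<open>simp_all add: tree_of_simps Inl_node\<close>)
qed

lemma node_cases:
  assumes "u \<in> tree_nodes A"
  obtains l where "u = Inl l" "l \<in> leaves" "degree (tree_of A) u = 1"
    | p where "u = Inr p" "p \<in> P" "3 \<le> degree (tree_of A) u"
  using assms degree_leaf degree_branch_point Inr_node Inl_node by (cases u) auto

lemma internal_edge_cases:
  assumes "e \<in> internal_edges (tree_of A)"
  obtains p q where "e = {Inr p, Inr q}" "Inr p \<in> tree_nodes A" "Inr q \<in> tree_nodes A" "p \<noteq> q"
    "e \<in> edges (tree_of A)"
proof -
  have e: "e \<in> edges (tree_of A)" "\<And>v. v \<in> e \<Longrightarrow> degree (tree_of A) v \<noteq> 1"
    using assms unfolding internal_edges_def by auto
  obtain u v where uv: "e = {u, v}" "u \<in> tree_nodes A" "v \<in> tree_nodes A" "u \<noteq> v"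
    using T.edgeE[OF e(1)] unfolding tree_of_simps by blast
  obtain p where "u = Inr p" using node_cases[OF uv(2)] e(2)[of u] uv(1) by blast
  moreover obtain q where "v = Inr q" using node_cases[OF uv(3)] e(2)[of v] uv(1) by blast
  ultimately show ?thesis using that[of p q] uv e(1) by blast
qed

lemma tree_of_len:
  assumes "p \<in> P" "q \<in> P"
  shows "len (tree_of A) {Inr p, Inr q} = hd p q"
proof -
  have "(\<lambda>(u, v). node_dist A u v) ` ({Inr p, Inr q} \<times> {Inr p, Inr q}) = {0, hd p q}"
    using hd_self assms hd_sym[OF assms] by (auto simp: node_dist_def image_iff)
  moreover have "0 \<le> hd p q" using dist_nonneg assms by blast
  ultimately show ?thesis unfolding tree_of_def by (simp add: max_def)
qed

text \<open>A leaf is adjacent to its base at distance 1. The exception is a 1 x 1 matrix, where the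
  base has valence 2 and is no node; there the two leaves are adjacent at distance 2.\<close>

lemma leaf_edge:
  assumes l: "l \<in> leaves" and e: "{Inl l, v} \<in> edges (tree_of A)"
  shows "ext (Inl l) v = edge_weight (tree_of A) {Inl l, v}"
proof -
  let ?p = "label_base A l"
  have v: "v \<in> tree_nodes A" "v \<noteq> Inl l" using T.edge_nodes[OF e] unfolding tree_of_simps by auto
  have M: "Inl l \<in> points" "v \<in> points" using l v nodes_subset Inl_points by auto
  have ni: "{Inl l, v} \<notin> internal_edges (tree_of A)"
    unfolding internal_edges_def using degree_leaf[OF l] by auto
  hence w: "edge_weight (tree_of A) {Inl l, v} = real (card {u \<in> {Inl l, v}. degree (tree_of A) u = 1})"
    unfolding edge_weight_def by simp
  show ?thesis
  proof (cases "valence A ?p = 2")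
    case False
    hence N: "Inr ?p \<in> tree_nodes A" using Inr_node label_base_hull[OF l] by simp
    have "between ext (Inl l) (Inr ?p) v"
      using between_ext_Inr[OF M v(2)[symmetric] label_base_hull[OF l]] hd_self[OF label_base_hull[OF l]]
      unfolding between_def by simp
    hence v_eq: "v = Inr ?p" using T.edge_between[OF e, of "Inr ?p"] N unfolding tree_of_simps by auto
    have "{u \<in> {Inl l, v}. degree (tree_of A) u = 1} = {Inl l}"
      using v_eq degree_branch_point[OF N] degree_leaf[OF l] by auto
    moreover have "ext (Inl l) v = 1"
      unfolding v_eq ext_Inr(1)[OF M(1) label_base_hull[OF l]] using hd_self[OF label_base_hull[OF l]] offset_simps
      by simp
    ultimately show ?thesis using w by simp
  next
    case True
    have S: "leaves = {Unprimed 0, Primed 0}" "P = {?p}" using valence_label[OF l True] by auto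
    have "v \<noteq> Inr p" for p using v(1) S(2) True Inr_node by auto
    then obtain k where k: "v = Inl k" "k \<in> leaves" using v(1) Inl_node by (cases v) auto
    have "label_base A k = ?p" using label_base_hull[OF k(2)] S(2) by auto
    hence "ext (Inl l) v = 2"
      using ext_neq[OF v(2)[symmetric]] hd_self[OF label_base_hull[OF l]] k(1) offset_simps by simp
    moreover have "{u \<in> {Inl l, v}. degree (tree_of A) u = 1} = {Inl l, v}"
      using degree_leaf[OF l] degree_leaf[OF k(2)] k(1) by auto
    ultimately show ?thesis using w v(2) by simp
  qed
qed

lemma tree_of_realized: "realized_tree (tree_of A) ext"
proof (intro realized_tree.intro realized_tree_axioms.intro tree_of_metric)
  fix u v assume e: "{u, v} \<in> edges (tree_of A)"
  have N: "u \<in> tree_nodes A" "v \<in> tree_nodes A" "u \<noteq> v" using T.edge_nodes[OF e] unfolding tree_of_simps by auto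
  from N(1) show "ext u v = edge_weight (tree_of A) {u, v}"
  proof (cases rule: node_cases)
    case (1 l)
    thus ?thesis using leaf_edge[of l v] e by simp
  next
    case u: (2 p)
    from N(2) show ?thesis
    proof (cases rule: node_cases)
      case (1 l)
      have "ext u v = ext v u" using ext_sym N nodes_subset by blast
      thus ?thesis using leaf_edge[of l u] e 1 by (simp add: insert_commute)
    next
      case v: (2 q)
      have "{u, v} \<in> internal_edges (tree_of A)" unfolding internal_edges_def using e u v by auto
      thus ?thesis unfolding edge_weight_def
        using tree_of_len[OF u(2) v(2)] u(1) v(1) ext_neq[OF N(3)] offset_simps by simp
    qed
  qed
qed

lemma tree_of_leaf_labelled: "leaf_labelled_tree leaves (tree_of A)"
proof -
  have deg: "{v \<in> tree_nodes A. degree (tree_of A) v = 1} = Inl ` leaves"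
  proof (intro equalityI subsetI)
    fix v assume "v \<in> {v \<in> tree_nodes A. degree (tree_of A) v = 1}"
    hence v: "v \<in> tree_nodes A" "degree (tree_of A) v = 1" by auto
    from v(1) show "v \<in> Inl ` leaves" by (cases rule: node_cases) (use v(2) in auto)
  next
    fix v :: "label + real vec" assume "v \<in> Inl ` leaves"
    thus "v \<in> {v \<in> tree_nodes A. degree (tree_of A) v = 1}" using degree_leaf Inl_node by auto
  qed
  have "bij_betw Inl leaves (Inl ` leaves)" by (simp add: bij_betw_def)
  moreover have "degree (tree_of A) v \<noteq> 2" if "v \<in> tree_nodes A" for v
    using that by (cases rule: node_cases) auto
  ultimately show ?thesis
    unfolding leaf_labelled_tree_def tree_of_simps deg using T.is_tree by simp
qed

lemma tree_of_splits:
  assumes "S \<in> splits leaves (tree_of A)" "B \<in> S"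
  shows "(\<exists>i. Unprimed i \<in> B) \<and> (\<exists>j. Primed j \<in> B)"
proof -
  obtain e u where e: "e \<in> internal_edges (tree_of A)" "B = side leaves (tree_of A) e u" "u \<in> e"
    using assms unfolding splits_def by blast
  obtain p q where pq: "e = {Inr p, Inr q}" "Inr p \<in> tree_nodes A" "Inr q \<in> tree_nodes A" "p \<noteq> q"
    "e \<in> edges (tree_of A)" using internal_edge_cases[OF e(1)] by blast
  have "\<exists>x y. e = {Inr x, Inr y} \<and> u = Inr x \<and> x \<noteq> y \<and> x \<in> P \<and> y \<in> P"
  proof (cases "u = Inr p")
    case True
    thus ?thesis using pq Inr_node by blast
  next
    case False
    hence "u = Inr q" using e(3) pq(1) by auto
    moreover have "e = {Inr q, Inr p}" using pq(1) by auto
    ultimately show ?thesis using pq Inr_node by blast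
  qed
  then obtain x y where xy: "e = {Inr x, Inr y}" "u = Inr x" "x \<noteq> y" "x \<in> P" "y \<in> P" by blast
  have sub: "leaf (tree_of A) ` leaves \<subseteq> nodes (tree_of A)" unfolding tree_of_simps using Inl_node by auto
  have B: "B = {l \<in> leaves. between ext (Inl l) (Inr x) (Inr y)}"
    unfolding e(2) xy(1,2) using T.side_eq[OF _ sub, of "Inr x" "Inr y"] pq(5) xy(1) tree_of_simps by simp
  have btw: "between ext (Inl l) (Inr x) (Inr y) \<longleftrightarrow> between hd (label_base A l) x y" if "l \<in> leaves" for l
    using between_ext_Inr[OF Inl_points[OF that] Inr_points[OF xy(5)] _ xy(4)] by simp
  obtain i where i: "i < n" "between hd (column i) x y" using leaves_beyond(1)[OF xy(4,5,3)] by blast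
  obtain j where j: "j < r" "between hd (base j) x y" using leaves_beyond(2)[OF xy(4,5,3)] by blast
  have "Unprimed i \<in> B" "Primed j \<in> B"
    unfolding B using btw i j label_base_simps unfolding labels_def by auto
  thus ?thesis by blast
qed

lemma tree_of_len_pos:
  assumes "e \<in> internal_edges (tree_of A)"
  shows "0 < len (tree_of A) e"
proof -
  obtain p q where pq: "e = {Inr p, Inr q}" "Inr p \<in> tree_nodes A" "Inr q \<in> tree_nodes A" "p \<noteq> q"
    using internal_edge_cases[OF assms] by blast
  thus ?thesis using tree_of_len[of p q] hd_pos[of p q] Inr_node by simp
qed

lemma ext_leaves: "ext (Inl k) (Inl l) = (if k = l then 0 else 2 + hd (label_base A k) (label_base A l))"
  using ext_neq[of "Inl k" "Inl l"] offset_simps ext_self by simp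

end

section \<open>Fixed points of an involution\<close>

lemma cell_single: "x \<in> cell {v} \<longleftrightarrow> x v = 1 \<and> (\<forall>u. u \<noteq> v \<longrightarrow> x u = 0)"
  unfolding cell_def by (auto, metis order_refl zero_le_one)

lemma cell_pair:
  assumes "u \<noteq> v"
  shows "x \<in> cell {u, v} \<longleftrightarrow>
    0 \<le> x u \<and> 0 \<le> x v \<and> x u + x v = 1 \<and> (\<forall>w. w \<noteq> u \<and> w \<noteq> v \<longrightarrow> x w = 0)"
proof -
  have "(\<Sum>w\<in>{u, v}. x w) = x u + x v" using assms by simp
  moreover have "0 \<le> x w" if "0 \<le> x u" "0 \<le> x v" "\<forall>w. w \<noteq> u \<and> w \<noteq> v \<longrightarrow> x w = 0" for w
    using that by (cases "w = u \<or> w = v") auto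
  ultimately show ?thesis unfolding cell_def mem_Collect_eq by auto
qed

text \<open>A path in a tree has no chords.\<close>

lemma (in metric_tree) path_adjacent:
  assumes "is_path T vs" "u \<in> set vs" "v \<in> set vs" "{u, v} \<in> edges T"
  shows "\<exists>k. Suc k < length vs \<and> {vs ! k, vs ! Suc k} = {u, v}"
  using assms(1-3)
proof (induction rule: is_path_induct)
  case (single x)
  thus ?case using edge_nodes(3)[OF assms(4)] by auto
next
  case (Cons x y zs)
  have p: "is_path T (x # y # zs)" using Cons.hyps by (simp add: is_path_Cons_Cons)
  have first: "w = y" if w: "w \<in> set (y # zs)" "{x, w} \<in> edges T" for w
  proof -
    have n: "last (y # zs) \<in> nodes T" "w \<in> nodes T" "y \<in> nodes T"
      using is_path_last[OF p] edge_nodes(2)[OF w(2)] edge_nodes(2)[OF Cons.hyps(2)] by simp_all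
    have "between d x y (last (y # zs))" using path_first_between[OF p refl] by simp
    moreover have "between d x w (last (y # zs))" using path_between[OF p, of w] w(1) by simp
    ultimately have "between d x y w \<or> between d x w y"
      using between_linear[OF Cons.hyps(1) n(1,3,2)] by simp
    thus ?thesis
      using edge_between[OF w(2) n(3)] edge_between[OF Cons.hyps(2) n(2)]
        edge_nodes(3)[OF w(2)] edge_nodes(3)[OF Cons.hyps(2)] by metis
  qed
  consider "u = x" "v \<in> set (y # zs)" | "v = x" "u \<in> set (y # zs)" | "u \<in> set (y # zs)" "v \<in> set (y # zs)"
    using Cons.prems edge_nodes(3)[OF assms(4)] by auto
  thus ?case
  proof cases
    case 1
    hence "v = y" using first assms(4) by simp
    thus ?thesis using 1(1) by (intro exI[of _ 0]) simp
  next
    case 2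
    hence "u = y" using first assms(4) by (simp add: insert_commute)
    thus ?thesis using 2(1) by (intro exI[of _ 0]) (simp add: insert_commute)
  next
    case 3
    obtain k where "Suc k < length (y # zs)" "{(y # zs) ! k, (y # zs) ! Suc k} = {u, v}"
      using Cons.IH[OF 3] by blast
    thus ?thesis by (intro exI[of _ "Suc k"]) simp
  qed
qed

lemma (in metric_tree) separated_by_leaves:
  assumes "u \<in> nodes T" "v \<in> nodes T"
    and "\<And>x. x \<in> nodes T \<Longrightarrow> degree T x = 1 \<Longrightarrow> d u x = d v x"
  shows "u = v"
proof (rule ccontr)
  assume neq: "u \<noteq> v"
  obtain x where x: "x \<in> nodes T" "degree T x = 1" "between d u v x"
    using leaf_beyond[OF assms(1,2) neq] by blast
  show False
    using x(3) assms(3)[OF x(1,2)] dist_pos[OF assms(1,2) neq] unfolding between_def by simp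
qed

lemma (in tree_metric) dist_through_tripod:
  assumes "m \<in> M" "a \<in> M" "b \<in> M" "x \<in> M" "y \<in> M" "between d m a x" "between d m b y" "between d a m b"
    "a \<noteq> m" "b \<noteq> m"
  shows "d x y = d a x + d a m + d m b + d b y"
proof -
  have xam: "between d x a m" using between_sym[OF assms(1,4,2)] assms(6) by simp
  have "between d x m b" using between_concat(2)[OF assms(4,3,2,1) xam assms(8,9)] .
  hence "between d x m y" using between_concat(1)[OF assms(4,5,1,3) _ assms(7)] assms(10) by blast
  thus ?thesis
    using assms(6,7) dist_sym[OF assms(4,1)] dist_sym[OF assms(1,2)] unfolding between_def by linarith
qed

locale tree_involution = metric_tree T d
  for T :: "('v, 'm) ltree_scheme" and d :: "'v \<Rightarrow> 'v \<Rightarrow> real" +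
  fixes \<sigma> :: "'v \<Rightarrow> 'v"
  assumes sigma_node: "v \<in> nodes T \<Longrightarrow> \<sigma> v \<in> nodes T"
    and sigma_dist: "u \<in> nodes T \<Longrightarrow> v \<in> nodes T \<Longrightarrow> d (\<sigma> u) (\<sigma> v) = d u v"
    and sigma_sigma: "v \<in> nodes T \<Longrightarrow> \<sigma> (\<sigma> v) = v"
begin

definition fixed_nodes :: "'v set" where
  "fixed_nodes = {v \<in> nodes T. \<sigma> v = v}"

lemma sigma_between:
  assumes "a \<in> nodes T" "b \<in> nodes T" "x \<in> nodes T"
  shows "between d (\<sigma> a) (\<sigma> x) (\<sigma> b) \<longleftrightarrow> between d a x b"
  unfolding between_def using sigma_dist assms by simp

text \<open>The image of \<open>x\<close> lies on the same segment at the same distance from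
  \<open>a\<close>.\<close>

lemma fixed_between:
  assumes "a \<in> fixed_nodes" "b \<in> fixed_nodes" "x \<in> nodes T" "between d a x b"
  shows "x \<in> fixed_nodes"
proof -
  have ab: "a \<in> nodes T" "b \<in> nodes T" "\<sigma> a = a" "\<sigma> b = b" using assms(1,2) unfolding fixed_nodes_def by auto
  have sx: "\<sigma> x \<in> nodes T" using sigma_node assms(3) .
  have "between d a (\<sigma> x) b" using sigma_between[OF ab(1,2) assms(3)] ab assms(4) by simp
  moreover have "d a (\<sigma> x) = d a x" using sigma_dist[OF ab(1) assms(3)] ab(3) by simp
  ultimately have "\<sigma> x = x"
    using between_linear[OF ab(1,2) assms(3) sx assms(4)] dist_zero[OF assms(3) sx] dist_zero[OF sx assms(3)]
    unfolding between_def by auto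
  thus ?thesis unfolding fixed_nodes_def using assms(3) by simp
qed

lemma sigma_inj: "u \<in> nodes T \<Longrightarrow> v \<in> nodes T \<Longrightarrow> \<sigma> u = \<sigma> v \<Longrightarrow> u = v"
  using sigma_sigma by metis

text \<open>The involution preserves the set of nodes with positive coordinate; so an edge with the
  point in its interior has both ends fixed or is flipped.\<close>

lemma fixed_point_cases:
  assumes "x \<in> fixed_points T \<sigma>"
  obtains v where "v \<in> fixed_nodes" "x \<in> cell {v}"
    | u v where "{u, v} \<in> edges T" "u \<in> fixed_nodes" "v \<in> fixed_nodes" "x \<in> cell {u, v}"
    | u v where "{u, v} \<in> edges T" "\<sigma> u = v" "x \<in> cell {u, v}"
proof -
  have inv: "x (\<sigma> v) = x v" if "v \<in> nodes T" for v using assms that unfolding fixed_points_def by simp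
  have node: "v \<in> fixed_nodes" if v: "v \<in> nodes T" "x \<in> cell {v}" for v
  proof -
    have "x (\<sigma> v) = 1" using inv[OF v(1)] v(2) by (simp add: cell_single)
    hence "\<sigma> v = v" using v(2) unfolding cell_single by (metis zero_neq_one)
    thus ?thesis using v(1) unfolding fixed_nodes_def by simp
  qed
  have "(\<exists>v\<in>nodes T. x \<in> cell {v}) \<or> (\<exists>e\<in>edges T. x \<in> cell e)"
    using assms unfolding fixed_points_def tree_points_def by blast
  thus ?thesis
  proof
    assume "\<exists>v\<in>nodes T. x \<in> cell {v}"
    thus ?thesis using node that(1) by blast
  next
    assume "\<exists>e\<in>edges T. x \<in> cell e"
    then obtain e where e: "e \<in> edges T" "x \<in> cell e" by blast
    obtain u v where uv: "e = {u, v}" "u \<in> nodes T" "v \<in> nodes T" "u \<noteq> v" using edgeE[OF e(1)] by blast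
    have c: "0 \<le> x u" "0 \<le> x v" "x u + x v = 1" "\<And>w. w \<noteq> u \<Longrightarrow> w \<noteq> v \<Longrightarrow> x w = 0"
      using e(2) cell_pair[OF uv(4), of x] unfolding uv(1) by auto
    consider "x u = 0" | "x v = 0" | "0 < x u" "0 < x v" using c by linarith
    thus ?thesis
    proof cases
      case 1
      have "x w = 0" if "w \<noteq> v" for w using c(4)[of w] 1 that by (cases "w = u") auto
      hence "x \<in> cell {v}" unfolding cell_single using 1 c(3) by simp
      thus ?thesis using node[OF uv(3)] that(1) by blast
    next
      case 2
      have "x w = 0" if "w \<noteq> u" for w using c(4)[of w] 2 that by (cases "w = v") auto
      hence "x \<in> cell {u}" unfolding cell_single using 2 c(3) by simp
      thus ?thesis using node[OF uv(2)] that(1) by blast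
    next
      case 3
      have su: "\<sigma> u = u \<or> \<sigma> u = v" using inv[OF uv(2)] 3(1) c(4)[of "\<sigma> u"] by force
      have sv: "\<sigma> v = u \<or> \<sigma> v = v" using inv[OF uv(3)] 3(2) c(4)[of "\<sigma> v"] by force
      show ?thesis
      proof (cases "\<sigma> u = u")
        case True
        hence "\<sigma> v = v" using sv sigma_inj[OF uv(2,3)] uv(4) by auto
        hence "u \<in> fixed_nodes" "v \<in> fixed_nodes" using True uv unfolding fixed_nodes_def by auto
        thus ?thesis using that(2)[of u v] e uv(1) by blast
      next
        case False
        thus ?thesis using that(3)[of u v] su e uv(1) by blast
      qed
    qed
  qed
qed

text \<open>A fixed node is equally far from both ends of a flipped edge, whereas every node is
  strictly nearer to one end of any given edge.\<close>

lemma no_flip: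
  assumes "w \<in> fixed_nodes" "{u, v} \<in> edges T"
  shows "\<sigma> u \<noteq> v"
proof
  assume uv: "\<sigma> u = v"
  have n: "u \<in> nodes T" "v \<in> nodes T" "u \<noteq> v" "w \<in> nodes T" "\<sigma> w = w"
    using edge_nodes[OF assms(2)] assms(1) unfolding fixed_nodes_def by auto
  have "d w v = d w u" using sigma_dist[OF n(4,1)] uv n(5) by simp
  moreover have "0 < d u v" "0 < d v u" using dist_pos n by auto
  ultimately show False using edge_dichotomy[OF assms(2) n(4)] unfolding between_def by linarith
qed

lemma fixed_cell:
  assumes "u \<in> fixed_nodes" "v \<in> fixed_nodes" "{u, v} \<in> edges T \<or> u = v" "x \<in> cell {u, v}"
  shows "x \<in> fixed_points T \<sigma>"
proof -
  have n: "u \<in> nodes T" "v \<in> nodes T" "\<sigma> u = u" "\<sigma> v = v" using assms(1,2) unfolding fixed_nodes_def by auto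
  have zero: "x w = 0" if "w \<notin> {u, v}" for w using assms(4) that unfolding cell_def by blast
  have "x (\<sigma> w) = x w" if w: "w \<in> nodes T" for w
  proof (cases "w \<in> {u, v}")
    case True
    thus ?thesis using n by auto
  next
    case False
    hence "\<sigma> w \<notin> {u, v}" using sigma_sigma[OF w] n by auto
    thus ?thesis using zero False by simp
  qed
  moreover have "x \<in> tree_points T" using assms(3,4) n unfolding tree_points_def by auto
  ultimately show ?thesis unfolding fixed_points_def by blast
qed

text \<open>Two fixed nodes at maximal distance are joined by a path of fixed nodes, and by
  collinearity every other fixed node lies between them.\<close>

lemma forms_path_fixed_node:
  assumes "fixed_nodes \<noteq> {}"
    and collinear: "\<And>a b c. a \<in> fixed_nodes \<Longrightarrow> b \<in> fixed_nodes \<Longrightarrow> c \<in> fixed_nodes \<Longrightarrow>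
      between d a b c \<or> between d b c a \<or> between d c a b"
  shows "forms_path T (fixed_points T \<sigma>)"
proof -
  have sub: "fixed_nodes \<subseteq> nodes T" unfolding fixed_nodes_def by auto
  hence fin: "finite fixed_nodes" using finite_nodes finite_subset by blast
  let ?D = "(\<lambda>(a, b). d a b) ` (fixed_nodes \<times> fixed_nodes)"
  have D: "finite ?D" "?D \<noteq> {}" using fin assms(1) by auto
  obtain a b where ab: "a \<in> fixed_nodes" "b \<in> fixed_nodes" "Max ?D = d a b" using Max_in[OF D] by auto
  have max: "d x y \<le> d a b" if "x \<in> fixed_nodes" "y \<in> fixed_nodes" for x y
    unfolding ab(3)[symmetric] using that by (intro Max_ge[OF D(1)] image_eqI[of _ _ "(x, y)"]) simp_all
  have abn: "a \<in> nodes T" "b \<in> nodes T" using ab sub by auto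
  obtain vs where vs: "is_path T vs" "hd vs = a" "last vs = b" using path_exists[OF abn] by blast
  have "x \<in> set vs" if x: "x \<in> fixed_nodes" for x
  proof -
    have xn: "x \<in> nodes T" using x sub by auto
    have "between d a x b"
      using collinear[OF ab(1) x ab(2)]
    proof (elim disjE)
      assume "between d x b a"
      hence "d x b \<le> 0" using max[OF x ab(1)] dist_sym[OF abn] unfolding between_def by linarith
      hence "x = b" using dist_zero[OF xn abn(2)] by simp
      thus ?thesis using between_right[OF abn(2)] by simp
    next
      assume "between d b a x"
      hence "d a x \<le> 0" using max[OF ab(2) x] dist_sym[OF abn] unfolding between_def by linarith
      hence "a = x" using dist_zero[OF abn(1) xn] by simp
      thus ?thesis using between_left[OF abn(1)] by simp
    qed
    thus ?thesis using between_in_path[OF vs(1) xn] vs by simp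
  qed
  moreover have "x \<in> fixed_nodes" if x: "x \<in> set vs" for x
    using fixed_between[OF ab(1,2)] path_between[OF vs(1) x] is_path_set[OF vs(1)] x vs by auto
  ultimately have set_vs: "set vs = fixed_nodes" by blast
  have "fixed_points T \<sigma> = path_points vs"
  proof (intro equalityI subsetI)
    fix x assume "x \<in> fixed_points T \<sigma>"
    thus "x \<in> path_points vs"
    proof (cases rule: fixed_point_cases)
      case (1 v)
      thus ?thesis unfolding path_points_def set_vs by blast
    next
      case (2 u v)
      obtain k where k: "Suc k < length vs" "{vs ! k, vs ! Suc k} = {u, v}"
        using path_adjacent[OF vs(1) _ _ 2(1)] 2(2,3) set_vs by blast
      hence "x \<in> cell {vs ! k, vs ! Suc k}" using 2(4) by simp
      thus ?thesis using k(1) unfolding path_points_def by blast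
    next
      case (3 u v)
      thus ?thesis using no_flip[OF ab(1) 3(1)] by blast
    qed
  next
    fix x assume "x \<in> path_points vs"
    hence "(\<exists>v\<in>fixed_nodes. x \<in> cell {v}) \<or> (\<exists>k. Suc k < length vs \<and> x \<in> cell {vs ! k, vs ! Suc k})"
      unfolding path_points_def set_vs by simp
    then consider v where "v \<in> fixed_nodes" "x \<in> cell {v}"
      | k where "Suc k < length vs" "x \<in> cell {vs ! k, vs ! Suc k}"
      by blast
    thus "x \<in> fixed_points T \<sigma>"
    proof cases
      case (1 v)
      thus ?thesis using fixed_cell[of v v x] by simp
    next
      case (2 k)
      have "vs ! k \<in> set vs" "vs ! Suc k \<in> set vs" "{vs ! k, vs ! Suc k} \<in> edges T"
        using 2(1) vs(1) unfolding is_path_def by auto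
      thus ?thesis using fixed_cell[of "vs ! k" "vs ! Suc k" x] 2(2) set_vs by blast
    qed
  qed
  thus ?thesis unfolding forms_path_def using vs(1) by blast
qed

text \<open>Choose a node with least displacement. If its neighbour towards the image were not the
  image itself, that neighbour would be displaced less.\<close>

lemma flipped_edge_exists:
  assumes "fixed_nodes = {}"
  obtains u where "{u, \<sigma> u} \<in> edges T"
proof -
  have "finite ((\<lambda>v. d v (\<sigma> v)) ` nodes T)" "(\<lambda>v. d v (\<sigma> v)) ` nodes T \<noteq> {}"
    using finite_nodes nodes_nonempty by auto
  hence "Min ((\<lambda>v. d v (\<sigma> v)) ` nodes T) \<in> (\<lambda>v. d v (\<sigma> v)) ` nodes T"
    "\<And>y. y \<in> (\<lambda>v. d v (\<sigma> v)) ` nodes T \<Longrightarrow> Min ((\<lambda>v. d v (\<sigma> v)) ` nodes T) \<le> y" by simp_all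
  then obtain v where v: "v \<in> nodes T" and min: "\<And>w. w \<in> nodes T \<Longrightarrow> d v (\<sigma> v) \<le> d w (\<sigma> w)" by fastforce
  have sv: "\<sigma> v \<in> nodes T" "v \<noteq> \<sigma> v" using sigma_node[OF v] assms v unfolding fixed_nodes_def by auto
  obtain u where u: "u \<in> nodes T" "{v, u} \<in> edges T" "between d v u (\<sigma> v)"
    using neighbour_towards[OF v sv] by blast
  have su: "\<sigma> u \<in> nodes T" using sigma_node[OF u(1)] .
  have "u = \<sigma> v"
  proof (rule ccontr)
    assume neq: "u \<noteq> \<sigma> v"
    have "between d (\<sigma> v) (\<sigma> u) v" using sigma_between[OF v sv(1) u(1)] sigma_sigma[OF v] u(3) by simp
    hence b: "between d v (\<sigma> u) (\<sigma> v)" using between_sym[OF v sv(1) su] by simp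
    have eq: "d v u + d u (\<sigma> v) = d v (\<sigma> v)" "d v (\<sigma> u) + d (\<sigma> u) (\<sigma> v) = d v (\<sigma> v)" "d (\<sigma> u) (\<sigma> v) = d u v"
      "d u v = d v u" "d (\<sigma> u) u = d u (\<sigma> u)"
      using u(3) b sigma_dist[OF u(1) v] dist_sym[OF u(1) v] dist_sym[OF su u(1)] unfolding between_def by simp_all
    have pos: "0 < d v u" "0 < d u (\<sigma> v)"
      using dist_pos[OF v u(1)] dist_pos[OF u(1) sv(1) neq] edge_nodes(3)[OF u(2)] by simp_all
    have "between d v u (\<sigma> u) \<or> between d v (\<sigma> u) u" using between_linear[OF v sv(1) u(1) su u(3) b] .
    thus False using eq pos min[OF u(1)] unfolding between_def by linarith
  qed
  thus ?thesis using that[of v] u(2) by simp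
qed

text \<open>Seen from \<open>w\<close> one end of the first edge is nearer, seen from
  \<open>\<sigma> w\<close> the other. So both ends lie on the segment from \<open>w\<close> to
  \<open>\<sigma> w\<close>, which contains no further node.\<close>

lemma flipped_edge_unique:
  assumes "{u, \<sigma> u} \<in> edges T" "{w, \<sigma> w} \<in> edges T"
  shows "{w, \<sigma> w} = {u, \<sigma> u}"
proof -
  have aux: "{w, \<sigma> w} = {u, \<sigma> u}"
    if e: "{u, \<sigma> u} \<in> edges T" "{w, \<sigma> w} \<in> edges T" "between d w u (\<sigma> u)" for u
  proof -
    note n = edge_nodes[OF e(1)] edge_nodes[OF e(2)]
    have "between d (\<sigma> w) (\<sigma> u) u" using sigma_between[OF n(4,2,1)] sigma_sigma[OF n(1)] e(3) by simp
    hence "between d u (\<sigma> u) (\<sigma> w)" using between_sym[OF n(5,1,2)] by simp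
    hence "between d w u (\<sigma> w)" "between d w (\<sigma> u) (\<sigma> w)"
      using between_concat[OF n(4,5,1,2) e(3) _ n(3)] by simp_all
    hence "u = w \<or> u = \<sigma> w" "\<sigma> u = w \<or> \<sigma> u = \<sigma> w"
      using edge_between[OF e(2) n(1)] edge_between[OF e(2) n(2)] by simp_all
    thus ?thesis using n(3) by auto
  qed
  note n = edge_nodes[OF assms(1)] edge_nodes[OF assms(2)]
  have "between d w u (\<sigma> u) \<or> between d w (\<sigma> u) u" by (rule edge_dichotomy[OF assms(1) n(4)])
  thus ?thesis
  proof
    assume "between d w (\<sigma> u) u"
    hence "{w, \<sigma> w} = {\<sigma> u, \<sigma> (\<sigma> u)}"
      using aux[of "\<sigma> u"] assms sigma_sigma[OF n(1)] by (simp add: insert_commute)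
    thus ?thesis using sigma_sigma[OF n(1)] by auto
  qed (rule aux[OF assms])
qed

lemma forms_path_flipped_edge:
  assumes "fixed_nodes = {}"
  shows "forms_path T (fixed_points T \<sigma>)"
proof -
  obtain u where u: "{u, \<sigma> u} \<in> edges T" using flipped_edge_exists[OF assms] by blast
  note n = edge_nodes[OF u]
  define m where "m w = (if w = u \<or> w = \<sigma> u then 1 / 2 else 0 :: real)" for w
  have mc: "m \<in> cell {u, \<sigma> u}" unfolding cell_pair[OF n(3)] m_def using n(3) by simp
  have mT: "m \<in> tree_points T" using mc u unfolding tree_points_def by blast
  have "m (\<sigma> v) = m v" if v: "v \<in> nodes T" for v
  proof -
    have "\<sigma> v = u \<longleftrightarrow> v = \<sigma> u" "\<sigma> v = \<sigma> u \<longleftrightarrow> v = u"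
      using sigma_sigma[OF v] sigma_sigma[OF n(1)] sigma_inj[OF v n(1)] by auto
    thus ?thesis unfolding m_def by simp
  qed
  hence mF: "m \<in> fixed_points T \<sigma>" unfolding fixed_points_def using mT by blast
  have "x = m" if x: "x \<in> fixed_points T \<sigma>" for x
    using x
  proof (cases rule: fixed_point_cases)
    case (3 w w')
    have eq: "{w, w'} = {u, \<sigma> u}" using flipped_edge_unique[OF u, of w] 3(1,2) by simp
    hence "x \<in> cell {u, \<sigma> u}" using 3(3) by simp
    moreover have "x (\<sigma> u) = x u" using x n(1) unfolding fixed_points_def by simp
    ultimately show ?thesis unfolding cell_pair[OF n(3)] m_def by (intro ext) auto
  qed (use assms in auto)
  hence "fixed_points T \<sigma> = {m}" using mF by blast
  thus ?thesis unfolding forms_path_def using mT by blast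
qed

end

section \<open>The tree of a symmetric matrix is symbic\<close>

lemma swap_swap [simp]: "swap_label (swap_label l) = l"
  by (cases l) simp_all

lemma swap_label_eq_iff: "swap_label k = swap_label l \<longleftrightarrow> k = l"
  by (metis swap_swap)

lemma swap_label_labels: "swap_label l \<in> labels n n \<longleftrightarrow> l \<in> labels n n"
  unfolding labels_def by (cases l) auto

lemma bij_swap_label: "bij_betw swap_label (labels n n) (labels n n)"
proof (rule bij_betw_imageI)
  show "inj_on swap_label (labels n n)" by (simp add: inj_on_def swap_label_eq_iff)
  show "swap_label ` labels n n = labels n n"
    using swap_label_labels by (metis (no_types, lifting) image_subset_iff subsetI subset_antisym imageI swap_swap)
qed

lemma labels_cases:
  assumes "l \<in> labels n r"
  obtains i where "l = Unprimed i" "i < n" | j where "l = Primed j" "j < r"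
  using assms unfolding labels_def by auto

lemma image_times_swap: "(\<lambda>(k, l). f k l) ` (X \<times> X) = (\<lambda>(k, l). f l k) ` (X \<times> X)"
  by (auto simp: image_iff)

locale symmetric_hull = trop_hull A n n for A n +
  assumes sym: "i < n \<Longrightarrow> j < n \<Longrightarrow> A $$ (i, j) = A $$ (j, i)"
begin

text \<open>The formulas \<open>column_max_dist\<close> and \<open>base_base_dist\<close> are
  transposes of each other.\<close>

lemma column_dist_base: 
  assumes "i < n" "k < n"
  shows "hd (column i) (column k) = hd (base i) (base k)"
  unfolding column_max_dist[OF assms] base_base_dist[OF assms]
  by (rule arg_cong[where f=Max], rule image_cong) (use sym assms in auto)

lemma column_base_dist_swap: 
  assumes "i < n" "j < n"
  shows "hd (column i) (base j) = hd (column j) (base i)"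
proof -
  have "(\<lambda>(l, k). A $$ (l, i) - A $$ (l, k) + A $$ (j, k) - A $$ (j, i)) ` ({..<n} \<times> {..<n}) =
    (\<lambda>(k, l). A $$ (l, i) - A $$ (l, k) + A $$ (j, k) - A $$ (j, i)) ` ({..<n} \<times> {..<n})"
    by (rule image_times_swap)
  also have "\<dots> = (\<lambda>(l, k). A $$ (l, j) - A $$ (l, k) + A $$ (i, k) - A $$ (i, j)) ` ({..<n} \<times> {..<n})"
    by (rule image_cong) (use sym assms in auto)
  finally show ?thesis unfolding column_base_dist[OF assms] column_base_dist[OF assms(2,1)] by simp
qed

lemma label_dist_swap:
  assumes "k \<in> leaves" "l \<in> leaves"
  shows "hd (label_base A (swap_label k)) (label_base A (swap_label l)) = hd (label_base A k) (label_base A l)"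
  using assms(1)
proof (cases rule: labels_cases)
  case k: (1 i)
  from assms(2) show ?thesis
  proof (cases rule: labels_cases)
    case l: (1 j)
    thus ?thesis using k label_base_simps column_dist_base by simp
  next
    case l: (2 j)
    thus ?thesis using k label_base_simps column_base_dist_swap[of i j] hd_sym[OF base_hull column_hull] by simp
  qed
next
  case k: (2 i)
  from assms(2) show ?thesis
  proof (cases rule: labels_cases)
    case l: (1 j)
    thus ?thesis using k label_base_simps column_base_dist_swap[of i j] hd_sym[OF base_hull column_hull] by simp
  next
    case l: (2 j)
    thus ?thesis using k label_base_simps column_dist_base by simp
  qed
qed

lemma ext_swap:
  assumes "k \<in> leaves" "l \<in> leaves"
  shows "ext (Inl k) (Inl l) = ext (Inl (swap_label k)) (Inl (swap_label l))"
  unfolding ext_leaves using label_dist_swap[OF assms] swap_label_eq_iff by simp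

text \<open>Leaf distances are invariant under \<open>swap_label\<close>, so the reconstruction
  applies to the tree and itself. The square of the resulting isometry fixes all leaves and is the
  identity by \<open>separated_by_leaves\<close>.\<close>

lemma involution_exists:
  "\<exists>\<sigma>. ltree_iso_map leaves (tree_of A) (tree_of A) swap_label \<sigma> \<and> tree_involution (tree_of A) ext \<sigma>"
proof -
  have "Unprimed 0 \<in> leaves" unfolding labels_def using n by simp
  hence ne: "leaves \<noteq> {}" by blast
  have "\<exists>\<sigma>. ltree_iso_map leaves (tree_of A) (tree_of A) swap_label \<sigma> \<and>
    (\<forall>u\<in>nodes (tree_of A). \<forall>v\<in>nodes (tree_of A). ext (\<sigma> u) (\<sigma> v) = ext u v)"
    by (rule ltree_iso_map_exists[OF tree_of_realized tree_of_realized tree_of_leaf_labelled tree_of_leaf_labelled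
        bij_swap_label _ ne]) (simp add: tree_of_simps ext_swap)
  then obtain \<sigma> where s: "ltree_iso_map leaves (tree_of A) (tree_of A) swap_label \<sigma>"
    and iso: "\<And>u v. u \<in> tree_nodes A \<Longrightarrow> v \<in> tree_nodes A \<Longrightarrow> ext (\<sigma> u) (\<sigma> v) = ext u v"
    unfolding tree_of_simps by blast
  have bij: "bij_betw \<sigma> (tree_nodes A) (tree_nodes A)"
    and leaf: "\<And>l. l \<in> leaves \<Longrightarrow> \<sigma> (Inl l) = Inl (swap_label l)"
    using s unfolding ltree_iso_map_def tree_of_simps by simp_all
  have node: "\<sigma> v \<in> tree_nodes A" if "v \<in> tree_nodes A" for v using bij_betw_apply[OF bij that] .
  have "tree_involution (tree_of A) ext \<sigma>"
  proof (intro tree_involution.intro tree_involution_axioms.intro tree_of_metric)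
    fix v assume v: "v \<in> nodes (tree_of A)"
    show "\<sigma> (\<sigma> v) = v"
    proof (rule T.separated_by_leaves)
      show "\<sigma> (\<sigma> v) \<in> nodes (tree_of A)" "v \<in> nodes (tree_of A)" using v node unfolding tree_of_simps by auto
      fix x assume x: "x \<in> nodes (tree_of A)" "degree (tree_of A) x = 1"
      from x(1) have "\<exists>l. x = Inl l \<and> l \<in> leaves"
        unfolding tree_of_simps by (cases rule: node_cases) (use x(2) in auto)
      then obtain l where l: "x = Inl l" "l \<in> leaves" by blast
      have "\<sigma> (\<sigma> x) = x" using l leaf swap_label_labels by simp
      hence "ext (\<sigma> (\<sigma> v)) x = ext (\<sigma> (\<sigma> v)) (\<sigma> (\<sigma> x))" by simp
      also have "\<dots> = ext v x" using iso node v x(1) unfolding tree_of_simps by simp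
      finally show "ext (\<sigma> (\<sigma> v)) x = ext v x" .
    qed
  qed (use node iso in \<open>simp_all add: tree_of_simps\<close>)
  thus ?thesis using s by blast
qed

end

locale symmetric_rank2 = symmetric_hull A n for A n +
  assumes beaten: "off_diagonal_beaten n (\<lambda>i j. A $$ (i, j))"
begin

text \<open>Leaves beyond three fixed nodes that branch from a common point give a principal minor in
  which the product of the off-diagonal entries is the only minimal monomial.\<close>

lemma fixed_nodes_collinear:
  assumes \<sigma>: "ltree_iso_map leaves (tree_of A) (tree_of A) swap_label \<sigma>" "tree_involution (tree_of A) ext \<sigma>"
    and abc: "a \<in> tree_involution.fixed_nodes (tree_of A) \<sigma>" "b \<in> tree_involution.fixed_nodes (tree_of A) \<sigma>"
      "c \<in> tree_involution.fixed_nodes (tree_of A) \<sigma>"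
  shows "between ext a b c \<or> between ext b c a \<or> between ext c a b"
proof (rule ccontr)
  assume neg: "\<not> ?thesis"
  interpret I: tree_involution "tree_of A" ext \<sigma> by (rule \<sigma>(2))
  have leaf: "\<And>l. l \<in> leaves \<Longrightarrow> \<sigma> (Inl l) = Inl (swap_label l)"
    using \<sigma>(1) unfolding ltree_iso_map_def tree_of_simps by simp
  have N: "a \<in> nodes (tree_of A)" "b \<in> nodes (tree_of A)" "c \<in> nodes (tree_of A)"
    using abc unfolding I.fixed_nodes_def by auto
  obtain m where m: "m \<in> nodes (tree_of A)" "between ext a m b" "between ext b m c" "between ext a m c"
    using T.median[OF N] by blast
  have mF: "m \<in> I.fixed_nodes" using I.fixed_between[OF abc(1,2) m(1,2)] .
  have neq: "a \<noteq> m" "b \<noteq> m" "c \<noteq> m"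
    using neg m(2-4) T.between_sym[OF N(1,2) m(1)] T.between_sym[OF N(2,3) m(1)] T.between_sym[OF N(1,3) m(1)] by auto
  \<comment> \<open>A leaf beyond the fixed node \<open>x\<close> and its mirror image are both
    beyond \<open>x\<close>, at the same distance; so it is immaterial which colour
    \<open>leaf_beyond\<close> returns.\<close>
  have beyond: "\<exists>i<n. between ext m x (Inl (Unprimed i)) \<and> between ext m x (Inl (Primed i)) \<and>
      ext x (Inl (Primed i)) = ext x (Inl (Unprimed i))"
    if x: "x \<in> I.fixed_nodes" "x \<noteq> m" for x
  proof -
    have xn: "x \<in> nodes (tree_of A)" "\<sigma> x = x" "\<sigma> m = m" using x mF unfolding I.fixed_nodes_def by auto
    obtain y where y: "y \<in> nodes (tree_of A)" "degree (tree_of A) y = 1" "between ext m x y"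
      using T.leaf_beyond[OF m(1) xn(1) x(2)[symmetric]] by blast
    from y(1) have "\<exists>l. y = Inl l \<and> l \<in> leaves"
      unfolding tree_of_simps by (cases rule: node_cases) (use y(2) in auto)
    then obtain l where l: "y = Inl l" "l \<in> leaves" by blast
    have sy: "\<sigma> y = Inl (swap_label l)" using leaf l by simp
    have "between ext (\<sigma> m) (\<sigma> x) (\<sigma> y)" using I.sigma_between[OF m(1) y(1) xn(1)] y(3) by simp
    hence b: "between ext m x (Inl (swap_label l))" using xn sy by simp
    have d: "ext x (Inl (swap_label l)) = ext x (Inl l)"
      using I.sigma_dist[OF xn(1) y(1)] xn(2) sy l(1) by simp
    from l(2) show ?thesis
    proof (cases rule: labels_cases)
      case (1 i)
      thus ?thesis using b d y(3) l(1) by auto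
    next
      case (2 j)
      thus ?thesis using b d y(3) l(1) by (intro exI[of _ j]) simp
    qed
  qed
  obtain i where i: "i < n" "between ext m a (Inl (Unprimed i))" "between ext m a (Inl (Primed i))"
    "ext a (Inl (Primed i)) = ext a (Inl (Unprimed i))" using beyond[OF abc(1) neq(1)] by blast
  obtain j where j: "j < n" "between ext m b (Inl (Unprimed j))" "between ext m b (Inl (Primed j))"
    "ext b (Inl (Primed j)) = ext b (Inl (Unprimed j))" using beyond[OF abc(2) neq(2)] by blast
  obtain k where k: "k < n" "between ext m c (Inl (Unprimed k))" "between ext m c (Inl (Primed k))"
    "ext c (Inl (Primed k)) = ext c (Inl (Unprimed k))" using beyond[OF abc(3) neq(3)] by blast
  define D where "D x y = ext (Inl (Unprimed x)) (Inl (Primed y))" for x y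
  have L: "Inl (Unprimed x) \<in> nodes (tree_of A)" "Inl (Primed x) \<in> nodes (tree_of A)" if "x < n" for x
    using that unfolding tree_of_simps Inl_node labels_def by auto
  have L': "Unprimed x \<in> leaves" "Primed x \<in> leaves" if "x < n" for x
    using that unfolding labels_def by auto
  have cross: "D x y = ext p (Inl (Unprimed x)) + ext p m + ext m q + ext q (Inl (Unprimed y))"
    "Unprimed x \<noteq> Unprimed y"
    if p: "p \<in> nodes (tree_of A)" "p \<noteq> m" "between ext m p (Inl (Unprimed x))" "x < n"
    and q: "q \<in> nodes (tree_of A)" "q \<noteq> m" "between ext m q (Inl (Unprimed y))" "between ext m q (Inl (Primed y))" "y < n"
      "ext q (Inl (Primed y)) = ext q (Inl (Unprimed y))"
    and pq: "between ext p m q" for p q x y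
  proof -
    show "D x y = ext p (Inl (Unprimed x)) + ext p m + ext m q + ext q (Inl (Unprimed y))"
      unfolding D_def using T.dist_through_tripod[OF m(1) p(1) q(1) L(1)[OF p(4)] L(2)[OF q(5)] p(3) q(4) pq p(2) q(2)] q(6)
      by simp
    have "ext (Inl (Unprimed x)) (Inl (Unprimed y)) = ext p (Inl (Unprimed x)) + ext p m + ext m q + ext q (Inl (Unprimed y))"
      by (rule T.dist_through_tripod[OF m(1) p(1) q(1) L(1)[OF p(4)] L(1)[OF q(5)] p(3) q(3) pq p(2) q(2)])
    moreover have "0 < ext p m" "0 \<le> ext p (Inl (Unprimed x))" "0 \<le> ext m q" "0 \<le> ext q (Inl (Unprimed y))"
      using T.dist_pos[OF p(1) m(1) p(2)] T.dist_nonneg[OF p(1) L(1)[OF p(4)]] T.dist_nonneg[OF m(1) q(1)]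
        T.dist_nonneg[OF q(1) L(1)[OF q(5)]] by simp_all
    ultimately show "Unprimed x \<noteq> Unprimed y" using ext_self by force
  qed
  \<comment> \<open>The two leaves with index \<open>x\<close> may part only beyond
    \<open>p\<close>, hence an inequality, which suffices.\<close>
  have diag: "D x x \<le> 2 * ext p (Inl (Unprimed x))"
    if p: "p \<in> nodes (tree_of A)" "x < n" "ext p (Inl (Primed x)) = ext p (Inl (Unprimed x))" for p x
    unfolding D_def using T.triangle[OF L(1)[OF p(2)] p(1) L(2)[OF p(2)]] T.dist_sym[OF L(1)[OF p(2)] p(1)] p(3) by simp
  have Dsym: "D x y = D y x" if "x < n" "y < n" for x y
    unfolding D_def using ext_swap[OF L'(1)[OF that(1)] L'(2)[OF that(2)]] T.dist_sym[OF L(2)[OF that(1)] L(1)[OF that(2)]]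
    by simp
  obtain u v where uv: "\<forall>i<n. \<forall>j<n. A $$ (j, i) = - hd (column i) (base j) / 2 + u i + v j"
    using entry_eq_dist by blast
  have entry: "2 * A $$ (y, x) = - D x y + 2 + 2 * u x + 2 * v y" if "x < n" "y < n" for x y
    using uv[rule_format, OF that] that unfolding D_def ext_leaves by (simp add: label_base_simps)
  note ab = cross[OF N(1) neq(1) i(2,1) N(2) neq(2) j(2,3,1,4) m(2)]
  note bc = cross[OF N(2) neq(2) j(2,1) N(3) neq(3) k(2,3,1,4) m(3)]
  note ac = cross[OF N(1) neq(1) i(2,1) N(3) neq(3) k(2,3,1,4) m(4)]
  note dd = diag[OF N(1) i(1,4)] diag[OF N(2) j(1,4)] diag[OF N(3) k(1,4)]
  have pos: "0 < ext a m" "0 < ext b m" "0 < ext c m" "ext m b = ext b m" "ext m c = ext c m"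
    using T.dist_pos[OF N(1) m(1) neq(1)] T.dist_pos[OF N(2) m(1) neq(2)] T.dist_pos[OF N(3) m(1) neq(3)]
      T.dist_sym[OF m(1) N(2)] T.dist_sym[OF m(1) N(3)] by simp_all
  have E: "2 * A $$ (i, i) = - D i i + 2 + 2 * u i + 2 * v i" "2 * A $$ (j, j) = - D j j + 2 + 2 * u j + 2 * v j"
    "2 * A $$ (k, k) = - D k k + 2 + 2 * u k + 2 * v k"
    "2 * A $$ (i, j) = - D j i + 2 + 2 * u j + 2 * v i" "2 * A $$ (j, i) = - D i j + 2 + 2 * u i + 2 * v j"
    "2 * A $$ (j, k) = - D k j + 2 + 2 * u k + 2 * v j" "2 * A $$ (k, j) = - D j k + 2 + 2 * u j + 2 * v k"
    "2 * A $$ (k, i) = - D i k + 2 + 2 * u i + 2 * v k" "2 * A $$ (i, k) = - D k i + 2 + 2 * u k + 2 * v i"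
    using entry i(1) j(1) k(1) by simp_all
  have S: "A $$ (i, j) = A $$ (j, i)" "A $$ (j, k) = A $$ (k, j)" "A $$ (i, k) = A $$ (k, i)"
    "D j i = D i j" "D k j = D j k" "D k i = D i k"
    using sym Dsym i(1) j(1) k(1) by simp_all
  \<comment> \<open>In each sum every index occurs twice, so the summands \<open>u\<close> and
    \<open>v\<close> cancel. For the distances, the three crossing terms together exceed each of the
    other four sums by at least twice a leg of the tripod.\<close>
  have "A $$ (i, i) + A $$ (j, j) + A $$ (k, k) \<le> A $$ (i, j) + A $$ (j, k) + A $$ (k, i) \<or>
    A $$ (i, i) + 2 * A $$ (j, k) \<le> A $$ (i, j) + A $$ (j, k) + A $$ (k, i) \<or>
    A $$ (j, j) + 2 * A $$ (i, k) \<le> A $$ (i, j) + A $$ (j, k) + A $$ (k, i) \<or>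
    A $$ (k, k) + 2 * A $$ (i, j) \<le> A $$ (i, j) + A $$ (j, k) + A $$ (k, i)"
    using beaten i(1) j(1) k(1) ab(2) bc(2) ac(2) unfolding off_diagonal_beaten_def by blast
  thus False using E S ab(1) bc(1) ac(1) dd pos by linarith
qed

lemma symbic: "symbic_tree n (tree_of A)"
proof -
  obtain \<sigma> where s: "ltree_iso_map leaves (tree_of A) (tree_of A) swap_label \<sigma>" "tree_involution (tree_of A) ext \<sigma>"
    using involution_exists by blast
  interpret I: tree_involution "tree_of A" ext \<sigma> by (rule s(2))
  have "forms_path (tree_of A) (fixed_points (tree_of A) \<sigma>)"
    using I.forms_path_flipped_edge I.forms_path_fixed_node fixed_nodes_collinear[OF s] by blast
  thus ?thesis
    unfolding symbic_tree_def using tree_of_leaf_labelled tree_of_splits tree_of_len_pos s(1) I.sigma_sigma by blast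
qed

end

lemma symmetric_rank2_localeI:
  assumes "symmetric_rank2_matrix n A" "1 \<le> n"
  shows "symmetric_rank2 A n"
  using assms unfolding symmetric_rank2_iff
  by (intro symmetric_rank2.intro symmetric_hull.intro trop_hull.intro symmetric_hull_axioms.intro
      symmetric_rank2_axioms.intro) auto

section \<open>The matrix of a symbic tree\<close>

lemma (in tree_involution) fixed_nodes_collinear_of_path:
  assumes "forms_path T (fixed_points T \<sigma>)"
    and abc: "a \<in> fixed_nodes" "b \<in> fixed_nodes" "c \<in> fixed_nodes"
  shows "between d a b c \<or> between d b c a \<or> between d c a b"
proof -
  \<comment> \<open>These are the barycentric coordinates of the node \<open>v\<close>.\<close>
  define \<delta> where "\<delta> v = (\<lambda>u. if u = v then 1 else 0 :: real)" for v :: 'v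
  have N: "a \<in> nodes T" "b \<in> nodes T" "c \<in> nodes T" using abc unfolding fixed_nodes_def by auto
  have \<delta>F: "\<delta> v \<in> fixed_points T \<sigma>" if "v \<in> fixed_nodes" for v
    using fixed_cell[OF that that, of "\<delta> v"] by (simp add: cell_single \<delta>_def)
  from assms(1) consider p where "fixed_points T \<sigma> = {p}"
    | vs where "is_path T vs" "fixed_points T \<sigma> = path_points vs"
    unfolding forms_path_def by blast
  thus ?thesis
  proof cases
    case (1 p)
    hence "\<delta> a = \<delta> b" using \<delta>F[OF abc(1)] \<delta>F[OF abc(2)] by simp
    from fun_cong[OF this, of a] have "a = b" unfolding \<delta>_def by (simp split: if_splits)
    thus ?thesis using between_left[OF N(1), of c] by simp
  next
    case (2 vs)
    have mem: "v \<in> set vs" if v: "v \<in> fixed_nodes" for v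
    proof -
      have "(\<exists>w\<in>set vs. \<delta> v \<in> cell {w}) \<or> (\<exists>k. Suc k < length vs \<and> \<delta> v \<in> cell {vs ! k, vs ! Suc k})"
        using \<delta>F[OF v] unfolding 2(2) path_points_def by simp
      thus ?thesis
      proof
        assume "\<exists>w\<in>set vs. \<delta> v \<in> cell {w}"
        then obtain w where w: "w \<in> set vs" "\<delta> v \<in> cell {w}" by blast
        have "\<delta> v w = 1" using w(2) unfolding cell_single by blast
        hence "w = v" unfolding \<delta>_def by (simp split: if_splits)
        thus ?thesis using w(1) by simp
      next
        assume "\<exists>k. Suc k < length vs \<and> \<delta> v \<in> cell {vs ! k, vs ! Suc k}"
        then obtain k where k: "Suc k < length vs" "\<delta> v \<in> cell {vs ! k, vs ! Suc k}" by blast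
        have "v \<in> {vs ! k, vs ! Suc k}"
        proof (rule ccontr)
          assume "v \<notin> {vs ! k, vs ! Suc k}"
          hence "\<delta> v v = 0" using k(2) unfolding cell_def by blast
          thus False unfolding \<delta>_def by simp
        qed
        thus ?thesis using k(1) by auto
      qed
    qed
    define h where "h = hd vs"
    have ends: "h \<in> nodes T" "last vs \<in> nodes T" unfolding h_def using is_path_hd[OF 2(1)] is_path_last[OF 2(1)] .
    have B: "between d h a (last vs)" "between d h b (last vs)" "between d h c (last vs)"
      unfolding h_def using path_between[OF 2(1)] mem abc by auto
    have lin: "between d h a b \<or> between d h b a" "between d h b c \<or> between d h c b" "between d h a c \<or> between d h c a"
      using between_linear[OF ends N(1,2) B(1,2)] between_linear[OF ends N(2,3) B(2,3)]
        between_linear[OF ends N(1,3) B(1,3)] by simp_all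
    have s: "d b a = d a b" "d c b = d b c" "d c a = d a c"
      using dist_sym[OF N(2,1)] dist_sym[OF N(3,2)] dist_sym[OF N(3,1)] by simp_all
    have nn: "0 \<le> d a b" "0 \<le> d b c" "0 \<le> d a c"
      using dist_nonneg[OF N(1,2)] dist_nonneg[OF N(2,3)] dist_nonneg[OF N(1,3)] .
    show ?thesis using lin nn unfolding between_def s by argo
  qed
qed

text \<open>The midpoint of \<open>x\<close> and its image need not be a node; a node
  \<open>j\<close> equally far from both makes it one, as the median of the three. A midpoint is
  fixed, and by \<open>between_cut\<close> it is on the way from \<open>x\<close> to every
  equidistant node.\<close>

lemma (in tree_involution) fixed_middle:
  assumes "x \<in> nodes T" "j \<in> nodes T" "d x j = d (\<sigma> x) j"
  obtains p where "p \<in> fixed_nodes" "d x p = d x (\<sigma> x) / 2"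
    "\<And>y. y \<in> nodes T \<Longrightarrow> d x y = d (\<sigma> x) y \<Longrightarrow> between d x p y"
proof -
  have sx: "\<sigma> x \<in> nodes T" using sigma_node[OF assms(1)] .
  obtain p where p: "p \<in> nodes T" "between d x p (\<sigma> x)" "between d (\<sigma> x) p j" "between d x p j"
    using median[OF assms(1) sx assms(2)] by blast
  have half: "d x p = d (\<sigma> x) p" using p(3,4) assms(3) unfolding between_def by simp
  have psx: "d p (\<sigma> x) = d (\<sigma> x) p" "d p x = d x p" using dist_sym[OF p(1) sx] dist_sym[OF p(1) assms(1)] .
  have h: "d x p = d x (\<sigma> x) / 2" using p(2) half psx unfolding between_def by simp
  have sp: "\<sigma> p \<in> nodes T" using sigma_node[OF p(1)] .
  have "between d (\<sigma> x) (\<sigma> p) x" using sigma_between[OF assms(1) sx p(1)] p(2) sigma_sigma[OF assms(1)] by simp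
  hence bsp: "between d x (\<sigma> p) (\<sigma> x)" using between_sym[OF assms(1) sx sp] by simp
  have "d x (\<sigma> p) = d (\<sigma> x) p" using sigma_dist[OF sx p(1)] sigma_sigma[OF assms(1)] by simp
  hence "\<sigma> p = p"
    using between_linear[OF assms(1) sx p(1) sp p(2) bsp] half dist_zero[OF p(1) sp] dist_zero[OF sp p(1)]
    unfolding between_def by auto
  hence F: "p \<in> fixed_nodes" unfolding fixed_nodes_def using p(1) by simp
  have "between d x p y" if y: "y \<in> nodes T" "d x y = d (\<sigma> x) y" for y
  proof -
    have "between d x p y \<or> between d y p (\<sigma> x)" by (rule between_cut[OF assms(1) y(1) sx p(1,2)])
    thus ?thesis
      using y(2) half psx dist_sym[OF y(1) p(1)] dist_sym[OF y(1) sx] unfolding between_def by auto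
  qed
  thus ?thesis using that F h by blast
qed

locale symbic = realized_tree T d + I: tree_involution T d \<sigma>
  for T :: "('v, 'm) ltree_scheme" and d \<sigma> +
  fixes n :: nat
  assumes n: "1 \<le> n"
    and leaf_labelled: "leaf_labelled_tree (labels n n) T"
    and bicolored: "S \<in> splits (labels n n) T \<Longrightarrow> B \<in> S \<Longrightarrow> (\<exists>i. Unprimed i \<in> B) \<and> (\<exists>j. Primed j \<in> B)"
    and sigma_leaf: "l \<in> labels n n \<Longrightarrow> \<sigma> (leaf T l) = leaf T (swap_label l)"
    and path: "forms_path T (fixed_points T \<sigma>)"
begin

abbreviation L where "L \<equiv> labels n n"

lemma leaf_bij: "bij_betw (leaf T) L {v \<in> nodes T. degree T v = 1}"
  using leaf_labelled unfolding leaf_labelled_tree_def by simp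

lemma leaf_node: "l \<in> L \<Longrightarrow> leaf T l \<in> nodes T" and leaf_degree: "l \<in> L \<Longrightarrow> degree T (leaf T l) = 1"
  using bij_betw_apply[OF leaf_bij] by auto

lemma leaf_eq_iff: "k \<in> L \<Longrightarrow> l \<in> L \<Longrightarrow> leaf T k = leaf T l \<longleftrightarrow> k = l"
  using leaf_bij unfolding bij_betw_def inj_on_def by blast

lemma L_simps: "Unprimed i \<in> L \<longleftrightarrow> i < n" "Primed i \<in> L \<longleftrightarrow> i < n"
  unfolding labels_def by auto

definition ld :: "label \<Rightarrow> label \<Rightarrow> real" where
  "ld k l = d (leaf T k) (leaf T l)"

lemma ld_swap: "k \<in> L \<Longrightarrow> l \<in> L \<Longrightarrow> ld (swap_label k) (swap_label l) = ld k l"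
  unfolding ld_def using I.sigma_dist[OF leaf_node leaf_node] sigma_leaf by simp

lemma ld_sym: "k \<in> L \<Longrightarrow> l \<in> L \<Longrightarrow> ld k l = ld l k"
  unfolding ld_def using dist_sym[OF leaf_node leaf_node] by simp

definition D :: "nat \<Rightarrow> nat \<Rightarrow> real" where
  "D i j = ld (Unprimed i) (Primed j)"

lemma D_sym: "i < n \<Longrightarrow> j < n \<Longrightarrow> D i j = D j i"
  unfolding D_def using ld_swap[of "Unprimed i" "Primed j"] ld_sym[of "Primed i" "Unprimed j"] L_simps by simp

text \<open>The formula of \<open>entry_eq_dist\<close> without row and column summands. Leaf
  distances exceed distances of bases by 2, which lowers all entries by 1; this is a simultaneous
  scaling by -1/2 at every index.\<close>

definition A :: "real mat" where
  "A = mat n n (\<lambda>(i, j). - D i j / 2)"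

lemma A_index: "i < n \<Longrightarrow> j < n \<Longrightarrow> A $$ (i, j) = - D i j / 2"
  unfolding A_def by simp

text \<open>Half the distances to the median \<open>m\<close> of three row leaves are coefficients
  of a dependency: from any column leaf \<open>y\<close>, the paths to at least two of the three
  pass through \<open>m\<close>, and these attain the minimum \<open>- d m y / 2\<close>.\<close>

lemma A_rank: "trop_rank_le_two {..<n} {..<n} (\<lambda>i j. A $$ (i, j))"
  unfolding trop_rank_le_two_def
proof (intro ballI impI)
  fix i1 i2 i3 j1 j2 j3
  assume i: "i1 \<in> {..<n}" "i2 \<in> {..<n}" "i3 \<in> {..<n}" and j: "j1 \<in> {..<n}" "j2 \<in> {..<n}" "j3 \<in> {..<n}"
  define x where "x i = leaf T (Unprimed i)" for i
  have xn: "x i1 \<in> nodes T" "x i2 \<in> nodes T" "x i3 \<in> nodes T" using i leaf_node L_simps unfolding x_def by simp_all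
  obtain m where m: "m \<in> nodes T" "between d (x i1) m (x i2)" "between d (x i2) m (x i3)" "between d (x i1) m (x i3)"
    using median[OF xn] by blast
  have twice: "min_twice (d (x i1) m / 2 + A $$ (i1, j)) (d (x i2) m / 2 + A $$ (i2, j)) (d (x i3) m / 2 + A $$ (i3, j))"
    if j: "j \<in> {..<n}" for j
  proof -
    define y where "y = leaf T (Primed j)"
    have yn: "y \<in> nodes T" using j leaf_node L_simps unfolding y_def by simp
    have e: "A $$ (i1, j) = - d (x i1) y / 2" "A $$ (i2, j) = - d (x i2) y / 2" "A $$ (i3, j) = - d (x i3) y / 2"
      using i j A_index unfolding D_def ld_def x_def y_def by simp_all
    have t: "d (x i1) y \<le> d (x i1) m + d m y" "d (x i2) y \<le> d (x i2) m + d m y" "d (x i3) y \<le> d (x i3) m + d m y"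
      using triangle[OF xn(1) m(1) yn] triangle[OF xn(2) m(1) yn] triangle[OF xn(3) m(1) yn] by simp_all
    have s: "d y m = d m y" "d m (x i2) = d (x i2) m" "d m (x i3) = d (x i3) m" "d y (x i2) = d (x i2) y" "d y (x i3) = d (x i3) y"
      using dist_sym[OF yn m(1)] dist_sym[OF m(1) xn(2)] dist_sym[OF m(1) xn(3)] dist_sym[OF yn xn(2)] dist_sym[OF yn xn(3)]
      by simp_all
    have c: "d (x i1) m + d m y = d (x i1) y \<or> d (x i2) m + d m y = d (x i2) y"
      "d (x i2) m + d m y = d (x i2) y \<or> d (x i3) m + d m y = d (x i3) y"
      "d (x i1) m + d m y = d (x i1) y \<or> d (x i3) m + d m y = d (x i3) y"
      using between_cut[OF xn(1) yn xn(2) m(1,2)] between_cut[OF xn(2) yn xn(3) m(1,3)]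
        between_cut[OF xn(1) yn xn(3) m(1,4)] s unfolding between_def by auto
    show ?thesis unfolding e min_twice_def using t c by argo
  qed
  show "trop_singular (\<lambda>i j. A $$ (i, j)) i1 i2 i3 j1 j2 j3"
    by (rule trop_singular_dependent[OF twice[OF j(1)] twice[OF j(2)] twice[OF j(3)]])
qed

text \<open>The leaves \<open>i\<close>, \<open>j\<close>, \<open>i'\<close>, \<open>j'\<close> can
  be paired in three ways, and in a tree the two largest sums agree. By symmetry the sums are
  \<open>2 * D i j\<close>, twice the distance of \<open>i\<close> and \<open>j\<close>, and
  \<open>D i i + D j j\<close>; the last one is too small.\<close>

lemma same_side:
  assumes ij: "i < n" "j < n" and less: "D i i + D j j < 2 * D i j"
  shows "ld (Unprimed i) (Unprimed j) = D i j"
proof -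
  have l: "Unprimed i \<in> L" "Unprimed j \<in> L" "Primed i \<in> L" "Primed j \<in> L" using ij L_simps by simp_all
  note N = leaf_node[OF l(1)] leaf_node[OF l(2)] leaf_node[OF l(3)] leaf_node[OF l(4)]
  have e: "ld (Primed i) (Primed j) = ld (Unprimed i) (Unprimed j)" "ld (Unprimed i) (Primed j) = D i j"
    "ld (Unprimed j) (Primed i) = D i j" "ld (Primed i) (Unprimed j) = D i j"
    "ld (Unprimed i) (Primed i) = D i i" "ld (Unprimed j) (Primed j) = D j j"
    "ld (Primed j) (Unprimed j) = D j j" "ld (Primed j) (Primed i) = ld (Unprimed i) (Unprimed j)"
    using ld_swap[OF l(1,2)] ld_sym[OF l(3,2)] ld_sym[OF l(4,2)] ld_sym[OF l(4,3)] D_sym[OF ij] unfolding D_def by simp_all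
  have "ld (Unprimed i) (Primed j) + ld (Unprimed j) (Primed i) \<le>
      max (ld (Unprimed i) (Unprimed j) + ld (Primed j) (Primed i)) (ld (Unprimed i) (Primed i) + ld (Unprimed j) (Primed j))"
    unfolding ld_def by (rule four_point[OF N(1,2,4,3)])
  moreover have "ld (Unprimed i) (Unprimed j) + ld (Primed j) (Primed i) \<le>
      max (ld (Unprimed i) (Primed j) + ld (Unprimed j) (Primed i)) (ld (Unprimed i) (Primed i) + ld (Primed j) (Unprimed j))"
    unfolding ld_def by (rule four_point[OF N(1,4,2,3)])
  ultimately show ?thesis unfolding e using less by linarith
qed

text \<open>If the condition failed, \<open>same_side\<close> would make each leaf and its mirror
  image equally far from the other two leaves. The midpoints of the three mirror pairs are then
  fixed nodes whose distances satisfy all three triangle inequalities strictly, contradicting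
  collinearity.\<close>

lemma A_beaten: "off_diagonal_beaten n (\<lambda>i j. A $$ (i, j))"
  unfolding off_diagonal_beaten_def
proof (intro allI impI, rule ccontr)
  fix i j k assume ijk: "i < n" "j < n" "k < n" "i \<noteq> j \<and> j \<noteq> k \<and> i \<noteq> k"
    and neg: "\<not> (A $$ (i, i) + A $$ (j, j) + A $$ (k, k) \<le> A $$ (i, j) + A $$ (j, k) + A $$ (k, i) \<or>
      A $$ (i, i) + 2 * A $$ (j, k) \<le> A $$ (i, j) + A $$ (j, k) + A $$ (k, i) \<or>
      A $$ (j, j) + 2 * A $$ (i, k) \<le> A $$ (i, j) + A $$ (j, k) + A $$ (k, i) \<or>
      A $$ (k, k) + 2 * A $$ (i, j) \<le> A $$ (i, j) + A $$ (j, k) + A $$ (k, i))"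
  have s: "D j i = D i j" "D k j = D j k" "D k i = D i k" using D_sym ijk by simp_all
  \<comment> \<open>Adding two of these gives the hypothesis of \<open>same_side\<close>; at the end
    each of them excludes one order of the three fixed nodes on a path.\<close>
  have lt: "D i i + D j k < D i j + D i k" "D j j + D i k < D i j + D j k" "D k k + D i j < D j k + D i k"
    using neg ijk s by (simp_all add: A_index)
  have U: "Unprimed i \<in> L" "Unprimed j \<in> L" "Unprimed k \<in> L" using ijk L_simps by simp_all
  have same: "ld (Unprimed i) (Unprimed j) = D i j" "ld (Unprimed j) (Unprimed k) = D j k"
    "ld (Unprimed i) (Unprimed k) = D i k"
    using same_side[OF ijk(1,2)] same_side[OF ijk(2,3)] same_side[OF ijk(1,3)] lt by simp_all
  have same': "ld (Unprimed j) (Unprimed i) = D i j" "ld (Unprimed k) (Unprimed j) = D j k"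
    "ld (Unprimed k) (Unprimed i) = D i k"
    using same ld_sym[OF U(2,1)] ld_sym[OF U(3,2)] ld_sym[OF U(3,1)] by simp_all
  have sig: "\<sigma> (leaf T (Unprimed x)) = leaf T (Primed x)" if "x < n" for x
    using sigma_leaf[of "Unprimed x"] that L_simps by simp
  have mid: "\<exists>p. p \<in> I.fixed_nodes \<and> d (leaf T (Unprimed x)) p = D x x / 2 \<and>
      between d (leaf T (Unprimed x)) p (leaf T (Unprimed y)) \<and> between d (leaf T (Unprimed x)) p (leaf T (Unprimed z))"
    if xyz: "x < n" "y < n" "z < n" "ld (Unprimed x) (Unprimed y) = D y x" "ld (Unprimed x) (Unprimed z) = D z x" for x y z
  proof -
    have l: "Unprimed x \<in> L" "Unprimed y \<in> L" "Unprimed z \<in> L" "Primed x \<in> L" using xyz L_simps by simp_all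
    have eq: "d (leaf T (Unprimed x)) (leaf T (Unprimed w)) = d (\<sigma> (leaf T (Unprimed x))) (leaf T (Unprimed w))"
      if "w < n" "ld (Unprimed x) (Unprimed w) = D w x" for w
      using that(2) ld_sym[of "Unprimed w" "Primed x"] that(1) l L_simps
      unfolding sig[OF xyz(1)] ld_def[symmetric] D_def by simp
    obtain p where p: "p \<in> I.fixed_nodes" "d (leaf T (Unprimed x)) p = d (leaf T (Unprimed x)) (\<sigma> (leaf T (Unprimed x))) / 2"
      "\<And>w. w \<in> nodes T \<Longrightarrow> d (leaf T (Unprimed x)) w = d (\<sigma> (leaf T (Unprimed x))) w \<Longrightarrow> between d (leaf T (Unprimed x)) p w"
      using I.fixed_middle[OF leaf_node[OF l(1)] leaf_node[OF l(2)] eq[OF xyz(2,4)]] by blast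
    have "d (leaf T (Unprimed x)) p = D x x / 2" using p(2) unfolding sig[OF xyz(1)] D_def ld_def .
    thus ?thesis using p(1) p(3)[OF leaf_node[OF l(2)] eq[OF xyz(2,4)]] p(3)[OF leaf_node[OF l(3)] eq[OF xyz(3,5)]] by blast
  qed
  define x where "x = leaf T (Unprimed i)"
  define y where "y = leaf T (Unprimed j)"
  define z where "z = leaf T (Unprimed k)"
  have N: "x \<in> nodes T" "y \<in> nodes T" "z \<in> nodes T" unfolding x_def y_def z_def using leaf_node U by simp_all
  have dd: "d x y = D i j" "d y z = D j k" "d x z = D i k" "d y x = D i j" "d z y = D j k" "d z x = D i k"
    using same same' unfolding ld_def x_def y_def z_def by simp_all
  obtain p where p: "p \<in> I.fixed_nodes" "d x p = D i i / 2" "between d x p y" "between d x p z"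
    using mid[OF ijk(1,2,3)] same s unfolding x_def y_def z_def by auto
  obtain q where q: "q \<in> I.fixed_nodes" "d y q = D j j / 2" "between d y q x" "between d y q z"
    using mid[OF ijk(2,1,3)] same same' s unfolding x_def y_def z_def by auto
  obtain w where w: "w \<in> I.fixed_nodes" "d z w = D k k / 2" "between d z w x" "between d z w y"
    using mid[OF ijk(3,1,2)] same' s unfolding x_def y_def z_def by auto
  have FN: "p \<in> nodes T" "q \<in> nodes T" "w \<in> nodes T" using p(1) q(1) w(1) unfolding I.fixed_nodes_def by auto
  \<comment> \<open>Walking from \<open>u\<close> and \<open>v\<close> towards each other, without
    meeting, leaves the remainder of the segment.\<close>
  have gap: "d a b = d u v - d u a - d v b"
    if "u \<in> nodes T" "v \<in> nodes T" "a \<in> nodes T" "b \<in> nodes T" "between d u a v" "between d v b u"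
      "d u a + d v b < d u v" for u v a b
  proof -
    have bb: "between d u b v" using between_sym[OF that(2,1,4)] that(6) by simp
    have "between d u a b \<or> between d u b a" by (rule between_linear[OF that(1,2,3,4,5) bb])
    thus ?thesis
      using bb that(5,7) dist_sym[OF that(2,4)] dist_nonneg[OF that(4,3)] unfolding between_def by auto
  qed
  have "d p q = D i j - D i i / 2 - D j j / 2" "d q w = D j k - D j j / 2 - D k k / 2" "d p w = D i k - D i i / 2 - D k k / 2"
    using gap[OF N(1,2) FN(1,2) p(3) q(3)] gap[OF N(2,3) FN(2,3) q(4) w(4)] gap[OF N(1,3) FN(1,3) p(4) w(3)]
      dd p(2) q(2) w(2) lt by simp_all
  moreover have "d q p = d p q" "d w q = d q w" "d w p = d p w"
    using dist_sym[OF FN(2,1)] dist_sym[OF FN(3,2)] dist_sym[OF FN(3,1)] by simp_all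
  ultimately show False
    using I.fixed_nodes_collinear_of_path[OF path p(1) q(1) w(1)] lt unfolding between_def by linarith
qed

lemma A_symmetric_rank2: "symmetric_rank2_matrix n A"
  unfolding symmetric_rank2_iff using A_rank A_beaten A_index D_sym by (simp add: A_def)

text \<open>The distance of the bases of two leaves.\<close>

definition bd :: "label \<Rightarrow> label \<Rightarrow> real" where
  "bd k l = (if k = l then 0 else ld k l - 2)"

text \<open>The third node \<open>v\<close> excludes the tree with a single edge, in which a leaf
  has no inner neighbour.\<close>

lemma leaf_neighbour:
  assumes l: "l \<in> L" and w: "w \<in> nodes T" "w \<noteq> leaf T l" and v: "v \<in> nodes T" "v \<noteq> leaf T l" "v \<noteq> w"
  obtains b where "b \<in> nodes T" "d (leaf T l) b = 1" "degree T b \<noteq> 1"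
    "\<And>u. u \<in> nodes T \<Longrightarrow> u \<noteq> leaf T l \<Longrightarrow> between d (leaf T l) b u"
proof -
  let ?z = "leaf T l"
  have zn: "?z \<in> nodes T" using leaf_node[OF l] .
  obtain b where b: "b \<in> nodes T" "{?z, b} \<in> edges T" "between d ?z b w"
    using neighbour_towards[OF zn w(1) w(2)[symmetric]] by blast
  have bz: "b \<noteq> ?z" using edge_nodes(3)[OF b(2)] by simp
  have btw: "between d ?z b u" if u: "u \<in> nodes T" "u \<noteq> ?z" for u
  proof -
    have "between d u ?z b \<or> between d u b ?z" by (rule edge_dichotomy[OF b(2) u(1)])
    moreover have "\<not> between d u ?z b"
      using degree_one_between[OF zn leaf_degree[OF l] u(1) b(1)] u(2) bz by blast
    ultimately show ?thesis using between_sym[OF u(1) zn b(1)] by simp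
  qed
  have inner: "degree T b \<noteq> 1"
  proof
    assume one: "degree T b = 1"
    have "u = b" if "u \<in> nodes T" "u \<noteq> ?z" for u
      using degree_one_between[OF b(1) one zn that(1) btw[OF that]] bz by auto
    thus False using w v by metis
  qed
  have "{?z, b} \<notin> internal_edges T" unfolding internal_edges_def using leaf_degree[OF l] by auto
  moreover have "{v \<in> {?z, b}. degree T v = 1} = {?z}" using inner leaf_degree[OF l] by auto
  ultimately have "d ?z b = 1" using edge_dist[OF b(2)] unfolding edge_weight_def by simp
  thus ?thesis using that b(1) inner btw by blast
qed

lemma leaf_pair_dist:
  assumes "k \<in> L" "l \<in> L" "k \<noteq> l"
  shows "2 \<le> ld k l"
proof -
  let ?z = "leaf T k" and ?y = "leaf T l"
  have N: "?z \<in> nodes T" "?y \<in> nodes T" "?z \<noteq> ?y" using leaf_node leaf_eq_iff assms by simp_all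
  show ?thesis
  proof (cases "\<exists>v\<in>nodes T. v \<noteq> ?z \<and> v \<noteq> ?y")
    case True
    then obtain v where v: "v \<in> nodes T" "v \<noteq> ?z" "v \<noteq> ?y" by blast
    obtain b where b: "b \<in> nodes T" "d ?z b = 1" "degree T b \<noteq> 1" "between d ?z b ?y"
      using leaf_neighbour[OF assms(1) N(2) N(3)[symmetric] v] N(2,3) by metis
    obtain c where c: "c \<in> nodes T" "d ?y c = 1" "between d ?y c b"
      using leaf_neighbour[OF assms(2) N(1,3) v(1,3,2)] b(1,3) leaf_degree[OF assms(2)] by metis
    have "1 \<le> d ?y b" using c dist_nonneg[OF c(1) b(1)] unfolding between_def by linarith
    thus ?thesis using b(2,4) dist_sym[OF N(2) b(1)] unfolding ld_def between_def by linarith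
  next
    case False
    have e: "{?z, ?y} \<in> edges T" unfolding edge_iff using N False by auto
    moreover have "{?z, ?y} \<notin> internal_edges T" unfolding internal_edges_def using leaf_degree[OF assms(1)] by auto
    moreover have "{v \<in> {?z, ?y}. degree T v = 1} = {?z, ?y}" using leaf_degree assms by auto
    ultimately show ?thesis using edge_dist[OF e] N(3) unfolding ld_def edge_weight_def by simp
  qed
qed

lemma bd_triangle:
  assumes "k \<in> L" "l \<in> L" "m \<in> L"
  shows "bd k m \<le> bd k l + bd l m"
proof (cases "k = l \<or> l = m \<or> k = m")
  case True
  have "0 \<le> bd k l" "0 \<le> bd l m" using leaf_pair_dist assms unfolding bd_def by auto
  thus ?thesis using True unfolding bd_def by auto
next
  case False
  let ?z = "leaf T l" and ?x = "leaf T k" and ?y = "leaf T m"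
  have N: "?z \<in> nodes T" "?x \<in> nodes T" "?y \<in> nodes T" "?x \<noteq> ?z" "?y \<noteq> ?z" "?x \<noteq> ?y"
    using leaf_node leaf_eq_iff assms False by auto
  obtain b where b: "b \<in> nodes T" "d ?z b = 1" "between d ?z b ?x" "between d ?z b ?y"
    using leaf_neighbour[OF assms(2) N(2,4) N(3,5) N(6)[symmetric]] N by metis
  have "ld k m \<le> ld l k - 1 + (ld l m - 1)"
    using triangle[OF N(2) b(1) N(3)] b(2-4) dist_sym[OF N(2) b(1)] unfolding ld_def between_def by linarith
  thus ?thesis using False ld_sym[OF assms(2,1)] unfolding bd_def by auto
qed

text \<open>By the split condition there are leaves of both colours beyond the base of any leaf.\<close>

lemma bd_beyond:
  assumes k: "k \<in> L" and l: "l \<in> L"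
  shows "\<exists>i<n. bd k (Unprimed i) = bd k l + bd l (Unprimed i)"
    "\<exists>j<n. bd k (Primed j) = bd k l + bd l (Primed j)"
proof -
  have sym: "bd a b = bd b a" if "a \<in> L" "b \<in> L" for a b using ld_sym[OF that] unfolding bd_def by auto
  have same: "bd k y = bd k l + bd l y" if "k = l" for y using that unfolding bd_def by simp
  \<comment> \<open>Two leaves attached at the same node \<open>b\<close> have base distance 0, and
    all other leaves are equally far from both.\<close>
  have zero: "bd k y = bd k l + bd l y"
    if neq: "k \<noteq> l" and b: "b \<in> nodes T" "d (leaf T k) b = 1" "d (leaf T l) b = 1" "between d (leaf T k) b (leaf T l)"
      "\<And>u. u \<in> nodes T \<Longrightarrow> u \<noteq> leaf T k \<Longrightarrow> between d (leaf T k) b u"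
      "\<And>u. u \<in> nodes T \<Longrightarrow> u \<noteq> leaf T l \<Longrightarrow> between d (leaf T l) b u" and y: "y \<in> L" for b y
  proof -
    have kl: "ld k l = 2" using b(2-4) dist_sym[OF leaf_node[OF l] b(1)] unfolding ld_def between_def by simp
    consider "y = k" | "y = l" | "y \<noteq> k" "y \<noteq> l" by blast
    thus ?thesis
    proof cases
      case 1
      thus ?thesis using kl neq ld_sym[OF k l] unfolding bd_def by simp
    next
      case 2
      thus ?thesis using kl neq unfolding bd_def by simp
    next
      case 3
      have "ld k y = ld l y"
        using b(5)[of "leaf T y"] b(6)[of "leaf T y"] leaf_node[OF y] leaf_eq_iff[OF y k] leaf_eq_iff[OF y l] 3 b(2,3)
        unfolding ld_def between_def by simp
      thus ?thesis using 3 neq kl unfolding bd_def by simp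
    qed
  qed
  have beyond: "bd k y = bd k l + bd l y"
    if neq: "k \<noteq> l" and b: "b \<in> nodes T" "c \<in> nodes T" "d (leaf T l) b = 1" "b \<noteq> c"
      "\<And>u. u \<in> nodes T \<Longrightarrow> u \<noteq> leaf T l \<Longrightarrow> between d (leaf T l) b u"
      "between d b c (leaf T k)" and y: "y \<in> L" "between d (leaf T y) b c" for b c y
  proof -
    note N = leaf_node[OF k] leaf_node[OF l] leaf_node[OF y(1)]
    have yk: "between d (leaf T y) b (leaf T k)" using between_concat(1)[OF N(3,1) b(1,2) y(2) b(6,4)] .
    have "y \<noteq> k"
    proof
      assume "y = k"
      hence "between d (leaf T k) b c" "between d (leaf T k) c b" using y(2) b(6) between_sym[OF b(1) N(1) b(2)] by simp_all
      thus False using between_antisym[OF N(1) b(1,2)] b(4) by simp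
    qed
    have kb: "ld l k = 1 + d b (leaf T k)"
      using b(5)[OF N(1)] leaf_eq_iff[OF k l] neq b(3) unfolding ld_def between_def by simp
    show ?thesis
    proof (cases "y = l")
      case True
      thus ?thesis unfolding bd_def by simp
    next
      case False
      have "ld l y = 1 + d b (leaf T y)"
        using b(5)[OF N(3)] leaf_eq_iff[OF y(1) l] False b(3) unfolding ld_def between_def by simp
      moreover have "ld y k = d (leaf T y) b + d b (leaf T k)" using yk unfolding ld_def between_def by simp
      ultimately show ?thesis
        using kb False \<open>y \<noteq> k\<close> neq ld_sym[OF k l] ld_sym[OF k y(1)] dist_sym[OF N(3) b(1)] unfolding bd_def by simp
    qed
  qed
  \<comment> \<open>If the labels agree, the leaves share a base, or the tree is a single edge,
    every label works, in particular those with index 0. Otherwise an internal edge leads from the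
    base of \<open>l\<close> towards \<open>k\<close>.\<close>
  have all_eq: "bd k (Unprimed 0) = bd k l + bd l (Unprimed 0) \<and> bd k (Primed 0) = bd k l + bd l (Primed 0) \<or>
    (\<exists>b c. k \<noteq> l \<and> b \<in> nodes T \<and> c \<in> nodes T \<and> d (leaf T l) b = 1 \<and> {b, c} \<in> internal_edges T \<and>
      (\<forall>u\<in>nodes T. u \<noteq> leaf T l \<longrightarrow> between d (leaf T l) b u) \<and> between d b c (leaf T k))"
  proof (cases "k = l")
    case True
    thus ?thesis using same by simp
  next
    case False
    note N = leaf_node[OF k] leaf_node[OF l]
    have neq: "leaf T k \<noteq> leaf T l" using leaf_eq_iff[OF k l] False by simp
    have L0: "Unprimed 0 \<in> L" "Primed 0 \<in> L" using n L_simps by simp_all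
    show ?thesis
    proof (cases "\<exists>v\<in>nodes T. v \<noteq> leaf T k \<and> v \<noteq> leaf T l")
      case True
      then obtain v where v: "v \<in> nodes T" "v \<noteq> leaf T k" "v \<noteq> leaf T l" by blast
      obtain b where b: "b \<in> nodes T" "d (leaf T l) b = 1" "degree T b \<noteq> 1"
        "\<forall>u\<in>nodes T. u \<noteq> leaf T l \<longrightarrow> between d (leaf T l) b u"
        using leaf_neighbour[OF l N(1) neq v(1,3,2)] by metis
      obtain a where a: "a \<in> nodes T" "d (leaf T k) a = 1" "degree T a \<noteq> 1"
        "\<forall>u\<in>nodes T. u \<noteq> leaf T k \<longrightarrow> between d (leaf T k) a u"
        using leaf_neighbour[OF k N(2) neq[symmetric] v] by metis
      have bk: "b \<noteq> leaf T k" using b(3) leaf_degree[OF k] by auto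
      obtain c where c: "c \<in> nodes T" "{b, c} \<in> edges T" "between d b c (leaf T k)"
        using neighbour_towards[OF b(1) N(1) bk] by blast
      show ?thesis
      proof (cases "c = leaf T k")
        case True
        have "between d (leaf T k) a b" using a(4) b(1) bk by blast
        hence "between d b a (leaf T k)" using between_sym[OF b(1) N(1) a(1)] by simp
        hence "a = b" using edge_between[OF c(2) a(1)] True a(3) leaf_degree[OF k] by auto
        hence ab: "d (leaf T k) b = 1" "\<forall>u\<in>nodes T. u \<noteq> leaf T k \<longrightarrow> between d (leaf T k) b u" using a by simp_all
        have "between d (leaf T k) b (leaf T l)" using ab(2) N(2) neq by simp
        thus ?thesis using zero[OF False b(1) ab(1) b(2)] ab(2) b(4) L0 by simp
      next
        case False
        have "degree T c \<noteq> 1" using degree_one_between[OF c(1) _ b(1) N(1) c(3)] False edge_nodes(3)[OF c(2)] by auto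
        hence "{b, c} \<in> internal_edges T" unfolding internal_edges_def using c(2) b(3) by simp
        thus ?thesis using b c \<open>k \<noteq> l\<close> by blast
      qed
    next
      case none: False
      have e: "{leaf T k, leaf T l} \<in> edges T" unfolding edge_iff using N neq none by auto
      moreover have "{leaf T k, leaf T l} \<notin> internal_edges T" unfolding internal_edges_def using leaf_degree[OF k] by auto
      moreover have "{v \<in> {leaf T k, leaf T l}. degree T v = 1} = {leaf T k, leaf T l}" using leaf_degree k l by auto
      ultimately have two: "ld k l = 2" using edge_dist[OF e] neq unfolding ld_def edge_weight_def by simp
      have "y = k \<or> y = l" if "y \<in> L" for y
        using none leaf_node[OF that] leaf_eq_iff[OF that k] leaf_eq_iff[OF that l] by blast
      hence "bd k y = bd k l + bd l y" if "y \<in> L" for y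
        using two False ld_sym[OF k l] that unfolding bd_def by auto
      thus ?thesis using L0 by blast
    qed
  qed
  have U: "(\<exists>i<n. bd k (Unprimed i) = bd k l + bd l (Unprimed i)) \<and> (\<exists>j<n. bd k (Primed j) = bd k l + bd l (Primed j))"
    using all_eq
  proof
    assume "bd k (Unprimed 0) = bd k l + bd l (Unprimed 0) \<and> bd k (Primed 0) = bd k l + bd l (Primed 0)"
    moreover have "0 < n" using n by simp
    ultimately show ?thesis by blast
  next
    assume "\<exists>b c. k \<noteq> l \<and> b \<in> nodes T \<and> c \<in> nodes T \<and> d (leaf T l) b = 1 \<and> {b, c} \<in> internal_edges T \<and>
      (\<forall>u\<in>nodes T. u \<noteq> leaf T l \<longrightarrow> between d (leaf T l) b u) \<and> between d b c (leaf T k)"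
    then obtain b c where bc: "k \<noteq> l" "b \<in> nodes T" "c \<in> nodes T" "d (leaf T l) b = 1" "{b, c} \<in> internal_edges T"
      "\<forall>u\<in>nodes T. u \<noteq> leaf T l \<longrightarrow> between d (leaf T l) b u" "between d b c (leaf T k)" by blast
    have e: "{b, c} \<in> edges T" using bc(5) unfolding internal_edges_def by simp
    have neq: "b \<noteq> c" using edge_nodes(3)[OF e] .
    have side: "side L T {b, c} b = {y \<in> L. between d (leaf T y) b c}"
      by (rule side_eq[OF e]) (use leaf_node in blast)
    \<comment> \<open>The side of \<open>b\<close> is the one away from \<open>k\<close>; the split
      condition puts leaves of both colours there.\<close>
    have "side L T {b, c} ` {b, c} \<in> splits L T" unfolding splits_def using bc(5) by blast
    hence "(\<exists>i. Unprimed i \<in> side L T {b, c} b) \<and> (\<exists>j. Primed j \<in> side L T {b, c} b)"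
      by (rule bicolored) simp
    then obtain i j where ij: "Unprimed i \<in> L" "between d (leaf T (Unprimed i)) b c"
      "Primed j \<in> L" "between d (leaf T (Primed j)) b c" unfolding side by blast
    have "bd k (Unprimed i) = bd k l + bd l (Unprimed i)" "bd k (Primed j) = bd k l + bd l (Primed j)"
      using beyond[OF bc(1-4) neq _ bc(7) ij(1,2)] beyond[OF bc(1-4) neq _ bc(7) ij(3,4)] bc(6) by blast+
    thus ?thesis using ij(1,3) L_simps by blast
  qed
  show "\<exists>i<n. bd k (Unprimed i) = bd k l + bd l (Unprimed i)" "\<exists>j<n. bd k (Primed j) = bd k l + bd l (Primed j)"
    using U by simp_all
qed

lemma bd_sym: "k \<in> L \<Longrightarrow> l \<in> L \<Longrightarrow> bd k l = bd l k"
  using ld_sym unfolding bd_def by auto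

lemma bd_swap: "k \<in> L \<Longrightarrow> l \<in> L \<Longrightarrow> bd (swap_label k) (swap_label l) = bd k l"
  using ld_swap swap_label_eq_iff unfolding bd_def by auto

lemma A_bd: "i < n \<Longrightarrow> j < n \<Longrightarrow> A $$ (j, i) = - bd (Unprimed i) (Primed j) / 2 - 1"
  using A_index[of j i] D_sym[of j i] unfolding bd_def D_def by (simp add: field_simps)

sublocale M: symmetric_rank2 A n
  by (rule symmetric_rank2_localeI[OF A_symmetric_rank2 n])

text \<open>The triangle inequality bounds every four-entry expression. Equality needs a primed leaf
  beyond the base of either column as seen from the other, which \<open>bd_beyond\<close>
  provides.\<close>

lemma column_bd:
  assumes "i < n" "k < n"
  shows "M.hd (M.column i) (M.column k) = bd (Unprimed i) (Unprimed k)"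
  unfolding M.column_max_dist[OF assms]
proof (rule Max_eqI)
  have L: "Unprimed i \<in> L" "Unprimed k \<in> L" using assms L_simps by simp_all
  obtain j where j: "j < n" "bd (Unprimed k) (Primed j) = bd (Unprimed k) (Unprimed i) + bd (Unprimed i) (Primed j)"
    using bd_beyond(2)[OF L(2,1)] by blast
  obtain l where l: "l < n" "bd (Unprimed i) (Primed l) = bd (Unprimed i) (Unprimed k) + bd (Unprimed k) (Primed l)"
    using bd_beyond(2)[OF L] by blast
  show "bd (Unprimed i) (Unprimed k) \<in> (\<lambda>(j, l). A $$ (j, i) - A $$ (j, k) - A $$ (l, i) + A $$ (l, k)) ` ({..<n} \<times> {..<n})"
    using j l bd_sym[OF L] by (intro image_eqI[of _ _ "(j, l)"]) (simp_all add: A_bd assms field_simps)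
next
  have L: "Unprimed i \<in> L" "Unprimed k \<in> L" using assms L_simps by simp_all
  fix y assume "y \<in> (\<lambda>(j, l). A $$ (j, i) - A $$ (j, k) - A $$ (l, i) + A $$ (l, k)) ` ({..<n} \<times> {..<n})"
  then obtain j l where jl: "j < n" "l < n" "y = A $$ (j, i) - A $$ (j, k) - A $$ (l, i) + A $$ (l, k)" by auto
  have "Primed j \<in> L" "Primed l \<in> L" using jl L_simps by simp_all
  thus "y \<le> bd (Unprimed i) (Unprimed k)"
    using bd_triangle[OF L(2,1), of "Primed j"] bd_triangle[OF L, of "Primed l"] bd_sym[OF L] jl
    by (simp add: A_bd assms)
qed simp

text \<open>Equality is reached by an unprimed leaf \<open>k\<close> beyond the base of
  \<open>j'\<close> as seen from \<open>i\<close>, and then a primed leaf \<open>l'\<close> beyond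
  the base of \<open>i\<close> as seen from \<open>k\<close>.\<close>

lemma column_base_bd:
  assumes "i < n" "j < n"
  shows "M.hd (M.column i) (M.base j) = bd (Unprimed i) (Primed j)"
  unfolding M.column_base_dist[OF assms]
proof (rule Max_eqI)
  have L: "Unprimed i \<in> L" "Primed j \<in> L" using assms L_simps by simp_all
  obtain k where k: "k < n" "bd (Unprimed i) (Unprimed k) = bd (Unprimed i) (Primed j) + bd (Primed j) (Unprimed k)"
    using bd_beyond(1)[OF L] by blast
  have Lk: "Unprimed k \<in> L" using k L_simps by simp
  obtain l where l: "l < n" "bd (Unprimed k) (Primed l) = bd (Unprimed k) (Unprimed i) + bd (Unprimed i) (Primed l)"
    using bd_beyond(2)[OF Lk L(1)] by blast
  show "bd (Unprimed i) (Primed j) \<in> (\<lambda>(l, k). A $$ (l, i) - A $$ (l, k) + A $$ (j, k) - A $$ (j, i)) ` ({..<n} \<times> {..<n})"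
    using k l bd_sym[OF Lk L(1)] bd_sym[OF Lk L(2)]
    by (intro image_eqI[of _ _ "(l, k)"]) (simp_all add: A_bd assms field_simps)
next
  have L: "Unprimed i \<in> L" "Primed j \<in> L" using assms L_simps by simp_all
  fix y assume "y \<in> (\<lambda>(l, k). A $$ (l, i) - A $$ (l, k) + A $$ (j, k) - A $$ (j, i)) ` ({..<n} \<times> {..<n})"
  then obtain l k where lk: "l < n" "k < n" "y = A $$ (l, i) - A $$ (l, k) + A $$ (j, k) - A $$ (j, i)" by auto
  have L': "Unprimed k \<in> L" "Primed l \<in> L" using lk L_simps by simp_all
  show "y \<le> bd (Unprimed i) (Primed j)"
    using bd_triangle[OF L'(1) L(2) L'(2)] bd_triangle[OF L(2,1) L'(2)] bd_sym[OF L] lk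
    by (simp add: A_bd assms)
qed simp

lemma leaf_dist_eq:
  assumes "k \<in> L" "l \<in> L"
  shows "d (leaf T k) (leaf T l) = M.ext (Inl k) (Inl l)"
proof -
  have "M.hd (label_base A k) (label_base A l) = bd k l"
    using assms(1)
  proof (cases rule: labels_cases)
    case k: (1 i)
    from assms(2) show ?thesis
    proof (cases rule: labels_cases)
      case l: (1 j)
      thus ?thesis using k M.label_base_simps column_bd by simp
    next
      case l: (2 j)
      thus ?thesis using k M.label_base_simps column_base_bd by simp
    qed
  next
    case k: (2 i)
    from assms(2) show ?thesis
    proof (cases rule: labels_cases)
      case l: (1 j)
      thus ?thesis
        using k M.label_base_simps column_base_bd[of j i] M.hd_sym[OF M.base_hull M.column_hull] bd_sym[OF assms] by simp
    next
      case l: (2 j)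
      \<comment> \<open>Two ray bases are reduced to two columns by the involution in the tree and
        by transposition in the matrix.\<close>
      have "bd (Primed i) (Primed j) = bd (Unprimed i) (Unprimed j)"
        using bd_swap[of "Unprimed i" "Unprimed j"] k(2) l(2) L_simps by simp
      thus ?thesis using k l M.label_base_simps M.column_dist_base[of i j] column_bd[of i j] by simp
    qed
  qed
  moreover have "d (leaf T k) (leaf T l) = 0" if "k = l" using that dist_self[OF leaf_node[OF assms(1)]] by simp
  ultimately show ?thesis unfolding M.ext_leaves bd_def ld_def by auto
qed

lemma isomorphic_tree_of: "ltree_isomorphic L T (tree_of A)"
proof -
  have "Unprimed 0 \<in> L" using n L_simps by simp
  hence ne: "L \<noteq> {}" by blast
  have "\<exists>f. ltree_iso_map L T (tree_of A) id f \<and>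
    (\<forall>u\<in>nodes T. \<forall>v\<in>nodes T. M.ext (f u) (f v) = d u v)"
    by (rule ltree_iso_map_exists[OF realized_tree_axioms M.tree_of_realized leaf_labelled
        M.tree_of_leaf_labelled _ _ ne]) (simp_all add: leaf_dist_eq M.tree_of_simps)
  thus ?thesis unfolding ltree_isomorphic_def by blast
qed

end

section \<open>Uniqueness and the main theorem\<close>

lemma simultaneous_scalingI:
  assumes A: "A \<in> carrier_mat n n" and B: "B \<in> carrier_mat n n"
    and BA: "\<And>i j. i < n \<Longrightarrow> j < n \<Longrightarrow> B $$ (i, j) = A $$ (i, j) + c i + c j"
  shows "simultaneous_scaling A B"
proof -
  \<comment> \<open>The intermediate result after scaling all indices below
    \<open>m\<close>.\<close>
  define M where "M m = mat n n (\<lambda>(i, j). A $$ (i, j) + (if i < m then c i else 0) + (if j < m then c j else 0))" for m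
  have "simultaneous_scaling A (M m)" if "m \<le> n" for m
    using that
  proof (induction m)
    case 0
    have "M 0 = A" unfolding M_def using A by (intro eq_matI) auto
    thus ?case unfolding simultaneous_scaling_def by simp
  next
    case (Suc m)
    have "M (Suc m) = scale_index m (c m) (M m)"
      unfolding M_def scale_index_def by (intro eq_matI) (auto simp: less_Suc_eq)
    moreover have "m < dim_row (M m)" using Suc.prems unfolding M_def by simp
    ultimately have "\<exists>i<dim_row (M m). \<exists>c. M (Suc m) = scale_index i c (M m)" by blast
    thus ?case using Suc unfolding simultaneous_scaling_def by (simp add: rtranclp.rtrancl_into_rtrancl)
  qed
  moreover have "M n = B" unfolding M_def using A B BA by (intro eq_matI) auto
  ultimately show ?thesis by blast
qed

text \<open>Both matrices have the same leaf distances, hence agree up to summands for rows and for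
  columns. Comparing \<open>(i, j)\<close> with \<open>(j, i)\<close> shows that both summands may
  be replaced by their mean, which is a simultaneous scaling.\<close>

lemma tree_determines_matrix:
  assumes T: "realized_tree T d" and n: "1 \<le> n"
    and A: "symmetric_rank2_matrix n A" "ltree_isomorphic (labels n n) T (tree_of A)"
    and B: "symmetric_rank2_matrix n B" "ltree_isomorphic (labels n n) T (tree_of B)"
    and leaf: "\<And>l. l \<in> labels n n \<Longrightarrow> leaf T l \<in> nodes T"
  shows "simultaneous_scaling A B"
proof -
  interpret HA: symmetric_rank2 A n by (rule symmetric_rank2_localeI[OF A(1) n])
  interpret HB: symmetric_rank2 B n by (rule symmetric_rank2_localeI[OF B(1) n])
  obtain f where f: "ltree_iso_map (labels n n) T (tree_of A) id f" using A(2) unfolding ltree_isomorphic_def by blast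
  obtain g where g: "ltree_iso_map (labels n n) T (tree_of B) id g" using B(2) unfolding ltree_isomorphic_def by blast
  have fl: "f (leaf T l) = Inl l" "g (leaf T l) = Inl l" if "l \<in> labels n n" for l
    using f g that unfolding ltree_iso_map_def HA.tree_of_simps HB.tree_of_simps by simp_all
  have eq: "HA.ext (Inl k) (Inl l) = HB.ext (Inl k) (Inl l)" if kl: "k \<in> labels n n" "l \<in> labels n n" for k l
    using ltree_iso_dist[OF T HA.tree_of_realized f leaf[OF kl(1)] leaf[OF kl(2)]]
      ltree_iso_dist[OF T HB.tree_of_realized g leaf[OF kl(1)] leaf[OF kl(2)]] fl[OF kl(1)] fl[OF kl(2)] by simp
  have hd: "hilbert_dist (HA.column i) (HA.base j) = hilbert_dist (HB.column i) (HB.base j)" if "i < n" "j < n" for i j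
    using eq[of "Unprimed i" "Primed j"] that unfolding HA.ext_leaves HB.ext_leaves
    by (simp add: labels_def HA.label_base_simps HB.label_base_simps)
  obtain u v where uv: "\<forall>i<n. \<forall>j<n. A $$ (j, i) = - hilbert_dist (HA.column i) (HA.base j) / 2 + u i + v j"
    using HA.entry_eq_dist by blast
  obtain u' v' where uv': "\<forall>i<n. \<forall>j<n. B $$ (j, i) = - hilbert_dist (HB.column i) (HB.base j) / 2 + u' i + v' j"
    using HB.entry_eq_dist by blast
  have diff: "B $$ (j, i) - A $$ (j, i) = (u' i - u i) + (v' j - v j)" if "i < n" "j < n" for i j
    using uv[rule_format, OF that] uv'[rule_format, OF that] hd[OF that] by simp
  show ?thesis
  proof (rule simultaneous_scalingI[OF HA.A HB.A, of "\<lambda>i. ((u' i - u i) + (v' i - v i)) / 2"])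
    fix i j assume ij: "i < n" "j < n"
    have "2 * (B $$ (i, j) - A $$ (i, j)) = (u' i - u i) + (v' i - v i) + ((u' j - u j) + (v' j - v j))"
      using diff[OF ij] diff[OF ij(2,1)] HA.sym[OF ij] HB.sym[OF ij] by simp
    thus "B $$ (i, j) = A $$ (i, j) + ((u' i - u i) + (v' i - v i)) / 2 + ((u' j - u j) + (v' j - v j)) / 2"
      by (simp add: field_simps)
  qed
qed

lemma symbic_localeI:
  assumes n: "1 \<le> n" and T: "symbic_tree n T"
  shows "\<exists>d \<sigma>. symbic T d \<sigma> n"
proof -
  have ll: "leaf_labelled_tree (labels n n) T" and pos: "\<forall>e\<in>internal_edges T. 0 < len T e"
    and sp: "\<forall>S\<in>splits (labels n n) T. \<forall>B\<in>S. (\<exists>i. Unprimed i \<in> B) \<and> (\<exists>j. Primed j \<in> B)"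
    using T unfolding symbic_tree_def by blast+
  obtain \<sigma> where s: "ltree_iso_map (labels n n) T T swap_label \<sigma>" "\<forall>v\<in>nodes T. \<sigma> (\<sigma> v) = v"
    "forms_path T (fixed_points T \<sigma>)" using T unfolding symbic_tree_def by blast
  have "is_tree T" using ll unfolding leaf_labelled_tree_def by blast
  then obtain d where d: "realized_tree T d" using realized_tree_exists pos by blast
  have bij: "bij_betw \<sigma> (nodes T) (nodes T)" and sl: "\<And>l. l \<in> labels n n \<Longrightarrow> \<sigma> (leaf T l) = leaf T (swap_label l)"
    using s(1) unfolding ltree_iso_map_def by simp_all
  have "metric_tree T d" using d unfolding realized_tree_def by simp
  hence "tree_involution T d \<sigma>"
    using bij_betw_apply[OF bij] ltree_iso_dist[OF d d s(1)] s(2)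
    by (intro tree_involution.intro tree_involution_axioms.intro) auto
  hence "symbic T d \<sigma> n"
    using d n ll sp sl s(3) by (intro symbic.intro symbic_axioms.intro) auto
  thus ?thesis by blast
qed

theorem theorem2p4:
  fixes n :: nat
  assumes "n \<ge> 1"
  shows "(\<forall>A. symmetric_rank2_matrix n A \<longrightarrow> symbic_tree n (tree_of A)) \<and>
    (\<forall>T :: 'v ltree. symbic_tree n T \<longrightarrow>
       (\<exists>A. symmetric_rank2_matrix n A \<and> ltree_isomorphic (labels n n) T (tree_of A)) \<and>
       (\<forall>A B. symmetric_rank2_matrix n A \<and> ltree_isomorphic (labels n n) T (tree_of A) \<and>
              symmetric_rank2_matrix n B \<and> ltree_isomorphic (labels n n) T (tree_of B) \<longrightarrow>
              simultaneous_scaling A B))"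
proof (intro conjI allI impI)
  fix A assume "symmetric_rank2_matrix n A"
  then interpret symmetric_rank2 A n by (rule symmetric_rank2_localeI[OF _ assms])
  show "symbic_tree n (tree_of A)" by (rule symbic)
next
  fix T :: "'v ltree" assume "symbic_tree n T"
  then obtain d \<sigma> where "symbic T d \<sigma> n" using symbic_localeI[OF assms] by blast
  then interpret symbic T d \<sigma> n .
  show "\<exists>A. symmetric_rank2_matrix n A \<and> ltree_isomorphic (labels n n) T (tree_of A)"
    using A_symmetric_rank2 isomorphic_tree_of by blast
next
  fix T :: "'v ltree" and A B :: "real mat"
  assume "symbic_tree n T" and AB: "symmetric_rank2_matrix n A \<and> ltree_isomorphic (labels n n) T (tree_of A) \<and>
    symmetric_rank2_matrix n B \<and> ltree_isomorphic (labels n n) T (tree_of B)"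
  then obtain d \<sigma> where "symbic T d \<sigma> n" using symbic_localeI[OF assms] by blast
  then interpret symbic T d \<sigma> n .
  show "simultaneous_scaling A B"
    using tree_determines_matrix[OF realized_tree_axioms n] AB leaf_node by blast
qed

end
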